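(* Let $\{(\mathbb{X}_{\alpha}(t),\mathbb{V}_{\alpha}(t))\}_{t\ge0}$ be the telegraph process with generalized Mittag-Leffler waiting times and velocity driven by random trials (defined in the context). For $t>0$ and $-v_2t<x<v_1t$ put $\theta=\frac{v_2t+x}{v_1+v_2}$. Conditional on the event that the initial velocity is $v_1$, the absolutely continuous component of the probability law of $\mathbb{X}_\alpha(t)$ is expressed in terms of its forward and backward densities as follows: $$\begin{aligned}f(x,t|v_1)={}&\frac{1}{v_1+v_2}\sum_{n=2}^{\infty}\sum_{j=0}^{n-2}\binom{n-1}{j}\Big(\frac{b+c}{c}\Big)_{j+1}\Big(\frac rc\Big)_{n-j-1}\Big(\Big(\frac{b+r+c}{c}\Big)_n\Big)^{-1}\frac{(\mu(t-\theta)^\alpha)^{\frac rc+n-j-1}}{t-\theta}\\&\cdot(\lambda\theta^\alpha)^{\frac bc+j+1}E_{\alpha,\alpha(\frac rc+n-j-1)}^{\frac rc+n-j-1}(-\mu(t-\theta)^\alpha)\,E_{\alpha,\alpha(\frac bc+j+1)+1}^{\frac bc+j+2}(-\lambda\theta^\alpha)\end{aligned}$$ and $$\begin{aligned}b(x,t|v_1)={}&\frac{1}{v_1+v_2}\bigg(\sum_{n=1}^{\infty}\Big(\frac{b+c}{c}\Big)_{n-1}\Big(\Big(\frac{b+r+c}{c}\Big)_n\Big)^{-1}\frac{r(\lambda\theta^\alpha)^{\frac bc+n}}{c\,\theta}E_{\alpha,\alpha(\frac bc+n)}^{\frac bc+n}(-\lambda\theta^\alpha)\bar F_{L_1}(t-\theta)\\&+\sum_{n=2}^{\infty}\sum_{j=0}^{n-2}\binom{n-1}{j}\Big(\frac{b+c}{c}\Big)_{j}\Big(\frac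 rc\Big)_{n-j}\Big(\Big(\frac{b+r+c}{c}\Big)_n\Big)^{-1}\frac{(\lambda\theta^\alpha)^{\frac bc+j+1}}{\theta}(\mu(t-\theta)^\alpha)^{\frac rc+n-j-1}\\&\cdot E_{\alpha,\alpha(\frac bc+j+1)}^{\frac bc+j+1}(-\lambda\theta^\alpha)\,E_{\alpha,\alpha(\frac rc+n-j-1)+1}^{\frac rc+n-j}(-\mu(t-\theta)^\alpha)\bigg).\end{aligned}$$
   Context: Special functions: for $\alpha,\beta,\gamma>0$, $E_{\alpha,\beta}^{\gamma}(x)=\sum_{k\ge0}\frac{(\gamma)_kx^k}{k!\,\Gamma(\alpha k+\beta)}$, where $(\gamma)_k=\Gamma(\gamma+k)/\Gamma(\gamma)$ is the Pochhammer symbol; $E_{\alpha,\beta}=E^1_{\alpha,\beta}$. The process: fix $0<\alpha\le1$ and positive constants $v_1,v_2,\lambda,\mu,b,r,c$ (the constant $b$ is unrelated to the density $b(x,t|v_1)$). Let $\{Y_n\}_{n\ge1}$ be $\{0,1\}$-valued with $\mathrm{Pr}\{Y_1=1\}=\frac{b}{b+r}$ and, for $m\ge1$, $\mathrm{Pr}\{Y_{m+1}=1\mid Y_1,\dots,Y_m\}=\frac{b+c\sum_{i=1}^mY_i}{b+r+cm}$ (Pólya urn scheme). Let $\{R_n\}_{n\ge1}$, $\{L_n\}_{n\ge1}$ be sequences of independent positive random variables with densities, for $t>0$, $f_{R_1}(t)=\lambda^{\frac bc+1}t^{\alpha(\frac bc+1)-1}E_{\alpha,\alpha(\frac bc+1)}^{\frac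 bc+1}(-\lambda t^\alpha)$, $f_{L_1}(t)=\mu^{\frac rc+1}t^{\alpha(\frac rc+1)-1}E_{\alpha,\alpha(\frac rc+1)}^{\frac rc+1}(-\mu t^\alpha)$, and for $n\ge2$, $f_{R_n}(t)=\lambda t^{\alpha-1}E_{\alpha,\alpha}(-\lambda t^\alpha)$, $f_{L_n}(t)=\mu t^{\alpha-1}E_{\alpha,\alpha}(-\mu t^\alpha)$. The sequences $\{Y_n\}$, $\{R_n\}$, $\{L_n\}$ are mutually independent. $\bar F_{L_1}(t)=\mathrm{Pr}\{L_1>t\}$. For $n\ge0$ set $S_n=v_1$ if $Y_{n+1}=1$ and $S_n=-v_2$ if $Y_{n+1}=0$. Set $T_0=0$ and, for $n\ge0$, $T_{n+1}=T_n+R_i$ if $S_n=v_1$ and $Y_1+\dots+Y_n=i-1$, while $T_{n+1}=T_n+L_i$ if $S_n=-v_2$ and $Y_1+\dots+Y_n=n-i+1$. Let $\mathcal{N}(t)=\max\{n\ge0:T_n\le t\}$, $\mathbb{V}_\alpha(t)=S_{\mathcal{N}(t)}$ and $\mathbb{X}_\alpha(t)=\int_0^t\mathbb{V}_\alpha(s)\,\mathrm{d}s$. Forward and backward densities: on $-v_2t<x<v_1t$, $f(x,t|v_1)=\frac{\partial}{\partial x}\mathrm{Pr}\{\mathbb{X}_\alpha(t)\le x,\mathbb{V}_\alpha(t)=v_1\mid\mathbb{V}_\alpha(0)=v_1\}$ and $b(x,t|v_1)=\frac{\partial}{\partial x}\mathrm{Pr}\{\mathbb{X}_\alpha(t)\le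 x,\mathbb{V}_\alpha(t)=-v_2\mid\mathbb{V}_\alpha(0)=v_1\}$; the conditional density of the absolutely continuous part given initial velocity $v_1$ is $p(x,t|v_1)=f(x,t|v_1)+b(x,t|v_1)$. *)

theory Defs
  imports "HOL-Probability.Probability"
begin

text \<open>The three-parameter Mittag-Leffler function: \<open>ml3 \<alpha> \<beta> \<gamma> x\<close> is
  $E_{\alpha,\beta}^{\gamma}(x)$, and \<open>\<gamma> = 1\<close> gives $E_{\alpha,\beta}(x)$.\<close>

definition ml3 :: "real \<Rightarrow> real \<Rightarrow> real \<Rightarrow> real \<Rightarrow> real" where
  "ml3 \<alpha> \<beta> \<gamma> x = (\<Sum>k. pochhammer \<gamma> k * x ^ k / (fact k * Gamma (\<alpha> * real k + \<beta>)))"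

text \<open>\<open>X\<close> is an (almost surely) positive random variable whose density is \<open>g\<close> on the positive
  half-line. That \<open>g\<close> is nonnegative is part of being a density; it has to be said because
  \<^const>\<open>ennreal\<close> truncates negative values to \<open>0\<close>.\<close>

definition has_pos_density :: "'a measure \<Rightarrow> ('a \<Rightarrow> real) \<Rightarrow> (real \<Rightarrow> real) \<Rightarrow> bool" where
  "has_pos_density M X g \<longleftrightarrow>
     (\<forall>t>0. 0 \<le> g t) \<and>
     distributed M lborel X (\<lambda>t. ennreal (if 0 < t then g t else 0))"

text \<open>The sequences \<open>Y\<close>, \<open>R\<close>, \<open>L\<close> are indexed from \<open>1\<close>; their entries at \<open>0\<close> are never used.
  In \<open>polya_step\<close> conditioning on the discrete vector \<open>(Y 1, \<dots>, Y m)\<close> is conditioning on each of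
  its values of positive probability. In \<open>indep_YRL\<close> the three sequences are three random
  elements of the space of real sequences, hence the embedding of \<open>Y\<close> into the reals.\<close>

locale ml_telegraph = prob_space M
  for M :: "'a measure" +
  fixes \<alpha> v1 v2 lam \<mu> b r c :: real
    and Y :: "nat \<Rightarrow> 'a \<Rightarrow> nat"
    and R L :: "nat \<Rightarrow> 'a \<Rightarrow> real"
  assumes alpha: "0 < \<alpha>" "\<alpha> \<le> 1"
    and positive: "0 < v1" "0 < v2" "0 < lam" "0 < \<mu>" "0 < b" "0 < r" "0 < c"
    and Y_measurable: "\<And>n. 1 \<le> n \<Longrightarrow> Y n \<in> measurable M (count_space UNIV)"
    and Y_01: "\<And>n \<omega>. 1 \<le> n \<Longrightarrow> \<omega> \<in> space M \<Longrightarrow> Y n \<omega> \<in> {0, 1}"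
    and polya_first: "\<P>(\<omega> in M. Y 1 \<omega> = 1) = b / (b + r)"
    and polya_step: "\<And>m y. 1 \<le> m \<Longrightarrow> \<P>(\<omega> in M. \<forall>i\<in>{1..m}. Y i \<omega> = y i) > 0 \<Longrightarrow>
        \<P>(\<omega> in M. Y (m + 1) \<omega> = 1 \<bar> \<forall>i\<in>{1..m}. Y i \<omega> = y i)
          = (b + c * (\<Sum>i = 1..m. real (y i))) / (b + r + c * real m)"
    and R_first: "has_pos_density M (R 1)
        (\<lambda>t. lam powr (b / c + 1) * t powr (\<alpha> * (b / c + 1) - 1)
               * ml3 \<alpha> (\<alpha> * (b / c + 1)) (b / c + 1) (- lam * t powr \<alpha>))"
    and L_first: "has_pos_density M (L 1)
        (\<lambda>t. \<mu> powr (r / c + 1) * t powr (\<alpha> * (r / c + 1) - 1)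
               * ml3 \<alpha> (\<alpha> * (r / c + 1)) (r / c + 1) (- \<mu> * t powr \<alpha>))"
    and R_later: "\<And>n. 2 \<le> n \<Longrightarrow> has_pos_density M (R n)
        (\<lambda>t. lam * t powr (\<alpha> - 1) * ml3 \<alpha> \<alpha> 1 (- lam * t powr \<alpha>))"
    and L_later: "\<And>n. 2 \<le> n \<Longrightarrow> has_pos_density M (L n)
        (\<lambda>t. \<mu> * t powr (\<alpha> - 1) * ml3 \<alpha> \<alpha> 1 (- \<mu> * t powr \<alpha>))"
    and indep_R: "indep_vars (\<lambda>_. borel) R {1..}"
    and indep_L: "indep_vars (\<lambda>_. borel) L {1..}"
    and indep_YRL: "indep_vars (\<lambda>_. \<Pi>\<^sub>M n\<in>{1..}. (borel :: real measure))
        (\<lambda>k \<omega>. \<lambda>n\<in>{1..}. [real (Y n \<omega>), R n \<omega>, L n \<omega>] ! k) {..<3}"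

definition trial_velocity :: "real \<Rightarrow> real \<Rightarrow> (nat \<Rightarrow> 'a \<Rightarrow> nat) \<Rightarrow> nat \<Rightarrow> 'a \<Rightarrow> real" where
  "trial_velocity v1 v2 Y n \<omega> = (if Y (n + 1) \<omega> = 1 then v1 else - v2)"

text \<open>The waiting time after epoch \<open>n\<close> is \<open>R i\<close> with \<open>i - 1\<close> the number of ones, or \<open>L i\<close> with
  \<open>i - 1\<close> the number of zeros, among the first \<open>n\<close> trials.\<close>

primrec epoch ::
  "real \<Rightarrow> real \<Rightarrow> (nat \<Rightarrow> 'a \<Rightarrow> nat) \<Rightarrow> (nat \<Rightarrow> 'a \<Rightarrow> real) \<Rightarrow> (nat \<Rightarrow> 'a \<Rightarrow> real) \<Rightarrow>
    nat \<Rightarrow> 'a \<Rightarrow> real" where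
  "epoch v1 v2 Y R L 0 \<omega> = 0"
| "epoch v1 v2 Y R L (Suc n) \<omega> = epoch v1 v2 Y R L n \<omega> +
     (if trial_velocity v1 v2 Y n \<omega> = v1
      then R ((\<Sum>i = 1..n. Y i \<omega>) + 1) \<omega>
      else L (n + 1 - (\<Sum>i = 1..n. Y i \<omega>)) \<omega>)"

text \<open>Almost surely the epochs increase to infinity, so that the set below is finite. It always
  contains \<open>0\<close> for \<open>t \<ge> 0\<close>.\<close>

definition counting ::
  "real \<Rightarrow> real \<Rightarrow> (nat \<Rightarrow> 'a \<Rightarrow> nat) \<Rightarrow> (nat \<Rightarrow> 'a \<Rightarrow> real) \<Rightarrow> (nat \<Rightarrow> 'a \<Rightarrow> real) \<Rightarrow>
    real \<Rightarrow> 'a \<Rightarrow> nat" where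
  "counting v1 v2 Y R L t \<omega> = Max {n. epoch v1 v2 Y R L n \<omega> \<le> t}"

definition velocity ::
  "real \<Rightarrow> real \<Rightarrow> (nat \<Rightarrow> 'a \<Rightarrow> nat) \<Rightarrow> (nat \<Rightarrow> 'a \<Rightarrow> real) \<Rightarrow> (nat \<Rightarrow> 'a \<Rightarrow> real) \<Rightarrow>
    real \<Rightarrow> 'a \<Rightarrow> real" where
  "velocity v1 v2 Y R L t \<omega> = trial_velocity v1 v2 Y (counting v1 v2 Y R L t \<omega>) \<omega>"

definition position ::
  "real \<Rightarrow> real \<Rightarrow> (nat \<Rightarrow> 'a \<Rightarrow> nat) \<Rightarrow> (nat \<Rightarrow> 'a \<Rightarrow> real) \<Rightarrow> (nat \<Rightarrow> 'a \<Rightarrow> real) \<Rightarrow>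
    real \<Rightarrow> 'a \<Rightarrow> real" where
  "position v1 v2 Y R L t \<omega> = (LBINT s:{0..t}. velocity v1 v2 Y R L s \<omega>)"

text \<open>\<open>joint_cdf M v1 v2 Y R L t v x\<close> is
  $\mathrm{Pr}\{X(t) \le x, V(t) = v \mid V(0) = v_1\}$.\<close>

definition joint_cdf ::
  "'a measure \<Rightarrow> real \<Rightarrow> real \<Rightarrow> (nat \<Rightarrow> 'a \<Rightarrow> nat) \<Rightarrow> (nat \<Rightarrow> 'a \<Rightarrow> real) \<Rightarrow>
    (nat \<Rightarrow> 'a \<Rightarrow> real) \<Rightarrow> real \<Rightarrow> real \<Rightarrow> real \<Rightarrow> real" where
  "joint_cdf M v1 v2 Y R L t v x =
     \<P>(\<omega> in M. position v1 v2 Y R L t \<omega> \<le> x \<and> velocity v1 v2 Y R L t \<omega> = v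
          \<bar> velocity v1 v2 Y R L 0 \<omega> = v1)"

definition forward_density ::
  "'a measure \<Rightarrow> real \<Rightarrow> real \<Rightarrow> (nat \<Rightarrow> 'a \<Rightarrow> nat) \<Rightarrow> (nat \<Rightarrow> 'a \<Rightarrow> real) \<Rightarrow>
    (nat \<Rightarrow> 'a \<Rightarrow> real) \<Rightarrow> real \<Rightarrow> real \<Rightarrow> real" where
  "forward_density M v1 v2 Y R L x t = deriv (joint_cdf M v1 v2 Y R L t v1) x"

definition backward_density ::
  "'a measure \<Rightarrow> real \<Rightarrow> real \<Rightarrow> (nat \<Rightarrow> 'a \<Rightarrow> nat) \<Rightarrow> (nat \<Rightarrow> 'a \<Rightarrow> real) \<Rightarrow>
    (nat \<Rightarrow> 'a \<Rightarrow> real) \<Rightarrow> real \<Rightarrow> real \<Rightarrow> real" where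
  "backward_density M v1 v2 Y R L x t = deriv (joint_cdf M v1 v2 Y R L t (- v2)) x"

definition position_law ::
  "'a measure \<Rightarrow> real \<Rightarrow> real \<Rightarrow> (nat \<Rightarrow> 'a \<Rightarrow> nat) \<Rightarrow> (nat \<Rightarrow> 'a \<Rightarrow> real) \<Rightarrow>
    (nat \<Rightarrow> 'a \<Rightarrow> real) \<Rightarrow> real \<Rightarrow> real measure" where
  "position_law M v1 v2 Y R L t =
     distr (uniform_measure M {\<omega> \<in> space M. velocity v1 v2 Y R L 0 \<omega> = v1})
       borel (position v1 v2 Y R L t)"

text \<open>Lebesgue decomposition: \<open>N\<close> is the sum of the measure with Lebesgue density \<open>p\<close> and of a
  measure \<open>\<nu>\<close> that is singular to Lebesgue measure.\<close>

definition has_ac_component :: "real measure \<Rightarrow> (real \<Rightarrow> real) \<Rightarrow> bool" where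
  "has_ac_component N p \<longleftrightarrow>
     p \<in> borel_measurable borel \<and> (\<forall>x. 0 \<le> p x) \<and>
     (\<exists>\<nu> Z. sets \<nu> = sets borel \<and> Z \<in> null_sets lborel \<and> emeasure \<nu> (- Z) = 0 \<and>
        (\<forall>A\<in>sets borel. emeasure N A = emeasure (density lborel (\<lambda>x. ennreal (p x))) A
                                        + emeasure \<nu> A))"

end

theory Submission
  imports Defs
begin

text \<open>
  Let \<open>\<theta>\<close> be the time spent at velocity \<open>v1\<close> up to time \<open>t\<close>. The position is
  \<open>v1 * \<theta> - v2 * (t - \<theta>)\<close>, so the law of the position is an affine image of the law of \<open>\<theta>\<close>.

  If \<open>k\<close> of the first \<open>n\<close> trials are ones, then the \<open>n\<close>-th epoch is
  \<open>(R 1 + \<dots> + R k) + (L 1 + \<dots> + L (n - k))\<close>: the order of the trials does not matter, each family of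
  waiting times is used up in its own order (\<open>epoch_eq\<close>). Suppose that \<open>t\<close> lies between epochs \<open>n\<close>
  and \<open>n + 1\<close>. If the velocity at \<open>t\<close> is \<open>v1\<close>, then all backward motion so far consists of complete
  waiting times, so that \<open>t - \<theta> = L 1 + \<dots> + L (n - k)\<close>, while \<open>\<theta>\<close> lies between the \<open>k\<close>-th and the
  \<open>(k + 1)\<close>-st partial sum of \<open>R\<close>. At velocity \<open>- v2\<close> the roles of the two families are exchanged.
  Because the urn, \<open>R\<close> and \<open>L\<close> are independent, each pair \<open>(n, k)\<close> contributes to the density of
  \<open>\<theta>\<close> the product of three factors (\<open>forward_event\<close>, \<open>backward_event\<close>).

  \<^item> The probability of \<open>k\<close> ones followed by the required trial. The number of ones is a Markov
    chain, and its law follows by induction (\<open>polya_ones\<close>).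
  \<^item> The density of the completed sum. The density with Laplace transform
    $(\lambda / (s^\alpha + \lambda))^\gamma$ is \<open>gml\<close>, and the exponents add under convolution.
    This is proved on the power series: the Beta integral convolves the powers and the Vandermonde
    identity for Pochhammer symbols adds up the coefficients (\<open>prabhakar_convolution\<close>).
  \<^item> The probability that the other sum straddles the remaining time. It is a difference of two
    distribution functions, which Pascal's rule turns into one Mittag-Leffler function
    (\<open>gml_cdf_diff\<close>).

  The density of \<open>\<theta>\<close> is the sum of these products. The Gamma function in the denominators outgrows
  every geometric sequence: \<open>\<Gamma> \<beta> \<ge> M powr (\<beta> - 1) * exp (- M)\<close> for every \<open>M \<ge> 1\<close>, and a large \<open>M\<close> bounds the
  sum geometrically and uniformly on compact subintervals (\<open>ml3_weighted_bound\<close>). Hence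
  the density is continuous, the distribution functions are differentiable at every interior point
  and not only almost everywhere, and the epochs tend to infinity. The rest of the law of the
  position sits on the two points \<open>- v2 * t\<close> and \<open>v1 * t\<close>, which form a null set.
\<close>

section \<open>Growth of the Mittag-Leffler function\<close>

text \<open>For \<open>\<beta> \<ge> 1\<close> keep only the part of the Gamma integral over
  \<open>t \<ge> M\<close>; for \<open>\<beta> < 1\<close> go to \<open>\<beta> + 1\<close> by
  the functional equation. The freedom in \<open>M\<close> is what makes all series below
  converge geometrically with any prescribed ratio.\<close>

lemma Gamma_ge_powr:
  fixes M \<beta> :: real
  assumes M: "1 \<le> M" and \<beta>: "0 < \<beta>"
  shows "M powr (\<beta> - 1) * exp (- M) \<le> Gamma \<beta>"
proof -
  have ge1: "M powr (x - 1) * exp (- M) \<le> Gamma x" if x: "1 \<le> x" for x :: real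
  proof -
    \<comment> \<open>On \<open>t \<ge> M\<close> the Gamma integrand is at least \<open>M powr (x - 1) * exp (- t)\<close>.\<close>
    have "((\<lambda>t. exp (- 1 * t)) has_integral exp (- 1 * M) / 1) {M..}"
      by (rule has_integral_exp_minus_to_infinity) simp
    hence "((\<lambda>t. M powr (x - 1) * exp (- t)) has_integral (M powr (x - 1) * exp (- M))) {M..}"
      by (intro has_integral_mult_right) simp
    hence 1: "((\<lambda>t. if t \<in> {M..} then M powr (x - 1) * exp (- t) else 0)
        has_integral (M powr (x - 1) * exp (- M))) {0..}"
      using M by (subst has_integral_restrict) auto
    have 2: "((\<lambda>t. t powr (x - 1) / exp t) has_integral Gamma x) {0..}"
      using x by (intro Gamma_integral_real) simp
    show ?thesis
    proof (rule has_integral_le[OF 1 2])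
      fix t :: real assume "t \<in> {0..}"
      show "(if t \<in> {M..} then M powr (x - 1) * exp (- t) else 0) \<le> t powr (x - 1) / exp t"
        using M x by (auto simp: exp_minus divide_inverse intro!: mult_right_mono powr_mono2)
    qed
  qed
  show ?thesis
  proof (cases "1 \<le> \<beta>")
    case True
    then show ?thesis by (rule ge1)
  next
    case False
    have "M powr (\<beta> - 1) * exp (- M) \<le> M powr \<beta> * exp (- M)"
      using M by (intro mult_right_mono powr_mono) auto
    also have "\<dots> \<le> Gamma (\<beta> + 1)"
      using ge1[of "\<beta> + 1"] \<beta> by simp
    also have "\<dots> = \<beta> * Gamma \<beta>"
      using \<beta> by (intro Gamma_plus1) (auto elim!: nonpos_Ints_cases)
    also have "\<dots> \<le> 1 * Gamma \<beta>"
      using \<beta> False Gamma_real_pos[of \<beta>] by (intro mult_right_mono) auto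
    finally show ?thesis by simp
  qed
qed

lemma pochhammer_nonneg_real: "0 \<le> (\<gamma>::real) \<Longrightarrow> 0 \<le> pochhammer \<gamma> k"
  by (cases "\<gamma> = 0") (auto simp: pochhammer_0_left pochhammer_pos intro: less_imp_le)

text \<open>The numbers \<open>pochhammer \<gamma> k / fact k\<close> are the coefficients of
  $(1 - z)^{-\gamma}$. At \<open>z = 1/2\<close> all terms are nonnegative, so each is at most
  the sum.\<close>

lemma pochhammer_fact_le:
  fixes \<gamma> :: real
  assumes "0 \<le> \<gamma>"
  shows "pochhammer \<gamma> k / fact k \<le> 2 powr \<gamma> * 2 ^ k"
proof -
  let ?a = "\<lambda>k. pochhammer \<gamma> k / fact k * (1/2) ^ k"
  have "(\<lambda>k. ((- \<gamma>) gchoose k) * (- (1/2)) ^ k) sums (1 + - (1/2)) powr (- \<gamma>)"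
    by (rule gen_binomial_real) simp
  also have "(\<lambda>k. ((- \<gamma>) gchoose k) * (- (1/2)) ^ k) = ?a"
  proof
    fix k
    have "(- 1) ^ k * (- (1/2)) ^ k = (1/2 :: real) ^ k" by (simp flip: power_mult_distrib)
    thus "((- \<gamma>) gchoose k) * (- (1/2)) ^ k = ?a k"
      unfolding gbinomial_pochhammer minus_minus by (metis mult.commute mult.left_commute times_divide_eq_left)
  qed
  finally have s: "?a sums (2 powr \<gamma>)"
    by (simp add: powr_minus powr_divide field_simps)
  have "?a k \<le> suminf ?a"
    using s assms sum_le_suminf[of ?a "{k}"] by (auto simp: sums_iff pochhammer_nonneg_real)
  also have "\<dots> = 2 powr \<gamma>" using s by (simp add: sums_iff)
  finally show ?thesis by (simp add: field_simps)
qed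

lemma ml3_term_bound:
  fixes \<alpha> \<beta> \<gamma> x M :: real
  assumes "0 < \<alpha>" "0 < \<beta>" "0 \<le> \<gamma>" and M: "1 \<le> M"
  shows "norm (pochhammer \<gamma> k * x ^ k / (fact k * Gamma (\<alpha> * real k + \<beta>)))
    \<le> M * exp M * 2 powr \<gamma> * M powr (- \<beta>) * (2 * \<bar>x\<bar> / M powr \<alpha>) ^ k"
proof -
  let ?b = "\<alpha> * real k + \<beta>"
  have b: "0 < ?b" using assms by (simp add: add_nonneg_pos)
  have G: "0 < Gamma ?b" using b by (rule Gamma_real_pos)
  have "1 / Gamma ?b \<le> 1 / (M powr (?b - 1) * exp (- M))"
    using Gamma_ge_powr[OF M b] M G by (intro divide_left_mono mult_pos_pos) auto
  also have "\<dots> = M * exp M * M powr (- \<beta>) / (M powr \<alpha>) ^ k"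
    using M by (simp add: powr_diff powr_add powr_minus exp_minus field_simps
        powr_powr flip: powr_realpow)
  finally have 1: "1 / Gamma ?b \<le> M * exp M * M powr (- \<beta>) / (M powr \<alpha>) ^ k" .
  have "norm (pochhammer \<gamma> k * x ^ k / (fact k * Gamma ?b))
      = pochhammer \<gamma> k / fact k * \<bar>x\<bar> ^ k * (1 / Gamma ?b)"
    using G assms by (simp add: abs_mult power_abs pochhammer_nonneg_real)
  also have "\<dots> \<le> (2 powr \<gamma> * 2 ^ k) * \<bar>x\<bar> ^ k * (M * exp M * M powr (- \<beta>) / (M powr \<alpha>) ^ k)"
    using 1 pochhammer_fact_le[OF assms(3), of k] G assms
    by (intro mult_mono) (auto simp: pochhammer_nonneg_real)
  also have "\<dots> = M * exp M * 2 powr \<gamma> * M powr (- \<beta>) * (2 * \<bar>x\<bar> / M powr \<alpha>) ^ k"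
    by (simp add: power_divide power_mult_distrib)
  finally show ?thesis .
qed

lemma ml3_scale_exists:
  fixes \<alpha> x :: real
  assumes "0 < \<alpha>"
  obtains M where "1 \<le> M" "x \<le> M powr \<alpha>"
proof
  show "1 \<le> max 1 (\<bar>x\<bar> powr (1 / \<alpha>))" by simp
  have "x \<le> (\<bar>x\<bar> powr (1 / \<alpha>)) powr \<alpha>" using assms by (simp add: powr_powr)
  also have "\<dots> \<le> max 1 (\<bar>x\<bar> powr (1 / \<alpha>)) powr \<alpha>"
    using assms by (intro powr_mono2) auto
  finally show "x \<le> max 1 (\<bar>x\<bar> powr (1 / \<alpha>)) powr \<alpha>" .
qed

lemma
  fixes \<alpha> \<beta> \<gamma> x :: real
  assumes "0 < \<alpha>" "0 < \<beta>" "0 \<le> \<gamma>"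
  shows ml3_summable_norm:
      "summable (\<lambda>k. norm (pochhammer \<gamma> k * x ^ k / (fact k * Gamma (\<alpha> * real k + \<beta>))))"
    and ml3_sums: "(\<lambda>k. pochhammer \<gamma> k * x ^ k / (fact k * Gamma (\<alpha> * real k + \<beta>)))
      sums ml3 \<alpha> \<beta> \<gamma> x"
proof -
  obtain M where M: "1 \<le> M" "4 * \<bar>x\<bar> \<le> M powr \<alpha>"
    using ml3_scale_exists[OF assms(1)] .
  have "0 < M powr \<alpha>" using M by simp
  hence "2 * \<bar>x\<bar> < M powr \<alpha>" using M by linarith
  hence "norm (2 * \<bar>x\<bar> / M powr \<alpha>) < 1" by (simp add: divide_less_eq)
  hence "summable (\<lambda>k. M * exp M * 2 powr \<gamma> * M powr (- \<beta>) * (2 * \<bar>x\<bar> / M powr \<alpha>) ^ k)"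
    by (intro summable_mult summable_geometric)
  thus "summable (\<lambda>k. norm (pochhammer \<gamma> k * x ^ k / (fact k * Gamma (\<alpha> * real k + \<beta>))))"
    by (rule summable_comparison_test') (subst real_norm_def, subst abs_norm_cancel, rule ml3_term_bound[OF assms M(1)])
  from summable_norm_cancel[OF this]
  show "(\<lambda>k. pochhammer \<gamma> k * x ^ k / (fact k * Gamma (\<alpha> * real k + \<beta>))) sums ml3 \<alpha> \<beta> \<gamma> x"
    by (simp add: ml3_def summable_sums)
qed

lemma ml3_bound:
  fixes \<alpha> \<beta> \<gamma> x M :: real
  assumes "0 < \<alpha>" "0 < \<beta>" "0 \<le> \<gamma>" and M: "1 \<le> M" "4 * \<bar>x\<bar> \<le> M powr \<alpha>"
  shows "\<bar>ml3 \<alpha> \<beta> \<gamma> x\<bar> \<le> 2 * (M * exp M * 2 powr \<gamma> * M powr (- \<beta>))"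
proof -
  let ?C = "M * exp M * 2 powr \<gamma> * M powr (- \<beta>)"
  have "2 * \<bar>x\<bar> / M powr \<alpha> \<le> 1/2" using M by (auto simp: field_simps)
  hence le: "(2 * \<bar>x\<bar> / M powr \<alpha>) ^ k \<le> (1/2) ^ k" for k by (intro power_mono) auto
  have s: "(\<lambda>k. ?C * (1/2) ^ k) sums (?C * (1 / (1 - 1/2)))"
    by (intro sums_mult geometric_sums) simp
  have "\<bar>ml3 \<alpha> \<beta> \<gamma> x\<bar> = norm (\<Sum>k. pochhammer \<gamma> k * x ^ k / (fact k * Gamma (\<alpha> * real k + \<beta>)))"
    by (simp add: ml3_def)
  also have "\<dots> \<le> (\<Sum>k. ?C * (1/2) ^ k)"
  proof (rule norm_suminf_le)
    fix k
    have "norm (pochhammer \<gamma> k * x ^ k / (fact k * Gamma (\<alpha> * real k + \<beta>)))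
      \<le> ?C * (2 * \<bar>x\<bar> / M powr \<alpha>) ^ k" by (rule ml3_term_bound) (use assms in auto)
    also have "\<dots> \<le> ?C * (1/2) ^ k" using M by (intro mult_left_mono le) auto
    finally show "norm (pochhammer \<gamma> k * x ^ k / (fact k * Gamma (\<alpha> * real k + \<beta>))) \<le> ?C * (1/2) ^ k" .
  qed (use s in \<open>simp add: sums_iff\<close>)
  also have "\<dots> = 2 * ?C" using s by (simp add: sums_iff)
  finally show ?thesis .
qed

text \<open>The factor \<open>x powr \<gamma>'\<close> grows like a power of \<open>x\<close>, but the index
  \<open>\<beta> \<ge> \<alpha> * \<gamma>'\<close> contributes
  \<open>M powr (- \<alpha> * \<gamma>')\<close>, which wins as soon as
  \<open>M powr \<alpha> \<ge> 8 * x\<close>. The slack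
  \<open>\<gamma> \<le> \<gamma>' + 1\<close> covers densities, distribution functions and
  differences of distribution functions at once. The ratio \<open>1/4\<close> leaves room for
  the number of terms in a row of the final double series.\<close>

lemma ml3_weighted_bound:
  fixes \<alpha> \<beta> \<gamma> \<gamma>' x M :: real
  assumes "0 < \<alpha>" "0 < \<gamma>'" "0 \<le> \<gamma>" "\<gamma> \<le> \<gamma>' + 1" "\<alpha> * \<gamma>' \<le> \<beta>"
    and M: "1 \<le> M" "8 * x \<le> M powr \<alpha>" and x: "0 \<le> x"
  shows "\<bar>x powr \<gamma>' * ml3 \<alpha> \<beta> \<gamma> (- x)\<bar> \<le> 4 * M * exp M * (1/4) powr \<gamma>'"
proof -
  have \<beta>: "0 < \<beta>" using assms by (smt (verit) mult_pos_pos)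
  have "\<bar>ml3 \<alpha> \<beta> \<gamma> (- x)\<bar> \<le> 2 * (M * exp M * 2 powr \<gamma> * M powr (- \<beta>))"
    by (rule ml3_bound) (use assms \<beta> in auto)
  also have "\<dots> \<le> 2 * (M * exp M * 2 powr (\<gamma>' + 1) * M powr (- (\<alpha> * \<gamma>')))"
    using assms by (intro mult_left_mono mult_mono[OF mult_left_mono] powr_mono) auto
  finally have *: "\<bar>ml3 \<alpha> \<beta> \<gamma> (- x)\<bar> \<le> 2 * (M * exp M * 2 powr (\<gamma>' + 1) * M powr (- (\<alpha> * \<gamma>')))" .
  have "x powr \<gamma>' \<le> (M powr \<alpha> / 8) powr \<gamma>'"
    using assms by (intro powr_mono2) auto
  also have "\<dots> = M powr (\<alpha> * \<gamma>') / 8 powr \<gamma>'"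
    using M by (simp add: powr_divide powr_powr)
  finally have "x powr \<gamma>' \<le> M powr (\<alpha> * \<gamma>') / 8 powr \<gamma>'" .
  hence "\<bar>x powr \<gamma>' * ml3 \<alpha> \<beta> \<gamma> (- x)\<bar> \<le>
     (M powr (\<alpha> * \<gamma>') / 8 powr \<gamma>') * (2 * (M * exp M * 2 powr (\<gamma>' + 1) * M powr (- (\<alpha> * \<gamma>'))))"
    unfolding abs_mult using * by (intro mult_mono) auto
  also have "\<dots> = 4 * M * exp M * (2 powr \<gamma>' / 8 powr \<gamma>')"
    using M by (simp add: powr_add powr_minus field_simps)
  also have "2 powr \<gamma>' / 8 powr \<gamma>' = (1/4) powr \<gamma>'"
    by (simp flip: powr_divide)
  finally show ?thesis .
qed

lemma continuous_on_ml3: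
  fixes \<alpha> \<beta> \<gamma> :: real
  assumes "0 < \<alpha>" "0 < \<beta>" "0 \<le> \<gamma>"
  shows "continuous_on UNIV (ml3 \<alpha> \<beta> \<gamma>)"
proof -
  let ?c = "\<lambda>k. pochhammer \<gamma> k / (fact k * Gamma (\<alpha> * real k + \<beta>))"
  have eq: "ml3 \<alpha> \<beta> \<gamma> = (\<lambda>x. \<Sum>k. ?c k * x ^ k)" by (simp add: ml3_def fun_eq_iff mult_ac)
  have "isCont (ml3 \<alpha> \<beta> \<gamma>) x" for x
    unfolding eq
  proof (rule isCont_powser)
    show "summable (\<lambda>k. ?c k * (\<bar>x\<bar> + 1) ^ k)"
      using ml3_sums[OF assms, of "\<bar>x\<bar> + 1"] by (simp add: sums_iff mult_ac)
  qed auto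
  thus ?thesis by (simp add: continuous_on_eq_continuous_at)
qed

section \<open>Convolution of Mittag-Leffler kernels\<close>

lemma has_bochner_integral_nonneg:
  fixes x :: real
  assumes "has_bochner_integral M f x" "\<And>s. 0 \<le> f s"
  shows "0 \<le> x"
  using assms by (metis Bochner_Integration.integral_nonneg has_bochner_integral_integral_eq)

text \<open>The Prabhakar kernel, whose Laplace transform is
  $s^{\alpha\gamma - \beta} (s^\alpha + \kappa)^{-\gamma}$.\<close>

definition prabhakar :: "real \<Rightarrow> real \<Rightarrow> real \<Rightarrow> real \<Rightarrow> real \<Rightarrow> real" where
  "prabhakar \<alpha> \<beta> \<gamma> \<kappa> t = t powr (\<beta> - 1) * ml3 \<alpha> \<beta> \<gamma> (- \<kappa> * t powr \<alpha>)"

lemma nn_integral_Beta_scaled: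
  fixes a b t :: real
  assumes "0 < a" "0 < b" "0 < t"
  shows "(\<integral>\<^sup>+s. ennreal (indicator {0<..<t} s * (s powr (a - 1) * (t - s) powr (b - 1))) \<partial>lborel)
    = ennreal (t powr (a + b - 1) * Beta a b)"
proof -
  have "((\<lambda>s. s powr (a - 1) * (1 - s) powr (b - 1)) has_integral Beta a b) {0<..<1}"
    using has_integral_Beta_real[OF assms(1,2)]
    by (subst has_integral_Icc_iff_Ioo[symmetric]) 
  hence "((\<lambda>s. if s \<in> {0<..<1} then s powr (a - 1) * (1 - s) powr (b - 1) else 0) has_integral Beta a b) UNIV"
    by (subst has_integral_restrict_UNIV)
  hence "((\<lambda>s. indicator {0<..<1} s * (s powr (a - 1) * (1 - s) powr (b - 1))) has_integral Beta a b) UNIV"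
    by (rule has_integral_eq[rotated]) (auto simp: indicator_def)
  hence B: "(\<integral>\<^sup>+s. ennreal (indicator {0<..<1} s * (s powr (a - 1) * (1 - s) powr (b - 1))) \<partial>lborel) = ennreal (Beta a b)"
    by (intro nn_integral_has_integral_lborel) auto
  have "(\<integral>\<^sup>+s. ennreal (indicator {0<..<t} s * (s powr (a - 1) * (t - s) powr (b - 1))) \<partial>lborel)
     = ennreal \<bar>t\<bar> * (\<integral>\<^sup>+s. ennreal (indicator {0<..<t} (0 + t * s) * ((0 + t * s) powr (a - 1) * (t - (0 + t * s)) powr (b - 1))) \<partial>lborel)"
    using assms by (intro nn_integral_real_affine) auto
  also have "\<dots> = ennreal t * (\<integral>\<^sup>+s. ennreal (t powr (a + b - 2)) * 
      ennreal (indicator {0<..<1} s * (s powr (a - 1) * (1 - s) powr (b - 1))) \<partial>lborel)"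
  proof -
    have "indicator {0<..<t} (0 + t * s) * ((0 + t * s) powr (a - 1) * (t - (0 + t * s)) powr (b - 1))
       = t powr (a + b - 2) * (indicator {0<..<1} s * (s powr (a - 1) * (1 - s) powr (b - 1)))" for s
    proof (cases "0 < s \<and> s < 1")
      case True
      have "t - (0 + t * s) = t * (1 - s)" by (simp add: algebra_simps)
      moreover have "a + b - 2 = (a - 1) + (b - 1)" by simp
      ultimately show ?thesis using True assms
        by (simp only: powr_add) (simp add: powr_mult)
    next
      case False
      then show ?thesis using assms by (auto simp: indicator_def zero_less_mult_iff)
    qed
    thus ?thesis using assms by (simp add: ennreal_mult' )
  qed
  also have "\<dots> = ennreal t * (ennreal (t powr (a + b - 2)) * ennreal (Beta a b))"
    by (subst nn_integral_cmult) (auto simp: B)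
  also have "\<dots> = ennreal (t * t powr (a + b - 2) * Beta a b)"
    using assms by (simp add: mult.assoc flip: ennreal_mult')
  also have "t * t powr (a + b - 2) = t powr (a + b - 1)"
    using assms by (metis add_diff_eq diff_add_cancel mult.commute one_add_one powr_mult_base less_imp_le
        add.commute diff_diff_eq2)
  finally show ?thesis .
qed

lemma has_bochner_integral_Beta_Gamma:
  fixes a b t :: real
  assumes "0 < a" "0 < b" "0 < t"
  shows "has_bochner_integral lborel
    (\<lambda>s. indicator {0<..<t} s * (s powr (a - 1) / Gamma a * ((t - s) powr (b - 1) / Gamma b)))
    (t powr (a + b - 1) / Gamma (a + b))"
proof (rule has_bochner_integral_nn_integral)
  have G: "0 < Gamma a" "0 < Gamma b" "0 < Gamma (a + b)" using assms by (auto intro!: Gamma_real_pos)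
  have "(\<integral>\<^sup>+s. ennreal (indicator {0<..<t} s * (s powr (a - 1) / Gamma a * ((t - s) powr (b - 1) / Gamma b))) \<partial>lborel)
     = (\<integral>\<^sup>+s. ennreal (1 / (Gamma a * Gamma b)) * ennreal (indicator {0<..<t} s * (s powr (a - 1) * (t - s) powr (b - 1))) \<partial>lborel)"
    using G by (intro nn_integral_cong) (auto simp: indicator_def simp flip: ennreal_mult')
  also have "\<dots> = ennreal (1 / (Gamma a * Gamma b)) * ennreal (t powr (a + b - 1) * Beta a b)"
    by (subst nn_integral_cmult) (auto simp: nn_integral_Beta_scaled assms)
  also have "\<dots> = ennreal (t powr (a + b - 1) / Gamma (a + b))"
    using G by (simp add: Beta_def flip: ennreal_mult')
  finally show "(\<integral>\<^sup>+s. ennreal (indicator {0<..<t} s * (s powr (a - 1) / Gamma a * ((t - s) powr (b - 1) / Gamma b))) \<partial>lborel)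
     = ennreal (t powr (a + b - 1) / Gamma (a + b))" .
  show "AE s in lborel. 0 \<le> indicator {0<..<t} s * (s powr (a - 1) / Gamma a * ((t - s) powr (b - 1) / Gamma b))"
    using G by auto
qed (use assms in \<open>auto intro!: divide_nonneg_nonneg less_imp_le[OF Gamma_real_pos]\<close>)

lemma prabhakar_sums:
  assumes "0 < \<alpha>" "0 < \<beta>" "0 \<le> \<gamma>" "0 < s"
  shows "(\<lambda>k. (- \<kappa>) ^ k * (pochhammer \<gamma> k / fact k) * (s powr (\<alpha> * real k + \<beta> - 1) / Gamma (\<alpha> * real k + \<beta>)))
      sums prabhakar \<alpha> \<beta> \<gamma> \<kappa> s"
   and "summable (\<lambda>k. norm ((- \<kappa>) ^ k * (pochhammer \<gamma> k / fact k) * (s powr (\<alpha> * real k + \<beta> - 1) / Gamma (\<alpha> * real k + \<beta>))))"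
proof -
  have eq: "(- \<kappa>) ^ k * (pochhammer \<gamma> k / fact k) * (s powr (\<alpha> * real k + \<beta> - 1) / Gamma (\<alpha> * real k + \<beta>))
    = s powr (\<beta> - 1) * (pochhammer \<gamma> k * (- \<kappa> * s powr \<alpha>) ^ k / (fact k * Gamma (\<alpha> * real k + \<beta>)))" for k
  proof -
    have "s powr (\<alpha> * real k + \<beta> - 1) = s powr (\<beta> - 1) * (s powr \<alpha>) ^ k"
      using assms(4) by (simp add: powr_powr flip: powr_realpow powr_add) (simp add: algebra_simps)
    moreover have "(- \<kappa> * s powr \<alpha>) ^ k = (- \<kappa>) ^ k * (s powr \<alpha>) ^ k"
      by (rule power_mult_distrib)
    ultimately show ?thesis by (simp del: mult_minus_left)
  qed
  show "(\<lambda>k. (- \<kappa>) ^ k * (pochhammer \<gamma> k / fact k) * (s powr (\<alpha> * real k + \<beta> - 1) / Gamma (\<alpha> * real k + \<beta>)))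
      sums prabhakar \<alpha> \<beta> \<gamma> \<kappa> s"
    unfolding eq prabhakar_def by (intro sums_mult ml3_sums assms)
  show "summable (\<lambda>k. norm ((- \<kappa>) ^ k * (pochhammer \<gamma> k / fact k) * (s powr (\<alpha> * real k + \<beta> - 1) / Gamma (\<alpha> * real k + \<beta>))))"
    unfolding eq norm_mult[of "s powr (\<beta> - 1)"] by (intro summable_mult ml3_summable_norm assms)
qed

lemma pochhammer_fact_convolution:
  fixes \<gamma> \<gamma>' :: real
  shows "(\<Sum>i\<le>n. pochhammer \<gamma> i / fact i * (pochhammer \<gamma>' (n - i) / fact (n - i)))
    = pochhammer (\<gamma> + \<gamma>') n / fact n"
  unfolding pochhammer_binomial_sum sum_divide_distrib
  by (intro sum.cong refl) (simp add: binomial_fact)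

text \<open>The integrand is expanded as a Cauchy product. For a fixed total degree \<open>n\<close> all its
  terms carry the same sign \<open>(- \<kappa>) ^ n\<close>, so the integral of the absolute
  value of the \<open>n\<close>-th term is the absolute value of the \<open>n\<close>-th term of
  the answer, whose series is absolutely convergent. This justifies integration term by term.\<close>

lemma prabhakar_convolution:
  fixes t \<alpha> \<beta> \<beta>' \<gamma> \<gamma>' \<kappa> :: real
  assumes t: "0 < t" and \<alpha>: "0 < \<alpha>" and \<beta>: "0 < \<beta>" "0 < \<beta>'" and \<gamma>: "0 \<le> \<gamma>" "0 \<le> \<gamma>'" and \<kappa>: "0 < \<kappa>"
  shows "has_bochner_integral lborel
    (\<lambda>s. indicator {0<..<t} s * (prabhakar \<alpha> \<beta> \<gamma> \<kappa> s * prabhakar \<alpha> \<beta>' \<gamma>' \<kappa> (t - s)))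
    (prabhakar \<alpha> (\<beta> + \<beta>') (\<gamma> + \<gamma>') \<kappa> t)"
proof -
  define p where "p \<beta> k s = s powr (\<alpha> * real k + \<beta> - 1) / Gamma (\<alpha> * real k + \<beta>)" for \<beta> k and s :: real
  define q where "q \<gamma> k = pochhammer \<gamma> k / fact k" for \<gamma> :: real and k
  define u where "u \<gamma> \<beta> k s = (- \<kappa>) ^ k * q \<gamma> k * p \<beta> k s" for \<gamma> \<beta> k s
  define w where "w n s = (\<Sum>i\<le>n. q \<gamma> i * q \<gamma>' (n - i) * (indicator {0<..<t} s * (p \<beta> i s * p \<beta>' (n - i) (t - s))))" for n s
  define c where "c n s = (- \<kappa>) ^ n * w n s" for n s
  have q0: "0 \<le> q \<gamma> k" "0 \<le> q \<gamma>' k" for k using \<gamma> by (auto simp: q_def pochhammer_nonneg_real)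
  have p0: "0 \<le> p \<beta> k s" "0 \<le> p \<beta>' k s" for k s using \<alpha> \<beta>
    by (auto simp: p_def intro!: divide_nonneg_nonneg less_imp_le[OF Gamma_real_pos] add_nonneg_pos)
  have w0: "0 \<le> w n s" for n s using q0 p0 by (auto simp: w_def intro!: sum_nonneg mult_nonneg_nonneg)

  have u_sums: "(\<lambda>k. u \<gamma> \<beta> k s) sums prabhakar \<alpha> \<beta> \<gamma> \<kappa> s"
    and u_abs: "summable (\<lambda>k. norm (u \<gamma> \<beta> k s))"
    if "0 < \<beta>" "0 \<le> \<gamma>" "0 < s" for \<gamma> \<beta> s
    using prabhakar_sums[OF \<alpha> that, of \<kappa>] by (simp_all add: u_def p_def q_def)
  have cauchy: "c n s = (\<Sum>i\<le>n. u \<gamma> \<beta> i s * u \<gamma>' \<beta>' (n - i) (t - s))" if "0 < s" "s < t" for n s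
    unfolding c_def w_def sum_distrib_left
  proof (rule sum.cong)
    fix i assume "i \<in> {..n}"
    hence "(- \<kappa>) ^ n = (- \<kappa>) ^ i * (- \<kappa>) ^ (n - i)" by (simp flip: power_add)
    thus "(- \<kappa>) ^ n * (q \<gamma> i * q \<gamma>' (n - i) * (indicator {0<..<t} s * (p \<beta> i s * p \<beta>' (n - i) (t - s))))
      = u \<gamma> \<beta> i s * u \<gamma>' \<beta>' (n - i) (t - s)"
      using that by (simp add: u_def)
  qed simp
  have norm_c: "norm (c n s) = \<kappa> ^ n * w n s" for n s
    using w0[of n s] \<kappa> by (simp add: c_def abs_mult power_abs)
  have norm_cauchy: "norm (c n s) = (\<Sum>i\<le>n. norm (u \<gamma> \<beta> i s) * norm (u \<gamma>' \<beta>' (n - i) (t - s)))" if "0 < s" "s < t" for n s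
    unfolding norm_c w_def sum_distrib_left
  proof (rule sum.cong)
    fix i assume "i \<in> {..n}"
    hence "\<kappa> ^ n = \<kappa> ^ i * \<kappa> ^ (n - i)" by (simp flip: power_add)
    thus "\<kappa> ^ n * (q \<gamma> i * q \<gamma>' (n - i) * (indicator {0<..<t} s * (p \<beta> i s * p \<beta>' (n - i) (t - s))))
      = norm (u \<gamma> \<beta> i s) * norm (u \<gamma>' \<beta>' (n - i) (t - s))"
      using that \<kappa> q0 p0 by (simp add: u_def abs_mult power_abs)
  qed simp
  have c_outside: "c n s = 0" if "\<not> (0 < s \<and> s < t)" for n s
    using that by (auto simp: c_def w_def)
  have c_summable: "summable (\<lambda>n. norm (c n s))" for s
  proof (cases "0 < s \<and> s < t")
    case True
    thus ?thesis unfolding norm_cauchy[OF conjunct1[OF True] conjunct2[OF True]]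
      using u_abs[OF \<beta>(1) \<gamma>(1), of s] u_abs[OF \<beta>(2) \<gamma>(2), of "t - s"]
      by (intro summable_Cauchy_product) auto
  qed (simp add: c_outside)
  have c_sums: "(\<lambda>n. c n s) sums (indicator {0<..<t} s * (prabhakar \<alpha> \<beta> \<gamma> \<kappa> s * prabhakar \<alpha> \<beta>' \<gamma>' \<kappa> (t - s)))" for s
  proof (cases "0 < s \<and> s < t")
    case True
    have "(\<lambda>n. c n s) sums ((\<Sum>k. u \<gamma> \<beta> k s) * (\<Sum>k. u \<gamma>' \<beta>' k (t - s)))"
      unfolding cauchy[OF conjunct1[OF True] conjunct2[OF True]]
      using True u_abs[OF \<beta>(1) \<gamma>(1), of s] u_abs[OF \<beta>(2) \<gamma>(2), of "t - s"]
      by (intro Cauchy_product_sums) auto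
    thus ?thesis
      using True u_sums[OF \<beta>(1) \<gamma>(1), of s] u_sums[OF \<beta>(2) \<gamma>(2), of "t - s"] by (simp add: sums_iff)
  next
    case False
    hence "(\<lambda>n. c n s) = (\<lambda>n. 0)" by (auto simp: c_outside)
    thus ?thesis using False by (auto simp: indicator_def)
  qed
  have beta_pos: "0 < \<alpha> * real k + \<beta>" "0 < \<alpha> * real k + \<beta>'" for k
    using \<alpha> \<beta> by (auto intro: add_nonneg_pos)
  have w_int: "has_bochner_integral lborel (w n) (q (\<gamma> + \<gamma>') n * p (\<beta> + \<beta>') n t)" for n
  proof -
    have "has_bochner_integral lborel (w n) (\<Sum>i\<le>n. q \<gamma> i * q \<gamma>' (n - i) * p (\<beta> + \<beta>') n t)"
      unfolding w_def
    proof (intro has_bochner_integral_sum has_bochner_integral_mult_right)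
      fix i assume i: "i \<in> {..n}"
      have "\<alpha> * real i + \<beta> + (\<alpha> * real (n - i) + \<beta>') = \<alpha> * real n + (\<beta> + \<beta>')"
        using i by (simp add: of_nat_diff algebra_simps)
      note eq = this
      from has_bochner_integral_Beta_Gamma[OF beta_pos(1)[of i] beta_pos(2)[of "n - i"] t]
      show "has_bochner_integral lborel (\<lambda>s. indicator {0<..<t} s * (p \<beta> i s * p \<beta>' (n - i) (t - s))) (p (\<beta> + \<beta>') n t)"
        unfolding p_def eq .
    qed
    moreover have "(\<Sum>i\<le>n. q \<gamma> i * q \<gamma>' (n - i)) = q (\<gamma> + \<gamma>') n"
      unfolding q_def by (rule pochhammer_fact_convolution)
    ultimately show ?thesis by (simp flip: sum_distrib_right)
  qed
  have c_int: "has_bochner_integral lborel (c n) (u (\<gamma> + \<gamma>') (\<beta> + \<beta>') n t)" for n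
    using has_bochner_integral_mult_right[OF w_int, of "(- \<kappa>) ^ n" n] by (simp add: c_def[abs_def] u_def mult.assoc)
  have c_norm_int: "(\<integral>s. norm (c n s) \<partial>lborel) = norm (u (\<gamma> + \<gamma>') (\<beta> + \<beta>') n t)" for n
  proof -
    have "0 \<le> q (\<gamma> + \<gamma>') n * p (\<beta> + \<beta>') n t"
      using has_bochner_integral_nonneg[OF w_int] w0 by blast
    moreover have "norm (u (\<gamma> + \<gamma>') (\<beta> + \<beta>') n t) = norm ((- \<kappa>) ^ n) * norm (q (\<gamma> + \<gamma>') n * p (\<beta> + \<beta>') n t)"
      unfolding u_def mult.assoc by (rule norm_mult)
    moreover have "norm ((- \<kappa>) ^ n) = \<kappa> ^ n" using \<kappa> by (simp add: power_abs)
    ultimately have "norm (u (\<gamma> + \<gamma>') (\<beta> + \<beta>') n t) = \<kappa> ^ n * (q (\<gamma> + \<gamma>') n * p (\<beta> + \<beta>') n t)"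
      by (simp only: real_norm_def abs_of_nonneg)
    thus ?thesis
      unfolding norm_c using has_bochner_integral_integral_eq[OF w_int, of n] by simp
  qed
  have c_norm_summable: "summable (\<lambda>n. \<integral>s. norm (c n s) \<partial>lborel)"
    unfolding c_norm_int using \<beta> \<gamma> t by (intro u_abs) auto
  have c_integrable: "integrable lborel (c n)" for n
    using c_int by (auto simp: has_bochner_integral_iff)
  have lim: "(\<lambda>s. \<Sum>n. c n s) = (\<lambda>s. indicator {0<..<t} s * (prabhakar \<alpha> \<beta> \<gamma> \<kappa> s * prabhakar \<alpha> \<beta>' \<gamma>' \<kappa> (t - s)))"
    using c_sums by (simp add: sums_iff fun_eq_iff)
  have "integrable lborel (\<lambda>s. \<Sum>n. c n s)"
    by (rule integrable_suminf[OF c_integrable _ c_norm_summable]) (use c_summable in auto)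
  moreover have "(\<lambda>n. integral\<^sup>L lborel (c n)) sums (\<integral>s. (\<Sum>n. c n s) \<partial>lborel)"
    by (rule sums_integral[OF c_integrable _ c_norm_summable]) (use c_summable in auto)
  moreover have "(\<lambda>n. integral\<^sup>L lborel (c n)) sums prabhakar \<alpha> (\<beta> + \<beta>') (\<gamma> + \<gamma>') \<kappa> t"
    using u_sums[of "\<beta> + \<beta>'" "\<gamma> + \<gamma>'" t] \<beta> \<gamma> t
    by (simp add: has_bochner_integral_integral_eq[OF c_int])
  ultimately show ?thesis
    unfolding has_bochner_integral_iff lim by (simp add: sums_iff)
qed

section \<open>Generalized Mittag-Leffler densities and their renewal sums\<close>

text \<open>The density of a generalized Mittag-Leffler variable with exponent \<open>\<gamma>\<close> and
  rate \<open>\<kappa>\<close>.\<close>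

definition gml :: "real \<Rightarrow> real \<Rightarrow> real \<Rightarrow> real \<Rightarrow> real" where
  "gml \<alpha> \<kappa> \<gamma> t = \<kappa> powr \<gamma> * prabhakar \<alpha> (\<alpha> * \<gamma>) \<gamma> \<kappa> t"

definition gml_cdf :: "real \<Rightarrow> real \<Rightarrow> real \<Rightarrow> real \<Rightarrow> real" where
  "gml_cdf \<alpha> \<kappa> \<gamma> t = \<kappa> powr \<gamma> * prabhakar \<alpha> (\<alpha> * \<gamma> + 1) \<gamma> \<kappa> t"

text \<open>The probability that a sum with exponent \<open>\<gamma>\<close> has passed by time
  \<open>t\<close> and the next sum, with exponent \<open>\<gamma> + 1\<close>, has not; see
  \<open>gml_cdf_diff\<close> and \<open>renewal_gap\<close>.\<close>

definition gml_gap :: "real \<Rightarrow> real \<Rightarrow> real \<Rightarrow> real \<Rightarrow> real" where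
  "gml_gap \<alpha> \<kappa> \<gamma> t = \<kappa> powr \<gamma> * prabhakar \<alpha> (\<alpha> * \<gamma> + 1) (\<gamma> + 1) \<kappa> t"

lemma powr_weight:
  fixes \<kappa> t \<alpha> \<gamma> :: real
  assumes "0 < \<kappa>" "0 < t"
  shows "\<kappa> powr \<gamma> * t powr (\<alpha> * \<gamma>) = (\<kappa> * t powr \<alpha>) powr \<gamma>"
  using assms by (simp add: powr_mult powr_powr)

text \<open>The dimensionless form, in which all three functions depend on \<open>t\<close> through
  \<open>\<kappa> * t powr \<alpha>\<close>; both the bounds and the final formulas use it.\<close>

lemma gml_weighted:
  assumes "0 < \<kappa>" "0 < t"
  shows "gml \<alpha> \<kappa> \<gamma> t = (\<kappa> * t powr \<alpha>) powr \<gamma> / t * ml3 \<alpha> (\<alpha> * \<gamma>) \<gamma> (- \<kappa> * t powr \<alpha>)"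
    and "gml_cdf \<alpha> \<kappa> \<gamma> t = (\<kappa> * t powr \<alpha>) powr \<gamma> * ml3 \<alpha> (\<alpha> * \<gamma> + 1) \<gamma> (- \<kappa> * t powr \<alpha>)"
    and "gml_gap \<alpha> \<kappa> \<gamma> t = (\<kappa> * t powr \<alpha>) powr \<gamma> * ml3 \<alpha> (\<alpha> * \<gamma> + 1) (\<gamma> + 1) (- \<kappa> * t powr \<alpha>)"
  unfolding powr_weight[OF assms, symmetric] using assms
  by (simp_all add: gml_def gml_cdf_def gml_gap_def prabhakar_def powr_diff)

lemma gml_bounds:
  fixes \<alpha> \<kappa> T :: real
  assumes "0 < \<alpha>" "0 < \<kappa>"
  obtains C where "0 \<le> C"
    "\<And>\<gamma> t. 0 < \<gamma> \<Longrightarrow> 0 < t \<Longrightarrow> t \<le> T \<Longrightarrow> \<bar>gml \<alpha> \<kappa> \<gamma> t\<bar> \<le> C * (1/4) powr \<gamma> / t"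
    "\<And>\<gamma> t. 0 < \<gamma> \<Longrightarrow> 0 < t \<Longrightarrow> t \<le> T \<Longrightarrow> \<bar>gml_cdf \<alpha> \<kappa> \<gamma> t\<bar> \<le> C * (1/4) powr \<gamma>"
    "\<And>\<gamma> t. 0 < \<gamma> \<Longrightarrow> 0 < t \<Longrightarrow> t \<le> T \<Longrightarrow> \<bar>gml_gap \<alpha> \<kappa> \<gamma> t\<bar> \<le> C * (1/4) powr \<gamma>"
proof -
  obtain M where M: "1 \<le> M" "8 * (\<kappa> * T powr \<alpha>) \<le> M powr \<alpha>"
    using ml3_scale_exists[OF assms(1)] .
  define C where "C = 4 * M * exp M"
  have *: "\<bar>(\<kappa> * t powr \<alpha>) powr \<gamma> * ml3 \<alpha> \<beta> \<delta> (- \<kappa> * t powr \<alpha>)\<bar> \<le> C * (1/4) powr \<gamma>"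
    if "0 < \<gamma>" "0 < t" "t \<le> T" "0 \<le> \<delta>" "\<delta> \<le> \<gamma> + 1" "\<alpha> * \<gamma> \<le> \<beta>" for \<gamma> \<delta> \<beta> t
  proof -
    have "\<kappa> * t powr \<alpha> \<le> \<kappa> * T powr \<alpha>"
      using that assms by (intro mult_left_mono powr_mono2) auto
    hence "8 * (\<kappa> * t powr \<alpha>) \<le> M powr \<alpha>" using M by simp
    from ml3_weighted_bound[OF assms(1) that(1,4,5,6) M(1) this]
    show ?thesis using assms by (simp add: C_def)
  qed
  show thesis
  proof (rule that[of C])
    fix \<gamma> t :: real assume t: "0 < \<gamma>" "0 < t" "t \<le> T"
    have "\<bar>gml \<alpha> \<kappa> \<gamma> t\<bar> = \<bar>(\<kappa> * t powr \<alpha>) powr \<gamma> * ml3 \<alpha> (\<alpha> * \<gamma>) \<gamma> (- \<kappa> * t powr \<alpha>)\<bar> / t"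
      using assms t by (simp add: gml_weighted abs_mult)
    also have "\<dots> \<le> C * (1/4) powr \<gamma> / t"
      using t by (intro divide_right_mono *) auto
    finally show "\<bar>gml \<alpha> \<kappa> \<gamma> t\<bar> \<le> C * (1/4) powr \<gamma> / t" .
    show "\<bar>gml_cdf \<alpha> \<kappa> \<gamma> t\<bar> \<le> C * (1/4) powr \<gamma>"
      unfolding gml_weighted[OF assms(2) t(2)] using t by (intro *) auto
    show "\<bar>gml_gap \<alpha> \<kappa> \<gamma> t\<bar> \<le> C * (1/4) powr \<gamma>"
      unfolding gml_weighted[OF assms(2) t(2)] using t by (intro *) auto
  qed (use M in \<open>simp add: C_def\<close>)
qed

lemma continuous_on_prabhakar:
  assumes "0 < \<alpha>" "0 < \<beta>" "0 \<le> \<gamma>"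
  shows "continuous_on {0<..} (prabhakar \<alpha> \<beta> \<gamma> \<kappa>)"
  unfolding prabhakar_def[abs_def]
  by (intro continuous_intros continuous_on_compose2[OF continuous_on_ml3[OF assms]]) auto

lemma measurable_prabhakar:
  assumes "0 < \<alpha>" "0 < \<beta>" "0 \<le> \<gamma>"
  shows "prabhakar \<alpha> \<beta> \<gamma> \<kappa> \<in> borel_measurable borel"
proof -
  have 1: "ml3 \<alpha> \<beta> \<gamma> \<in> borel_measurable borel"
    by (rule borel_measurable_continuous_onI[OF continuous_on_ml3[OF assms]])
  have 2: "(\<lambda>t :: real. t powr \<delta>) \<in> borel_measurable borel" for \<delta> :: real
    by measurable
  have 3: "(\<lambda>t. ml3 \<alpha> \<beta> \<gamma> (- \<kappa> * t powr \<alpha>)) \<in> borel_measurable borel"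
    by (rule measurable_compose[OF borel_measurable_times[OF borel_measurable_const 2] 1])
  show ?thesis unfolding prabhakar_def[abs_def] by (rule borel_measurable_times[OF 2 3])
qed

lemma
  assumes "0 < \<alpha>" "0 < \<gamma>"
  shows continuous_on_gml: "continuous_on {0<..} (gml \<alpha> \<kappa> \<gamma>)"
    and continuous_on_gml_cdf: "continuous_on {0<..} (gml_cdf \<alpha> \<kappa> \<gamma>)"
    and continuous_on_gml_gap: "continuous_on {0<..} (gml_gap \<alpha> \<kappa> \<gamma>)"
    and measurable_gml: "gml \<alpha> \<kappa> \<gamma> \<in> borel_measurable borel"
  unfolding gml_def[abs_def] gml_cdf_def[abs_def] gml_gap_def[abs_def]
  by (rule continuous_on_mult_left[OF continuous_on_prabhakar]
      borel_measurable_times[OF borel_measurable_const measurable_prabhakar];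
      use assms in \<open>simp add: add_pos_pos\<close>)+

lemma ml3_gamma_zero: "ml3 \<alpha> \<beta> 0 x = 1 / Gamma \<beta>"
proof -
  have "(\<lambda>k. pochhammer 0 k * x ^ k / (fact k * Gamma (\<alpha> * real k + \<beta>)))
      = (\<lambda>k. if k = 0 then 1 / Gamma \<beta> else 0)"
    by (auto simp: fun_eq_iff pochhammer_0_left)
  thus ?thesis unfolding ml3_def using sums_single[of 0 "\<lambda>_. 1 / Gamma \<beta>"] by (simp add: sums_iff)
qed

lemma gml_convolution:
  assumes "0 < \<alpha>" "0 < \<kappa>" "0 < \<gamma>" "0 < \<delta>" "0 < t"
  shows "has_bochner_integral lborel
    (\<lambda>s. indicator {0<..<t} s * (gml \<alpha> \<kappa> \<gamma> s * gml \<alpha> \<kappa> \<delta> (t - s))) (gml \<alpha> \<kappa> (\<gamma> + \<delta>) t)"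
proof -
  have "has_bochner_integral lborel
    (\<lambda>s. \<kappa> powr (\<gamma> + \<delta>) * (indicator {0<..<t} s * (prabhakar \<alpha> (\<alpha> * \<gamma>) \<gamma> \<kappa> s * prabhakar \<alpha> (\<alpha> * \<delta>) \<delta> \<kappa> (t - s))))
    (\<kappa> powr (\<gamma> + \<delta>) * (prabhakar \<alpha> (\<alpha> * \<gamma> + \<alpha> * \<delta>) (\<gamma> + \<delta>) \<kappa> t))"
    using assms by (intro has_bochner_integral_mult_right prabhakar_convolution) auto
  thus ?thesis by (simp add: gml_def powr_add distrib_left mult_ac)
qed

text \<open>The kernel with \<open>\<gamma> = 0\<close> and \<open>\<beta> = 1\<close> is the constant
  \<open>1\<close>, so integration is a special case of convolution.\<close>

lemma gml_integral:
  assumes "0 < \<alpha>" "0 < \<kappa>" "0 < \<gamma>" "0 < t"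
  shows "has_bochner_integral lborel
    (\<lambda>s. indicator {0<..<t} s * gml \<alpha> \<kappa> \<gamma> s) (gml_cdf \<alpha> \<kappa> \<gamma> t)"
proof -
  have "has_bochner_integral lborel
    (\<lambda>s. \<kappa> powr \<gamma> * (indicator {0<..<t} s * (prabhakar \<alpha> (\<alpha> * \<gamma>) \<gamma> \<kappa> s * prabhakar \<alpha> 1 0 \<kappa> (t - s))))
    (\<kappa> powr \<gamma> * (prabhakar \<alpha> (\<alpha> * \<gamma> + 1) (\<gamma> + 0) \<kappa> t))"
    using assms by (intro has_bochner_integral_mult_right prabhakar_convolution) auto
  \<comment> \<open>The second kernel is \<open>1\<close>, because \<open>pochhammer 0 k = 0\<close> for \<open>k > 0\<close>.\<close>
  also have "(\<lambda>s. \<kappa> powr \<gamma> * (indicator {0<..<t} s * (prabhakar \<alpha> (\<alpha> * \<gamma>) \<gamma> \<kappa> s * prabhakar \<alpha> 1 0 \<kappa> (t - s))))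
     = (\<lambda>s. indicator {0<..<t} s * gml \<alpha> \<kappa> \<gamma> s)"
    by (auto simp: fun_eq_iff indicator_def gml_def prabhakar_def ml3_gamma_zero)
  finally show ?thesis by (simp add: gml_cdf_def)
qed

text \<open>The prefactor \<open>\<kappa> powr (\<gamma> + 1)\<close> and the larger index shift the series
  of the second distribution function by one place; the coefficients then combine by
  \<open>pochhammer \<gamma> (k + 1) / fact (k + 1) + pochhammer (\<gamma> + 1) k / fact k = pochhammer (\<gamma> + 1) (k + 1) / fact (k + 1)\<close>.\<close>

lemma gml_cdf_diff:
  assumes "0 < \<alpha>" "0 < \<kappa>" "0 < \<gamma>" "0 < t"
  shows "gml_cdf \<alpha> \<kappa> \<gamma> t - gml_cdf \<alpha> \<kappa> (\<gamma> + 1) t = gml_gap \<alpha> \<kappa> \<gamma> t"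
proof -
  define P where "P k = t powr (\<alpha> * (real k + \<gamma>)) / Gamma (\<alpha> * (real k + \<gamma>) + 1)" for k :: nat
  define f where "f \<delta> k = (- \<kappa>) ^ k * (pochhammer \<delta> k / fact k) * P k" for \<delta> k
  have P: "P k = t powr (\<alpha> * real k + (\<alpha> * \<gamma> + 1) - 1) / Gamma (\<alpha> * real k + (\<alpha> * \<gamma> + 1))"
    "P (Suc k) = t powr (\<alpha> * real k + (\<alpha> * (\<gamma> + 1) + 1) - 1) / Gamma (\<alpha> * real k + (\<alpha> * (\<gamma> + 1) + 1))" for k
    by (simp_all add: P_def algebra_simps)
  have 1: "f \<delta> sums prabhakar \<alpha> (\<alpha> * \<gamma> + 1) \<delta> \<kappa> t" if "0 < \<delta>" for \<delta>
    unfolding f_def P(1) using assms that by (intro prabhakar_sums) (auto intro: add_pos_pos)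
  have "(\<lambda>k. (- \<kappa>) ^ k * (pochhammer (\<gamma> + 1) k / fact k) * P (Suc k)) sums prabhakar \<alpha> (\<alpha> * (\<gamma> + 1) + 1) (\<gamma> + 1) \<kappa> t"
    unfolding P(2) using assms by (intro prabhakar_sums) (auto intro: add_pos_pos)
  hence "(\<lambda>k. - \<kappa> * ((- \<kappa>) ^ k * (pochhammer (\<gamma> + 1) k / fact k) * P (Suc k))) sums (- \<kappa> * prabhakar \<alpha> (\<alpha> * (\<gamma> + 1) + 1) (\<gamma> + 1) \<kappa> t)"
    by (intro sums_mult)
  moreover have "- \<kappa> * ((- \<kappa>) ^ k * (pochhammer (\<gamma> + 1) k / fact k) * P (Suc k)) = f (\<gamma> + 1) (Suc k) - f \<gamma> (Suc k)" for k
  proof -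
    have "pochhammer (\<gamma> + 1) (Suc k) / fact (Suc k) - pochhammer \<gamma> (Suc k) / fact (Suc k)
      = (pochhammer (\<gamma> + 1) k * (\<gamma> + 1 + real k) - \<gamma> * pochhammer (\<gamma> + 1) k) / fact (Suc k)"
      unfolding pochhammer_Suc[of "\<gamma> + 1"] pochhammer_rec[of \<gamma>] by (simp only: diff_divide_distrib)
    also have "pochhammer (\<gamma> + 1) k * (\<gamma> + 1 + real k) - \<gamma> * pochhammer (\<gamma> + 1) k
      = real (Suc k) * pochhammer (\<gamma> + 1) k"
      by (simp add: algebra_simps)
    also have "\<dots> / fact (Suc k) = pochhammer (\<gamma> + 1) k / fact k"
      by simp
    finally have coeff: "pochhammer (\<gamma> + 1) (Suc k) / fact (Suc k) - pochhammer \<gamma> (Suc k) / fact (Suc k)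
      = pochhammer (\<gamma> + 1) k / fact k" .
    have "f (\<gamma> + 1) (Suc k) - f \<gamma> (Suc k) = (- \<kappa>) ^ Suc k
        * (pochhammer (\<gamma> + 1) (Suc k) / fact (Suc k) - pochhammer \<gamma> (Suc k) / fact (Suc k)) * P (Suc k)"
      unfolding f_def by (simp only: left_diff_distrib right_diff_distrib)
    thus ?thesis unfolding coeff by simp
  qed
  ultimately have "(\<lambda>k. f (\<gamma> + 1) (Suc k) - f \<gamma> (Suc k)) sums (- \<kappa> * prabhakar \<alpha> (\<alpha> * (\<gamma> + 1) + 1) (\<gamma> + 1) \<kappa> t)"
    by simp
  hence "(\<lambda>k. f (\<gamma> + 1) k - f \<gamma> k) sums (- \<kappa> * prabhakar \<alpha> (\<alpha> * (\<gamma> + 1) + 1) (\<gamma> + 1) \<kappa> t + (f (\<gamma> + 1) 0 - f \<gamma> 0))"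
    by (subst (asm) sums_Suc_iff) simp
  moreover have "f (\<gamma> + 1) 0 - f \<gamma> 0 = 0" by (simp add: f_def)
  moreover have "(\<lambda>k. f (\<gamma> + 1) k - f \<gamma> k) sums (prabhakar \<alpha> (\<alpha> * \<gamma> + 1) (\<gamma> + 1) \<kappa> t - prabhakar \<alpha> (\<alpha> * \<gamma> + 1) \<gamma> \<kappa> t)"
    using assms by (intro sums_diff 1) auto
  ultimately have *: "prabhakar \<alpha> (\<alpha> * \<gamma> + 1) (\<gamma> + 1) \<kappa> t - prabhakar \<alpha> (\<alpha> * \<gamma> + 1) \<gamma> \<kappa> t = - \<kappa> * prabhakar \<alpha> (\<alpha> * (\<gamma> + 1) + 1) (\<gamma> + 1) \<kappa> t"
    using sums_unique2 by fastforce
  have "gml_cdf \<alpha> \<kappa> \<gamma> t - gml_cdf \<alpha> \<kappa> (\<gamma> + 1) t = \<kappa> powr \<gamma> * (prabhakar \<alpha> (\<alpha> * \<gamma> + 1) \<gamma> \<kappa> t - \<kappa> * prabhakar \<alpha> (\<alpha> * (\<gamma> + 1) + 1) (\<gamma> + 1) \<kappa> t)"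
    using assms by (simp add: gml_cdf_def powr_add algebra_simps)
  also have "\<dots> = gml_gap \<alpha> \<kappa> \<gamma> t" unfolding gml_gap_def using * by simp
  finally show ?thesis .
qed

definition renewal :: "(nat \<Rightarrow> 'a \<Rightarrow> real) \<Rightarrow> nat \<Rightarrow> 'a \<Rightarrow> real" where
  "renewal X k \<omega> = (\<Sum>i=1..k. X i \<omega>)"

lemma renewal_simps: "renewal X 0 \<omega> = 0" "renewal X (Suc k) \<omega> = renewal X k \<omega> + X (Suc k) \<omega>"
  by (simp_all add: renewal_def)

context prob_space begin

lemma has_pos_density_AE_pos:
  assumes "has_pos_density M X g"
  shows "AE \<omega> in M. 0 < X \<omega>"
proof -
  have "distributed M lborel X (\<lambda>t. ennreal (if 0 < t then g t else 0))"
    using assms by (simp add: has_pos_density_def)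
  hence X: "X \<in> borel_measurable M"
    and eq: "distr M lborel X = density lborel (\<lambda>t. ennreal (if 0 < t then g t else 0))"
    and f: "(\<lambda>t. ennreal (if 0 < t then g t else 0)) \<in> borel_measurable lborel"
    by (auto simp: distributed_def)
  have "AE t in distr M lborel X. 0 < t"
    unfolding eq using f by (subst AE_density) auto
  thus ?thesis using X by (subst (asm) AE_distr_iff) auto
qed

lemma gml_density_add:
  assumes "indep_var borel X borel Y" "0 < \<alpha>" "0 < \<kappa>" "0 < \<gamma>" "0 < \<delta>"
    and X: "has_pos_density M X (gml \<alpha> \<kappa> \<gamma>)" and Y: "has_pos_density M Y (gml \<alpha> \<kappa> \<delta>)"
  shows "has_pos_density M (\<lambda>\<omega>. X \<omega> + Y \<omega>) (gml \<alpha> \<kappa> (\<gamma> + \<delta>))"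
proof -
  let ?f = "\<lambda>t s. ennreal (if 0 < t - s then gml \<alpha> \<kappa> \<gamma> (t - s) else 0) * ennreal (if 0 < s then gml \<alpha> \<kappa> \<delta> s else 0)"
  let ?g = "\<lambda>t s. indicator {0<..<t} s * (gml \<alpha> \<kappa> \<delta> s * gml \<alpha> \<kappa> \<gamma> (t - s))"
  have X0: "0 \<le> gml \<alpha> \<kappa> \<gamma> t" and Y0: "0 \<le> gml \<alpha> \<kappa> \<delta> t" if "0 < t" for t
    using X Y that by (auto simp: has_pos_density_def)
  have nonneg: "0 \<le> ?g t s" for s t :: real
    using X0 Y0 by (auto simp: indicator_def)
  have conv: "has_bochner_integral lborel
    (\<lambda>s. ?g t s) (gml \<alpha> \<kappa> (\<gamma> + \<delta>) t)" if "0 < t" for t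
    using gml_convolution[OF assms(2,3,5,4) that] by (simp add: add.commute)
  have "(\<integral>\<^sup>+s. ?f t s \<partial>lborel)
     = ennreal (if 0 < t then gml \<alpha> \<kappa> (\<gamma> + \<delta>) t else 0)" for t
  proof -
    have "(\<integral>\<^sup>+s. ?f t s \<partial>lborel)
      = (\<integral>\<^sup>+s. ennreal (?g t s) \<partial>lborel)"
      using X0 Y0 by (intro nn_integral_cong) (auto simp: indicator_def ennreal_mult mult.commute)
    also have "\<dots> = ennreal (if 0 < t then gml \<alpha> \<kappa> (\<gamma> + \<delta>) t else 0)"
    proof (cases "0 < t")
      case True
      then show ?thesis using conv[OF True] nonneg
        by (subst nn_integral_eq_integral) (auto simp: has_bochner_integral_iff)
    next
      case False
      hence "indicator {0<..<t} s = (0::real)" for s by (auto simp: indicator_def)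
      with False show ?thesis by simp
    qed
    finally show ?thesis .
  qed
  moreover have "distributed M lborel (\<lambda>\<omega>. X \<omega> + Y \<omega>) (\<lambda>t. \<integral>\<^sup>+s. ?f t s \<partial>lborel)"
    by (rule distributed_convolution[OF assms(1)]) (use X Y in \<open>auto simp: has_pos_density_def\<close>)
  moreover have "0 \<le> gml \<alpha> \<kappa> (\<gamma> + \<delta>) t" if "0 < t" for t
    using has_bochner_integral_nonneg[OF conv[OF that]] nonneg by blast
  ultimately show ?thesis by (simp add: has_pos_density_def)
qed

lemma gml_prob_le:
  assumes X: "has_pos_density M X (gml \<alpha> \<kappa> \<gamma>)" and "0 < \<alpha>" "0 < \<kappa>" "0 < \<gamma>" "0 < t"
  shows "prob {\<omega> \<in> space M. X \<omega> \<le> t} = gml_cdf \<alpha> \<kappa> \<gamma> t"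
proof -
  have D: "distributed M lborel X (\<lambda>t. ennreal (if 0 < t then gml \<alpha> \<kappa> \<gamma> t else 0))"
    and X0: "0 < t \<Longrightarrow> 0 \<le> gml \<alpha> \<kappa> \<gamma> t" for t
    using X by (auto simp: has_pos_density_def)
  have nonneg: "0 \<le> indicator {0<..<t} s * gml \<alpha> \<kappa> \<gamma> s" for s :: real
    using X0 by (auto simp: indicator_def)
  have I: "has_bochner_integral lborel (\<lambda>s. indicator {0<..<t} s * gml \<alpha> \<kappa> \<gamma> s) (gml_cdf \<alpha> \<kappa> \<gamma> t)"
    using assms by (intro gml_integral)
  have "emeasure M {\<omega> \<in> space M. X \<omega> \<le> t} = emeasure M (X -` {..t} \<inter> space M)"
    by (rule arg_cong[of _ _ "emeasure M"]) auto
  also have "\<dots> = (\<integral>\<^sup>+s. ennreal (if 0 < s then gml \<alpha> \<kappa> \<gamma> s else 0) * indicator {..t} s \<partial>lborel)"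
    by (rule distributed_emeasure[OF D]) simp
  also have "\<dots> = (\<integral>\<^sup>+s. ennreal (indicator {0<..<t} s * gml \<alpha> \<kappa> \<gamma> s) \<partial>lborel)"
    using AE_lborel_singleton[of t] by (intro nn_integral_cong_AE) (auto simp: indicator_def elim!: eventually_mono)
  also have "\<dots> = ennreal (gml_cdf \<alpha> \<kappa> \<gamma> t)"
    using I nonneg by (subst nn_integral_eq_integral) (auto simp: has_bochner_integral_iff)
  finally show ?thesis
    using has_bochner_integral_nonneg[OF I nonneg] by (simp add: measure_def)
qed

end

text \<open>The common structure of the forward and the backward waiting times: the first has exponent
  \<open>g0 + 1\<close>, all later ones have exponent \<open>1\<close>.\<close>

locale gml_renewal = prob_space M for M :: "'a measure" +
  fixes X :: "nat \<Rightarrow> 'a \<Rightarrow> real" and \<alpha> \<kappa> g0 :: real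
  assumes X_indep: "indep_vars (\<lambda>_. borel) X {1..}"
    and params: "0 < \<alpha>" "0 < \<kappa>" "0 < g0"
    and X_first: "has_pos_density M (X 1) (gml \<alpha> \<kappa> (g0 + 1))"
    and X_later: "\<And>n. 2 \<le> n \<Longrightarrow> has_pos_density M (X n) (gml \<alpha> \<kappa> 1)"
begin

lemma X_measurable: "1 \<le> n \<Longrightarrow> X n \<in> borel_measurable M"
  using X_indep by (auto simp: indep_vars_def)

lemma X_pos: "AE \<omega> in M. \<forall>n\<ge>1. 0 < X n \<omega>"
proof -
  have "AE \<omega> in M. 1 \<le> n \<longrightarrow> 0 < X n \<omega>" for n
  proof (cases "n = 0 \<or> n = 1")
    case True
    with has_pos_density_AE_pos[OF X_first] show ?thesis by auto
  next
    case False
    hence "AE \<omega> in M. 0 < X n \<omega>" by (intro has_pos_density_AE_pos[OF X_later]) simp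
    thus ?thesis by (rule AE_mp) simp
  qed
  thus ?thesis by (simp add: AE_all_countable)
qed

lemma renewal_measurable: "renewal X k \<in> borel_measurable M"
  unfolding renewal_def[abs_def] by (rule borel_measurable_sum) (use X_measurable in auto)

lemma renewal_density:
  assumes "1 \<le> k"
  shows "has_pos_density M (renewal X k) (gml \<alpha> \<kappa> (g0 + real k))"
  using assms
proof (induction k rule: dec_induct)
  case base
  then show ?case using X_first by (simp add: renewal_def)
next
  case (step k)
  have "indep_var borel (X (Suc k)) borel (\<lambda>\<omega>. \<Sum>i\<in>{1..k}. X i \<omega>)"
    by (rule indep_vars_sum) (use indep_vars_subset[OF X_indep, of "{1..Suc k}"] in \<open>auto simp: atLeastAtMostSuc_conv\<close>)
  hence "indep_var borel (X (Suc k)) borel (renewal X k)" by (simp add: renewal_def[abs_def])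
  from gml_density_add[OF this params(1,2) _ _ X_later step.IH] step params
  show ?case by (simp add: renewal_simps(2)[abs_def] add.commute add.left_commute)
qed

lemma renewal_prob_le:
  assumes "1 \<le> k" "0 < s"
  shows "prob {\<omega>\<in>space M. renewal X k \<omega> \<le> s} = gml_cdf \<alpha> \<kappa> (g0 + real k) s"
  using gml_prob_le[OF renewal_density[OF assms(1)] params(1,2) _ assms(2)] params by simp

lemma renewal_gap:
  assumes "1 \<le> k" "0 < s"
  shows "emeasure M {\<omega>\<in>space M. renewal X k \<omega> \<le> s \<and> s < renewal X (Suc k) \<omega>} = ennreal (gml_gap \<alpha> \<kappa> (g0 + real k) s)"
    and "0 \<le> gml_gap \<alpha> \<kappa> (g0 + real k) s"
proof -
  note [measurable] = renewal_measurable
  let ?G = "{\<omega>\<in>space M. renewal X k \<omega> \<le> s \<and> s < renewal X (Suc k) \<omega>}"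
  \<comment> \<open>Almost surely the partial sums increase, so \<open>?H\<close> is the event that the later sum has passed.\<close>
  let ?H = "{\<omega>\<in>space M. renewal X k \<omega> \<le> s \<and> renewal X (Suc k) \<omega> \<le> s}"
  have "{\<omega>\<in>space M. renewal X k \<omega> \<le> s} = ?G \<union> ?H" by auto
  moreover have "prob (?G \<union> ?H) = prob ?G + prob ?H"
    by (rule finite_measure_Union) auto
  moreover have "prob ?H = prob {\<omega>\<in>space M. renewal X (Suc k) \<omega> \<le> s}"
  proof (rule prob_eq_AE)
    have "AE \<omega> in M. 0 < X (Suc k) \<omega>" using X_pos by (rule eventually_mono) simp
    thus "AE \<omega> in M. renewal X k \<omega> \<le> s \<and> renewal X (Suc k) \<omega> \<le> s \<longleftrightarrow> renewal X (Suc k) \<omega> \<le> s"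
      by (rule eventually_mono) (auto simp: renewal_simps)
  qed measurable
  ultimately have "prob ?G = gml_cdf \<alpha> \<kappa> (g0 + real k) s - gml_cdf \<alpha> \<kappa> (g0 + real (Suc k)) s"
    using renewal_prob_le[OF assms] renewal_prob_le[of "Suc k" s] assms by simp
  also have "\<dots> = gml_gap \<alpha> \<kappa> (g0 + real k) s"
    using gml_cdf_diff[OF params(1,2), of "g0 + real k" s] params assms by (simp add: add_ac)
  finally have *: "prob ?G = gml_gap \<alpha> \<kappa> (g0 + real k) s" .
  show "emeasure M ?G = ennreal (gml_gap \<alpha> \<kappa> (g0 + real k) s)" by (simp add: emeasure_eq_measure *)
  show "0 \<le> gml_gap \<alpha> \<kappa> (g0 + real k) s" unfolding *[symmetric] by simp
qed

text \<open>The distribution functions of the partial sums tend to \<open>0\<close> geometrically, so that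
  the sums are almost surely unbounded.\<close>

lemma renewal_diverges: "AE \<omega> in M. \<forall>s. \<exists>m. s < renewal X m \<omega>"
proof -
  have "AE \<omega> in M. \<exists>m. real (Suc N) < renewal X m \<omega>" for N
  proof -
    let ?T = "real (Suc N)"
    let ?E = "\<lambda>m. {\<omega> \<in> space M. renewal X m \<omega> \<le> ?T}"
    note [measurable] = renewal_measurable
    obtain C where C: "\<And>\<gamma> t. 0 < \<gamma> \<Longrightarrow> 0 < t \<Longrightarrow> t \<le> ?T \<Longrightarrow> \<bar>gml_cdf \<alpha> \<kappa> \<gamma> t\<bar> \<le> C * (1/4) powr \<gamma>"
      using gml_bounds[OF params(1,2), of ?T] by metis
    have le: "prob (?E m) \<le> C * (1/4) powr (g0 + real m)" if "1 \<le> m" for m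
      using C[of "g0 + real m" ?T] renewal_prob_le[OF that, of ?T] params by simp
    have lim: "(\<lambda>m. C * (1/4) powr (g0 + real m)) \<longlonglongrightarrow> 0"
    proof -
      have "(\<lambda>m. C * (1/4) powr g0 * (1/4) ^ m) \<longlonglongrightarrow> C * (1/4) powr g0 * 0"
        by (intro tendsto_mult tendsto_const LIMSEQ_power_zero) simp
      thus ?thesis by (simp add: powr_add powr_realpow mult.assoc)
    qed
    have "prob (\<Inter>m. ?E m) \<le> 0"
    proof (rule LIMSEQ_le_const[OF lim], intro exI allI impI)
      fix m :: nat assume m: "1 \<le> m"
      have "prob (\<Inter>m. ?E m) \<le> prob (?E m)" by (rule finite_measure_mono) auto
      also note le[OF m]
      finally show "prob (\<Inter>m. ?E m) \<le> C * (1/4) powr (g0 + real m)" .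
    qed
    hence "prob (\<Inter>m. ?E m) = 0" using measure_nonneg[of M "\<Inter>m. ?E m"] by linarith
    hence "(\<Inter>m. ?E m) \<in> null_sets M" by (intro null_setsI) (auto simp: emeasure_eq_measure)
    thus ?thesis by (rule AE_I') (auto simp: not_less)
  qed
  hence "AE \<omega> in M. \<forall>N. \<exists>m. real (Suc N) < renewal X m \<omega>" by (simp add: AE_all_countable)
  thus ?thesis
  proof (rule AE_mp, intro AE_I2 impI allI)
    fix \<omega> and s :: real assume *: "\<forall>N. \<exists>m. real (Suc N) < renewal X m \<omega>"
    obtain N where "s < real N" using reals_Archimedean2 by blast
    moreover obtain m where "real (Suc N) < renewal X m \<omega>" using * by blast
    ultimately show "\<exists>m. s < renewal X m \<omega>" by (intro exI[of _ m]) simp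
  qed
qed

end

section \<open>Sample paths\<close>

definition ones :: "(nat \<Rightarrow> 'a \<Rightarrow> nat) \<Rightarrow> nat \<Rightarrow> 'a \<Rightarrow> nat" where
  "ones Y n \<omega> = (\<Sum>i=1..n. Y i \<omega>)"

lemma ones_simps: "ones Y 0 \<omega> = 0" "ones Y (Suc n) \<omega> = ones Y n \<omega> + Y (Suc n) \<omega>"
  by (simp_all add: ones_def)

lemma ones_le_trials:
  assumes "\<And>i. 1 \<le> i \<Longrightarrow> Y i \<omega> \<in> {0, 1}"
  shows "ones Y n \<omega> \<le> n"
proof (induction n)
  case (Suc n)
  then show ?case using assms[of "Suc n"] by (auto simp: ones_simps)
qed (simp add: ones_simps)

lemma ones_pos: "1 \<le> n \<Longrightarrow> Y 1 \<omega> = 1 \<Longrightarrow> 1 \<le> ones Y n \<omega>"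
  unfolding ones_def using member_le_sum[of 1 "{1..n}" "\<lambda>i. Y i \<omega>"] by auto

text \<open>The properties of a sample path that hold almost surely. Everything about the motion itself is
  deterministic and is proved for one such path.\<close>

locale telegraph_path =
  fixes v1 v2 :: real and Y :: "nat \<Rightarrow> 'a \<Rightarrow> nat" and R L :: "nat \<Rightarrow> 'a \<Rightarrow> real" and \<omega> :: 'a
  assumes v: "0 < v1" "0 < v2"
    and Y: "\<And>n. 1 \<le> n \<Longrightarrow> Y n \<omega> \<in> {0, 1}"
    and R: "\<And>n. 1 \<le> n \<Longrightarrow> 0 < R n \<omega>" and L: "\<And>n. 1 \<le> n \<Longrightarrow> 0 < L n \<omega>"
    and R_div: "\<And>s. \<exists>m. s < renewal R m \<omega>" and L_div: "\<And>s. \<exists>m. s < renewal L m \<omega>"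
begin

abbreviation "T n \<equiv> epoch v1 v2 Y R L n \<omega>"
abbreviation "V s \<equiv> velocity v1 v2 Y R L s \<omega>"
abbreviation "N s \<equiv> counting v1 v2 Y R L s \<omega>"
abbreviation "S n \<equiv> trial_velocity v1 v2 Y n \<omega>"
abbreviation "K n \<equiv> ones Y n \<omega>"
abbreviation "X s \<equiv> position v1 v2 Y R L s \<omega>"

lemma Y_cases: "Y (Suc n) \<omega> = 0 \<or> Y (Suc n) \<omega> = 1"
  using Y[of "Suc n"] by auto

lemma ones_le: "K n \<le> n"
  using Y by (rule ones_le_trials)

lemma S_eq: "S n = v1 \<longleftrightarrow> Y (Suc n) \<omega> = 1" "S n = - v2 \<longleftrightarrow> Y (Suc n) \<omega> = 0"
  "Y (Suc n) \<omega> = 1 \<Longrightarrow> S n = v1" "Y (Suc n) \<omega> = 0 \<Longrightarrow> S n = - v2"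
  using v Y_cases[of n] by (auto simp: trial_velocity_def)

lemma epoch_step:
  "T (Suc n) = T n + (if Y (Suc n) \<omega> = 1 then R (Suc (K n)) \<omega> else L (Suc (n - K n)) \<omega>)"
  using ones_le[of n] by (simp add: S_eq ones_def Suc_diff_le)

lemma epoch_eq: "T n = renewal R (K n) \<omega> + renewal L (n - K n) \<omega>"
proof (induction n)
  case (Suc n)
  have *: "T (Suc n) = renewal R (K n) \<omega> + renewal L (n - K n) \<omega>
      + (if Y (Suc n) \<omega> = 1 then R (Suc (K n)) \<omega> else L (Suc (n - K n)) \<omega>)"
    unfolding epoch_step Suc ..
  show ?case
  proof (cases "Y (Suc n) \<omega> = 1")
    case True
    then show ?thesis unfolding * by (simp add: ones_simps renewal_simps)
  next
    case False
    hence "Y (Suc n) \<omega> = 0" using Y_cases[of n] by simp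
    then show ?thesis unfolding * using ones_le[of n] by (simp add: ones_simps renewal_simps Suc_diff_le)
  qed
qed (simp add: renewal_simps ones_simps)

lemma renewal_mono:
  assumes "k \<le> m"
  shows "renewal R k \<omega> \<le> renewal R m \<omega>" "renewal L k \<omega> \<le> renewal L m \<omega>"
  using assms R L by (auto simp: renewal_def less_imp_le intro!: sum_mono2)

lemma epoch_less: "T n < T (Suc n)"
  unfolding epoch_step using R L by simp

lemma epoch_strict_mono: "strict_mono T"
  using epoch_less by (rule strict_mono_Suc_iff[THEN iffD2, rule_format])

text \<open>Among \<open>m1 + m2\<close> trials there are at least \<open>m1\<close> ones or at least
  \<open>m2\<close> zeros.\<close>

lemma epoch_unbounded: "\<exists>n. s < T n"
proof -
  obtain m1 m2 where m: "s < renewal R m1 \<omega>" "s < renewal L m2 \<omega>" using R_div L_div by blast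
  let ?n = "m1 + m2"
  have nn: "0 \<le> renewal R k \<omega>" "0 \<le> renewal L k \<omega>" for k
    using renewal_mono[of 0 k] by (simp_all add: renewal_simps)
  consider "m1 \<le> K ?n" | "m2 \<le> ?n - K ?n" by linarith
  thus ?thesis
  proof cases
    case 1
    hence "s < T ?n" unfolding epoch_eq using m renewal_mono(1)[OF 1] nn(2)[of "?n - K ?n"] by linarith
    thus ?thesis ..
  next
    case 2
    hence "s < T ?n" unfolding epoch_eq using m renewal_mono(2)[OF 2] nn(1)[of "K ?n"] by linarith
    thus ?thesis ..
  qed
qed

lemma counting_eqI:
  assumes "T n \<le> s" "s < T (Suc n)"
  shows "N s = n"
proof -
  have "T m \<le> s \<longleftrightarrow> m \<le> n" for m
  proof (cases "m \<le> n")
    case True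
    hence "T m \<le> T n" by (simp only: strict_mono_less_eq[OF epoch_strict_mono])
    with True assms show ?thesis by linarith
  next
    case False
    hence "T (Suc n) \<le> T m" by (simp only: strict_mono_less_eq[OF epoch_strict_mono] not_less_eq_eq)
    with False assms show ?thesis by linarith
  qed
  hence "{m. T m \<le> s} = {..n}" by auto
  moreover have "Max {..n} = n" by (rule Max_eqI) auto
  ultimately show ?thesis by (simp add: counting_def)
qed

lemma counting_bounds:
  assumes "0 \<le> s"
  shows "T (N s) \<le> s" "s < T (Suc (N s))"
proof -
  define n where "n = (LEAST n. s < T n)"
  have n: "s < T n" unfolding n_def using epoch_unbounded by (rule LeastI_ex)
  have "n \<noteq> 0" using n assms by (cases n) auto
  then obtain m where m: "n = Suc m" by (cases n) auto
  have "T m \<le> s" using not_less_Least[of m "\<lambda>n. s < T n"] m by (auto simp: n_def[symmetric])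
  moreover have "N s = m" by (rule counting_eqI) (use calculation n m in auto)
  ultimately show "T (N s) \<le> s" "s < T (Suc (N s))" using n m by auto
qed

lemma counting_eq_iff: "0 \<le> s \<Longrightarrow> N s = n \<longleftrightarrow> T n \<le> s \<and> s < T (Suc n)"
  using counting_eqI counting_bounds by blast

text \<open>At the right endpoint the velocity may already have changed; one point does not affect the
  integral.\<close>

lemma velocity_const_integral:
  assumes "T n \<le> s" "s \<le> T (Suc n)"
  shows "(V has_integral S n * (s - T n)) {T n..s}"
proof -
  have "((\<lambda>_. S n) has_integral S n * (s - T n)) {T n..s}"
    using has_integral_const_real[of "S n" "T n" s] assms(1) by (simp add: mult.commute)
  thus ?thesis
  proof (rule has_integral_spike_finite[of "{s}", rotated 2])
    fix u assume "u \<in> {T n..s} - {s}"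
    hence "N u = n" using assms by (intro counting_eqI) auto
    thus "V u = S n" by (simp add: velocity_def)
  qed simp
qed

lemma epoch_nonneg: "0 \<le> T n"
  using strict_mono_less_eq[OF epoch_strict_mono, of 0 n] by simp

lemma velocity_integral_epoch:
  "(V has_integral (v1 * renewal R (K n) \<omega> - v2 * renewal L (n - K n) \<omega>)) {0..T n}"
proof (induction n)
  case 0
  then show ?case by (simp add: renewal_simps ones_simps has_integral_refl)
next
  case (Suc n)
  have "(V has_integral (v1 * renewal R (K n) \<omega> - v2 * renewal L (n - K n) \<omega>)
      + S n * (T (Suc n) - T n)) {0..T (Suc n)}"
    using epoch_less[of n] epoch_nonneg[of n]
    by (intro has_integral_combine[OF _ _ Suc velocity_const_integral]) (auto simp del: epoch.simps)
  also have "(v1 * renewal R (K n) \<omega> - v2 * renewal L (n - K n) \<omega>) + S n * (T (Suc n) - T n)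
    = v1 * renewal R (K (Suc n)) \<omega> - v2 * renewal L (Suc n - K (Suc n)) \<omega>"
  proof (cases "Y (Suc n) \<omega> = 1")
    case True
    then show ?thesis unfolding epoch_step by (simp add: S_eq ones_simps renewal_simps algebra_simps)
  next
    case False
    hence "Y (Suc n) \<omega> = 0" using Y_cases[of n] by simp
    then show ?thesis unfolding epoch_step using ones_le[of n]
      by (simp add: S_eq ones_simps renewal_simps Suc_diff_le algebra_simps)
  qed
  finally show ?case .
qed

lemma velocity_path_measurable: "V \<in> borel_measurable borel"
  unfolding velocity_def counting_def by measurable

lemma position_eq:
  assumes "0 \<le> t"
  defines "n \<equiv> N t"
  shows "X t = (v1 * renewal R (K n) \<omega> - v2 * renewal L (n - K n) \<omega>) + S n * (t - T n)"
proof -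
  have "(V has_integral (v1 * renewal R (K n) \<omega> - v2 * renewal L (n - K n) \<omega>) + S n * (t - T n)) {0..t}"
    using counting_bounds[OF assms(1)] epoch_nonneg[of n] unfolding n_def
    by (intro has_integral_combine[OF _ _ velocity_integral_epoch velocity_const_integral]) (auto simp del: epoch.simps)
  moreover have "set_integrable lborel {0..t} V"
  proof -
    have "integrable lborel (\<lambda>s. indicator {0..t} s *\<^sub>R V s)"
    proof (rule integrableI_bounded_set_indicator[where B = "max v1 v2"])
      show "AE s in lborel. s \<in> {0..t} \<longrightarrow> norm (V s) \<le> max v1 v2"
        using v by (auto simp: velocity_def trial_velocity_def)
      show "V \<in> borel_measurable lborel" using velocity_path_measurable by simp
    qed (use assms in auto)
    thus ?thesis by (simp add: set_integrable_def)
  qed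
  ultimately show ?thesis
    unfolding position_def using set_borel_integral_eq_integral(2)[of "{0..t}" V]
    by (simp add: integral_unique)
qed

text \<open>The left side is the time spent moving forward. When the process moves forward, all backward
  waiting times so far are complete.\<close>

lemma position_forward:
  assumes "0 \<le> t" "V t = v1"
  shows "(v2 * t + X t) / (v1 + v2) = t - renewal L (N t - K (N t)) \<omega>"
  using assms(2) v unfolding position_eq[OF assms(1)] velocity_def epoch_eq
  by (simp add: field_simps)

lemma position_backward:
  assumes "0 \<le> t" "V t = - v2"
  shows "(v2 * t + X t) / (v1 + v2) = renewal R (K (N t)) \<omega>"
  using assms(2) v unfolding position_eq[OF assms(1)] velocity_def epoch_eq
  by (simp add: field_simps)

lemma velocity_cases: "V t = v1 \<or> V t = - v2"
  by (auto simp: velocity_def trial_velocity_def)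

lemma position_range:
  assumes "0 \<le> t"
  shows "- v2 * t \<le> X t" "X t \<le> v1 * t"
proof -
  let ?\<theta> = "(v2 * t + X t) / (v1 + v2)"
  have nn: "0 \<le> renewal R k \<omega>" "0 \<le> renewal L k \<omega>" for k
    using renewal_mono[of 0 k] by (simp_all add: renewal_simps)
  have T: "renewal R (K (N t)) \<omega> + renewal L (N t - K (N t)) \<omega> \<le> t"
    using counting_bounds(1)[OF assms] unfolding epoch_eq .
  have "0 \<le> ?\<theta> \<and> ?\<theta> \<le> t"
    using velocity_cases[of t]
  proof
    assume "V t = v1"
    from position_forward[OF assms this] show ?thesis using T nn by (smt (verit))
  next
    assume "V t = - v2"
    from position_backward[OF assms this] show ?thesis using T nn by (smt (verit))
  qed
  thus "- v2 * t \<le> X t" "X t \<le> v1 * t"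
    using v by (auto simp: field_simps)
qed

lemma velocity_initial: "V 0 = v1 \<longleftrightarrow> Y 1 \<omega> = 1"
proof -
  have "N 0 = 0" using epoch_less[of 0] by (intro counting_eqI) auto
  thus ?thesis using S_eq(1)[of 0] by (simp add: velocity_def)
qed

end

section \<open>The Polya urn\<close>

text \<open>The probability of \<open>j\<close> further ones among trials \<open>2\<close> to
  \<open>n\<close> of the urn, given that the first trial is one, where \<open>B = b / c\<close>
  and \<open>C = r / c\<close>: a beta-binomial law.\<close>

definition polya_weight :: "real \<Rightarrow> real \<Rightarrow> nat \<Rightarrow> nat \<Rightarrow> real" where
  "polya_weight B C n j = real ((n - 1) choose j) * pochhammer (B + 1) j * pochhammer C (n - 1 - j)
     / pochhammer (B + C + 1) (n - 1)"

lemma polya_weight_Suc: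
  assumes B: "0 < B" "0 < C" and n: "1 \<le> n"
  shows "polya_weight B C (Suc n) 0 = polya_weight B C n 0 * ((C + real (n - 1)) / (B + C + real n))"
    and "polya_weight B C (Suc n) (Suc j)
      = polya_weight B C n j * ((B + 1 + real j) / (B + C + real n))
        + polya_weight B C n (Suc j) * ((C + (real n - 1 - real (Suc j))) / (B + C + real n))"
proof -
  obtain m where m: "n = Suc m" using n by (cases n) auto
  define D where "D = pochhammer (B + C + 1) m"
  have D: "D \<noteq> 0" using B by (simp add: D_def pochhammer_pos less_imp_neq[symmetric])
  define E where "E = B + C + real n"
  have E: "E \<noteq> 0" "pochhammer (B + C + 1) (Suc m) = D * E" using B
    by (auto simp: E_def D_def m pochhammer_Suc add_ac)
  show "polya_weight B C (Suc n) 0 = polya_weight B C n 0 * ((C + real (n - 1)) / (B + C + real n))"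
    unfolding polya_weight_def E_def[symmetric] using D E
    by (simp add: m pochhammer_Suc[of C] flip: D_def)
  show "polya_weight B C (Suc n) (Suc j)
      = polya_weight B C n j * ((B + 1 + real j) / (B + C + real n))
        + polya_weight B C n (Suc j) * ((C + (real n - 1 - real (Suc j))) / (B + C + real n))"
  proof (cases "Suc j \<le> m")
    case True
    then obtain i where i: "m = Suc (j + i)" by (metis add_Suc le_Suc_ex)
    define X where "X = pochhammer (B + 1) j"
    define Z where "Z = pochhammer C i"
    have w1: "polya_weight B C (Suc n) (Suc j)
        = (real (m choose j) + real (m choose Suc j)) * (X * (B + 1 + real j)) * (Z * (C + real i)) / (D * E)"
      using E(2) by (simp add: polya_weight_def m X_def Z_def pochhammer_Suc[of "B + 1"] pochhammer_Suc[of C] i)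
    have w2: "polya_weight B C n j = real (m choose j) * X * (Z * (C + real i)) / D"
      by (simp add: polya_weight_def m X_def Z_def D_def pochhammer_Suc[of C] i)
    have w3: "polya_weight B C n (Suc j) = real (m choose Suc j) * (X * (B + 1 + real j)) * Z / D"
      by (simp add: polya_weight_def m X_def Z_def D_def pochhammer_Suc[of "B + 1"] i)
    have w4: "real n - 1 - real (Suc j) = real i" by (simp add: m i)
    show ?thesis unfolding w1 w2 w3 w4 E_def[symmetric] using D E(1) by (simp add: field_simps)
  next
    case False
    hence z: "m choose Suc j = 0" by (simp add: binomial_eq_0)
    have "pochhammer (B + 1) (Suc j) = pochhammer (B + 1) j * (B + 1 + real j)" by (rule pochhammer_Suc)
    moreover have "real (Suc m choose Suc j) = real (m choose j) + real (m choose Suc j)" by simp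
    moreover have "m - Suc j = m - j" using False by simp
    ultimately show ?thesis
      unfolding polya_weight_def E_def[symmetric]
      unfolding m diff_Suc_1 diff_Suc_Suc E(2) D_def[symmetric] z
      using D E(1) by simp
  qed
qed

context ml_telegraph begin

lemma Y_meas [measurable]: "1 \<le> n \<Longrightarrow> Y n \<in> measurable M (count_space UNIV)"
  by (rule Y_measurable)

lemma Y_zero_one: "1 \<le> n \<Longrightarrow> \<omega> \<in> space M \<Longrightarrow> Y n \<omega> = 0 \<or> Y n \<omega> = 1"
  using Y_01[of n \<omega>] by auto

lemma ones_meas [measurable]: "ones Y n \<in> measurable M (count_space UNIV)"
proof -
  have "(\<lambda>\<omega>. \<Sum>i=1..n. Y i \<omega>) \<in> borel_measurable M"
  proof (rule borel_measurable_sum)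
    fix i assume "i \<in> {1..n}"
    thus "Y i \<in> borel_measurable M" using Y_measurable[of i] by (simp add: measurable_cong_sets[OF refl sets_borel_eq_count_space])
  qed
  thus ?thesis unfolding ones_def[abs_def] by (simp add: measurable_cong_sets[OF refl sets_borel_eq_count_space])
qed

text \<open>The urn rule conditions on a full history, but its right side depends only on the number of
  ones. Summing over the histories with the same number of ones shows that this number is a
  Markov chain. Histories of probability zero, on which the urn rule says nothing, contribute
  zero to both sides.\<close>

lemma polya_step_ones:
  assumes n: "1 \<le> n"
  shows "prob {\<omega>\<in>space M. (Y 1 \<omega> = 1 \<and> ones Y n \<omega> = k) \<and> Y (Suc n) \<omega> = 1}
    = prob {\<omega>\<in>space M. Y 1 \<omega> = 1 \<and> ones Y n \<omega> = k} * ((b + c * real k) / (b + r + c * real n))"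
proof -
  let ?q = "(b + c * real k) / (b + r + c * real n)"
  \<comment> \<open>\<open>F\<close> lists the histories with \<open>k\<close> ones that start with a one; \<open>E y\<close> is the event of the history \<open>y\<close>.\<close>
  define F where "F = {y \<in> {1..n} \<rightarrow>\<^sub>E {0, 1::nat}. y 1 = 1 \<and> (\<Sum>i=1..n. y i) = k}"
  define E where "E y = {\<omega>\<in>space M. \<forall>i\<in>{1..n}. Y i \<omega> = y i}" for y
  have fin: "finite F" unfolding F_def by (rule finite_subset[of _ "{1..n} \<rightarrow>\<^sub>E {0, 1}"]) (auto intro: finite_PiE)
  have E_ev [measurable]: "E y \<in> sets M" for y
    unfolding E_def using Y_measurable by (intro sets.sets_Collect_finite_All) (auto simp: measurable_count_space_eq2_countable)
  have Yn [measurable]: "Y (Suc n) \<in> measurable M (count_space UNIV)" by (rule Y_measurable) simp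
  have disj: "disjoint_family_on E F"
  proof (unfold disjoint_family_on_def, intro ballI impI)
    fix y z assume yz: "y \<in> F" "z \<in> F" "y \<noteq> z"
    show "E y \<inter> E z = {}"
    proof (rule ccontr)
      assume "E y \<inter> E z \<noteq> {}"
      then obtain \<omega> where "\<omega> \<in> E y" "\<omega> \<in> E z" by auto
      hence "y i = z i" if "i \<in> {1..n}" for i using that by (auto simp: E_def)
      hence "y = z" using yz by (intro PiE_ext[of y "{1..n}" "\<lambda>_. {0,1}" z]) (auto simp: F_def)
      thus False using yz by simp
    qed
  qed
  have un: "{\<omega>\<in>space M. Y 1 \<omega> = 1 \<and> ones Y n \<omega> = k} = (\<Union>y\<in>F. E y)"
  proof (intro set_eqI iffI)
    fix \<omega> assume w: "\<omega> \<in> {\<omega>\<in>space M. Y 1 \<omega> = 1 \<and> ones Y n \<omega> = k}"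
    define y where "y = (\<lambda>i\<in>{1..n}. Y i \<omega>)"
    have "y \<in> F" using w n Y_01[of _ \<omega>] by (auto simp: F_def y_def ones_def)
    moreover have "\<omega> \<in> E y" using w by (auto simp: E_def y_def)
    ultimately show "\<omega> \<in> (\<Union>y\<in>F. E y)" by auto
  next
    fix \<omega> assume "\<omega> \<in> (\<Union>y\<in>F. E y)"
    then obtain y where y: "y \<in> F" "\<omega> \<in> E y" by auto
    hence "ones Y n \<omega> = (\<Sum>i=1..n. y i)" unfolding ones_def by (intro sum.cong) (auto simp: E_def)
    thus "\<omega> \<in> {\<omega>\<in>space M. Y 1 \<omega> = 1 \<and> ones Y n \<omega> = k}" using y n by (auto simp: E_def F_def)
  qed
  have one: "prob {\<omega>\<in>E y. Y (Suc n) \<omega> = 1} = prob (E y) * ?q"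
    if y: "y \<in> F" for y
  proof (cases "prob (E y) = 0")
    case True
    have "prob {\<omega>\<in>E y. Y (Suc n) \<omega> = 1} \<le> prob (E y)" by (rule finite_measure_mono) auto
    with True show ?thesis by (simp add: measure_le_0_iff)
  next
    case False
    hence pos: "prob (E y) > 0" by (simp add: zero_less_measure_iff)
    have s: "(\<Sum>i=1..n. real (y i)) = real k" using y unfolding F_def of_nat_sum[symmetric] by simp
    have "\<P>(\<omega> in M. Y (n + 1) \<omega> = 1 \<bar> \<forall>i\<in>{1..n}. Y i \<omega> = y i) = ?q"
      using polya_step[OF n, of y] pos unfolding E_def s by blast
    moreover have "{\<omega> \<in> space M. Y (n + 1) \<omega> = 1 \<and> (\<forall>i\<in>{1..n}. Y i \<omega> = y i)} = {\<omega>\<in>E y. Y (Suc n) \<omega> = 1}"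
      by (auto simp: E_def)
    ultimately have "prob {\<omega>\<in>E y. Y (Suc n) \<omega> = 1} / prob (E y) = ?q"
      by (simp add: cond_prob_def E_def)
    thus ?thesis using False by (simp add: field_simps)
  qed
  have "{\<omega>\<in>space M. (Y 1 \<omega> = 1 \<and> ones Y n \<omega> = k) \<and> Y (Suc n) \<omega> = 1} = (\<Union>y\<in>F. {\<omega>\<in>E y. Y (Suc n) \<omega> = 1})"
    using un by auto
  also have "prob \<dots> = (\<Sum>y\<in>F. prob {\<omega>\<in>E y. Y (Suc n) \<omega> = 1})"
  proof (rule finite_measure_finite_Union[OF fin])
    show "(\<lambda>y. {\<omega> \<in> E y. Y (Suc n) \<omega> = 1}) ` F \<subseteq> events"
    proof safe
      fix y
      have "{\<omega> \<in> E y. Y (Suc n) \<omega> = 1} = E y \<inter> {\<omega> \<in> space M. Y (Suc n) \<omega> = 1}" by (auto simp: E_def)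
      also have "\<dots> \<in> events" by measurable
      finally show "{\<omega> \<in> E y. Y (Suc n) \<omega> = 1} \<in> events" .
    qed
    show "disjoint_family_on (\<lambda>y. {\<omega> \<in> E y. Y (Suc n) \<omega> = 1}) F"
      using disj unfolding disjoint_family_on_def by blast
  qed
  also have "\<dots> = (\<Sum>y\<in>F. prob (E y)) * ?q"
    unfolding sum_distrib_right by (intro sum.cong refl one)
  also have "(\<Sum>y\<in>F. prob (E y)) = prob (\<Union>y\<in>F. E y)"
    using fin disj by (intro finite_measure_finite_Union[symmetric]) auto
  finally show ?thesis unfolding un .
qed

lemma polya_step_zeros:
  assumes n: "1 \<le> n"
  shows "prob {\<omega>\<in>space M. (Y 1 \<omega> = 1 \<and> ones Y n \<omega> = k) \<and> Y (Suc n) \<omega> = 0}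
    = prob {\<omega>\<in>space M. Y 1 \<omega> = 1 \<and> ones Y n \<omega> = k} * ((r + c * (real n - real k)) / (b + r + c * real n))"
proof -
  let ?A = "{\<omega>\<in>space M. Y 1 \<omega> = 1 \<and> ones Y n \<omega> = k}"
  let ?Aone = "{\<omega>\<in>space M. (Y 1 \<omega> = 1 \<and> ones Y n \<omega> = k) \<and> Y (Suc n) \<omega> = 1}"
  let ?Azero = "{\<omega>\<in>space M. (Y 1 \<omega> = 1 \<and> ones Y n \<omega> = k) \<and> Y (Suc n) \<omega> = 0}"
  have [measurable]: "Y (Suc n) \<in> measurable M (count_space UNIV)" "Y 1 \<in> measurable M (count_space UNIV)"
    by (auto intro: Y_measurable)
  have "?A = ?Aone \<union> ?Azero"
  proof (intro set_eqI)
    fix \<omega> show "\<omega> \<in> ?A \<longleftrightarrow> \<omega> \<in> ?Aone \<union> ?Azero"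
      using Y_zero_one[of "Suc n" \<omega>]
      by (cases "\<omega> \<in> space M"; cases "Y (Suc n) \<omega> = 0"; simp)
  qed
  moreover have "prob (?Aone \<union> ?Azero) = prob ?Aone + prob ?Azero"
    by (rule finite_measure_Union) auto
  ultimately have "prob ?A = prob ?A * ((b + c * real k) / (b + r + c * real n)) + prob ?Azero"
    using polya_step_ones[OF n, of k] by simp
  hence "prob ?Azero = prob ?A * (1 - (b + c * real k) / (b + r + c * real n))"
    by (simp add: algebra_simps)
  also have "1 - (b + c * real k) / (b + r + c * real n) = (r + c * (real n - real k)) / (b + r + c * real n)"
  proof -
    have "b + r + c * real n \<noteq> 0" using positive by (smt (verit) mult_nonneg_nonneg of_nat_0_le_iff)
    thus ?thesis by (simp add: field_simps)
  qed
  finally show ?thesis .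
qed

lemma polya_ones:
  assumes "1 \<le> n"
  shows "prob {\<omega>\<in>space M. Y 1 \<omega> = 1 \<and> ones Y n \<omega> = Suc j} = b / (b + r) * polya_weight (b / c) (r / c) n j"
  using assms
proof (induction n arbitrary: j rule: dec_induct)
  case base
  have "{\<omega>\<in>space M. Y 1 \<omega> = 1 \<and> ones Y 1 \<omega> = Suc j} = (if j = 0 then {\<omega>\<in>space M. Y 1 \<omega> = 1} else {})"
    by (auto simp: ones_def)
  thus ?case using polya_first by (simp add: polya_weight_def)
next
  case (step n)
  have n: "1 \<le> n" using step by simp
  let ?A = "\<lambda>k. {\<omega>\<in>space M. Y 1 \<omega> = 1 \<and> ones Y n \<omega> = k}"
  let ?Aone = "{\<omega>\<in>space M. (Y 1 \<omega> = 1 \<and> ones Y n \<omega> = j) \<and> Y (Suc n) \<omega> = 1}"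
  let ?Azero = "{\<omega>\<in>space M. (Y 1 \<omega> = 1 \<and> ones Y n \<omega> = Suc j) \<and> Y (Suc n) \<omega> = 0}"
  have [measurable]: "Y (Suc n) \<in> measurable M (count_space UNIV)" "Y 1 \<in> measurable M (count_space UNIV)"
    by (auto intro: Y_measurable)
  have "{\<omega>\<in>space M. Y 1 \<omega> = 1 \<and> ones Y (Suc n) \<omega> = Suc j} = ?Aone \<union> ?Azero"
    (is "?B = _")
  proof (intro set_eqI)
    fix \<omega> show "\<omega> \<in> ?B \<longleftrightarrow> \<omega> \<in> ?Aone \<union> ?Azero"
      using Y_zero_one[of "Suc n" \<omega>]
      by (cases "\<omega> \<in> space M"; cases "Y (Suc n) \<omega> = 0"; simp add: ones_simps)
  qed
  moreover have "prob (?Aone \<union> ?Azero) = prob ?Aone + prob ?Azero" by (rule finite_measure_Union) auto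
  moreover have "c * (b / c + r / c + real n) = b + r + c * real n"
    using positive by (simp add: algebra_simps)
  hence frac: "(c * x) / (b + r + c * real n) = x / (b / c + r / c + real n)" for x
    using positive by (metis mult_divide_mult_cancel_left less_irrefl)
  have f0: "(r + c * (real n - real (Suc j))) / (b + r + c * real n) = (r / c + (real n - 1 - real j)) / (b / c + r / c + real n)"
    unfolding frac[symmetric] using positive by (simp add: algebra_simps)
  ultimately have *: "prob {\<omega>\<in>space M. Y 1 \<omega> = 1 \<and> ones Y (Suc n) \<omega> = Suc j}
     = prob (?A j) * ((b + c * real j) / (b + r + c * real n))
       + prob (?A (Suc j)) * ((r / c + (real n - 1 - real j)) / (b / c + r / c + real n))"
    using polya_step_ones[OF n, of j] polya_step_zeros[OF n, of "Suc j"] unfolding f0 by simp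
  show ?case
  proof (cases j)
    case 0
    have empty: "?A 0 = {}" using ones_pos[OF n] by fastforce
    have zero: "prob (?A 0) = 0" unfolding empty by simp
    show ?thesis unfolding * unfolding 0 zero step.IH
      using positive n by (simp add: polya_weight_Suc(1) of_nat_diff)
  next
    case (Suc i)
    have f1: "(b + c * real (Suc i)) / (b + r + c * real n) = (b / c + 1 + real i) / (b / c + r / c + real n)"
      unfolding frac[symmetric] using positive by (simp add: algebra_simps)
    have pos: "0 < b / c" "0 < r / c" using positive by simp_all
    show ?thesis unfolding * unfolding Suc step.IH f1 polya_weight_Suc(2)[OF pos n]
      by (simp only: distrib_left mult.assoc)
  qed
qed

lemma polya_forward:
  assumes "j < n"
  shows "prob {\<omega>\<in>space M. (Y 1 \<omega> = 1 \<and> ones Y n \<omega> = Suc j) \<and> Y (Suc n) \<omega> = 1}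
    = b / (b + r) * (real ((n - 1) choose j) * pochhammer ((b + c) / c) (j + 1) * pochhammer (r / c) (n - j - 1)
              * inverse (pochhammer ((b + r + c) / c) n))"
proof -
  obtain m where m: "n = Suc m" using assms by (cases n) auto
  have eq: "(b + c) / c = b / c + 1" "(b + r + c) / c = b / c + r / c + 1"
    using positive by (simp_all add: field_simps)
  have c: "b + c * real (Suc j) = c * (b / c + 1 + real j)" "b + r + c * real n = c * (b / c + r / c + 1 + real m)"
    using positive by (simp_all add: m field_simps)
  have f: "(b + c * real (Suc j)) / (b + r + c * real n) = (b / c + 1 + real j) / (b / c + r / c + 1 + real m)"
    unfolding c using positive by simp
  have n: "1 \<le> n" using assms by simp
  have "m - j = n - j - 1" by (simp add: m)
  thus ?thesis
    unfolding polya_step_ones[OF n] polya_ones[OF n] polya_weight_def eq f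
    by (simp add: m pochhammer_Suc divide_simps)
qed

lemma polya_backward:
  assumes "j < n"
  shows "prob {\<omega>\<in>space M. (Y 1 \<omega> = 1 \<and> ones Y n \<omega> = Suc j) \<and> Y (Suc n) \<omega> = 0}
    = b / (b + r) * (real ((n - 1) choose j) * pochhammer ((b + c) / c) j * pochhammer (r / c) (n - j)
              * inverse (pochhammer ((b + r + c) / c) n))"
proof -
  obtain i where i: "n = Suc (j + i)" using assms by (metis less_imp_Suc_add)
  have eq: "(b + c) / c = b / c + 1" "(b + r + c) / c = b / c + r / c + 1"
    using positive by (simp_all add: field_simps)
  have c: "r + c * (real n - real (Suc j)) = c * (r / c + real i)" "b + r + c * real n = c * (b / c + r / c + 1 + real (j + i))"
    using positive by (simp_all add: i field_simps)
  have f: "(r + c * (real n - real (Suc j))) / (b + r + c * real n) = (r / c + real i) / (b / c + r / c + 1 + real (j + i))"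
    unfolding c using positive by simp
  have n: "1 \<le> n" using assms by simp
  have "n - j = Suc i" "n - 1 - j = i" "n - 1 = j + i" by (auto simp: i)
  thus ?thesis
    unfolding polya_step_zeros[OF n] polya_ones[OF n] polya_weight_def eq f
    by (simp add: i pochhammer_Suc divide_simps)
qed

end

section \<open>Independence of the urn and the waiting times\<close>

text \<open>By independence, condition on the value \<open>w\<close> of a completed sum with density
  \<open>f\<close>; then \<open>t\<close> falls between two later epochs exactly when the two
  other sums straddle \<open>t - w\<close>. All quantities are functions of two independent
  random elements \<open>Z\<close> and \<open>Z'\<close> with values in one type, because that
  is the form in which the independence of the sequences \<open>R\<close> and \<open>L\<close>
  is available.\<close>

lemma (in prob_space) residual_law:
  fixes h u u' :: "'b \<Rightarrow> real"
  assumes ind: "indep_var N Z N' Z'"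
    and hu [measurable]: "h \<in> borel_measurable N" "u \<in> borel_measurable N'" "u' \<in> borel_measurable N'"
    and W: "distributed M lborel (\<lambda>\<omega>. h (Z \<omega>)) f" and B [measurable]: "B \<in> sets borel"
  shows "emeasure M {\<omega>\<in>space M. h (Z \<omega>) \<in> B \<and> u (Z' \<omega>) + h (Z \<omega>) \<le> t \<and> t < u' (Z' \<omega>) + h (Z \<omega>)}
    = (\<integral>\<^sup>+w. f w * (indicator B w * emeasure M {\<omega>\<in>space M. u (Z' \<omega>) \<le> t - w \<and> t - w < u' (Z' \<omega>)}) \<partial>lborel)"
proof -
  have rv [measurable]: "Z \<in> measurable M N" "Z' \<in> measurable M N'"
    using indep_var_rv1[OF ind] indep_var_rv2[OF ind] by auto
  define D where "D = {x \<in> space (N \<Otimes>\<^sub>M N'). h (fst x) \<in> B \<and> u (snd x) + h (fst x) \<le> t \<and> t < u' (snd x) + h (fst x)}"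
  define G where "G w = indicator B w * emeasure M {\<omega>\<in>space M. u (Z' \<omega>) \<le> t - w \<and> t - w < u' (Z' \<omega>)}" for w
  have D: "D \<in> sets (N \<Otimes>\<^sub>M N')" unfolding D_def by measurable
  interpret ZZ: prob_space "distr M N' Z'" by (rule prob_space_distr) measurable
  have G_meas: "G \<in> borel_measurable lborel"
  proof -
    have "{x \<in> space (M \<Otimes>\<^sub>M borel). u (Z' (fst x)) \<le> t - snd x \<and> t - snd x < u' (Z' (fst x))} \<in> sets (M \<Otimes>\<^sub>M borel)"
      by measurable
    hence "{x \<in> space (borel \<Otimes>\<^sub>M M). u (Z' (snd x)) \<le> t - fst x \<and> t - fst x < u' (Z' (snd x))} \<in> sets (borel \<Otimes>\<^sub>M M)"
      by measurable
    from measurable_emeasure_Pair[OF this]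
    have "(\<lambda>w. emeasure M {\<omega>\<in>space M. u (Z' \<omega>) \<le> t - w \<and> t - w < u' (Z' \<omega>)}) \<in> borel_measurable borel"
      by (simp add: space_pair_measure vimage_def)
    thus ?thesis unfolding G_def[abs_def] by (intro borel_measurable_times_ennreal) auto
  qed
  have fibre: "emeasure (distr M N' Z') (Pair z -` D) = G (h z)" if z: "z \<in> space N" for z
  proof (cases "h z \<in> B")
    case True
    have "emeasure (distr M N' Z') (Pair z -` D) = emeasure M (Z' -` (Pair z -` D) \<inter> space M)"
      by (rule emeasure_distr[OF rv(2) sets_Pair1[OF D]])
    also have "Z' -` (Pair z -` D) \<inter> space M = {\<omega>\<in>space M. u (Z' \<omega>) \<le> t - h z \<and> t - h z < u' (Z' \<omega>)}"
      using True z measurable_space[OF rv(2)] by (auto simp: D_def space_pair_measure algebra_simps)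
    finally show ?thesis using True by (simp add: G_def)
  next
    case False
    hence "Pair z -` D = {}" by (auto simp: D_def)
    thus ?thesis using False by (simp add: G_def)
  qed
  have "{\<omega>\<in>space M. h (Z \<omega>) \<in> B \<and> u (Z' \<omega>) + h (Z \<omega>) \<le> t \<and> t < u' (Z' \<omega>) + h (Z \<omega>)}
     = (\<lambda>\<omega>. (Z \<omega>, Z' \<omega>)) -` D \<inter> space M"
    using measurable_space[OF rv(1)] measurable_space[OF rv(2)] by (auto simp: D_def space_pair_measure)
  hence "emeasure M {\<omega>\<in>space M. h (Z \<omega>) \<in> B \<and> u (Z' \<omega>) + h (Z \<omega>) \<le> t \<and> t < u' (Z' \<omega>) + h (Z \<omega>)}
     = emeasure (distr M (N \<Otimes>\<^sub>M N') (\<lambda>\<omega>. (Z \<omega>, Z' \<omega>))) D"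
    using D by (simp add: emeasure_distr)
  also have "distr M (N \<Otimes>\<^sub>M N') (\<lambda>\<omega>. (Z \<omega>, Z' \<omega>)) = distr M N Z \<Otimes>\<^sub>M distr M N' Z'"
    using ind by (simp add: indep_var_distribution_eq)
  also have "emeasure (distr M N Z \<Otimes>\<^sub>M distr M N' Z') D
     = (\<integral>\<^sup>+z. emeasure (distr M N' Z') (Pair z -` D) \<partial>distr M N Z)"
    by (rule ZZ.emeasure_pair_measure_alt) (use D in \<open>simp cong: sets_pair_measure_cong\<close>)
  also have "\<dots> = (\<integral>\<^sup>+z. G (h z) \<partial>distr M N Z)"
    by (rule nn_integral_cong) (simp add: fibre)
  also have "\<dots> = (\<integral>\<^sup>+\<omega>. G (h (Z \<omega>)) \<partial>M)"
    using G_meas by (intro nn_integral_distr) (auto intro: measurable_compose[OF hu(1)])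
  also have "\<dots> = (\<integral>\<^sup>+w. f w * G w \<partial>lborel)"
    by (rule distributed_nn_integral[OF W G_meas, symmetric])
  finally show ?thesis by (simp add: G_def)
qed

abbreviation seq_space :: "(nat \<Rightarrow> real) measure" where
  "seq_space \<equiv> \<Pi>\<^sub>M n\<in>{1..}. (borel :: real measure)"

definition partial_sum :: "nat \<Rightarrow> (nat \<Rightarrow> real) \<Rightarrow> real" where
  "partial_sum k f = (\<Sum>i=1..k. f i)"

lemma partial_sum_measurable [measurable]: "partial_sum k \<in> borel_measurable seq_space"
  unfolding partial_sum_def[abs_def]
  by (rule borel_measurable_sum) (simp add: measurable_component_singleton)

context ml_telegraph begin

sublocale R: gml_renewal M R \<alpha> lam "b / c"
proof
  show "has_pos_density M (R 1) (gml \<alpha> lam (b / c + 1))"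
    using R_first by (simp add: gml_def[abs_def] prabhakar_def mult.assoc)
  show "has_pos_density M (R n) (gml \<alpha> lam 1)" if "2 \<le> n" for n
    using R_later[OF that] positive by (simp add: gml_def[abs_def] prabhakar_def mult.assoc)
qed (use alpha positive indep_R in auto)

sublocale L: gml_renewal M L \<alpha> \<mu> "r / c"
proof
  show "has_pos_density M (L 1) (gml \<alpha> \<mu> (r / c + 1))"
    using L_first by (simp add: gml_def[abs_def] prabhakar_def mult.assoc)
  show "has_pos_density M (L n) (gml \<alpha> \<mu> 1)" if "2 \<le> n" for n
    using L_later[OF that] positive by (simp add: gml_def[abs_def] prabhakar_def mult.assoc)
qed (use alpha positive indep_L in auto)

lemma AE_telegraph_path: "AE \<omega> in M. telegraph_path v1 v2 Y R L \<omega>"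
  using R.X_pos L.X_pos R.renewal_diverges L.renewal_diverges AE_space
proof eventually_elim
  case (elim \<omega>)
  thus ?case using positive Y_01[of _ \<omega>] by unfold_locales auto
qed

definition Yseq where "Yseq \<omega> = (\<lambda>n\<in>{1..}. real (Y n \<omega>))"
definition Rseq where "Rseq \<omega> = (\<lambda>n\<in>{1..}. R n \<omega>)"
definition Lseq where "Lseq \<omega> = (\<lambda>n\<in>{1..}. L n \<omega>)"

lemma indep_RL: "indep_var seq_space Rseq seq_space Lseq"
proof -
  let ?Z = "\<lambda>k \<omega>. \<lambda>n\<in>{1..}. [real (Y n \<omega>), R n \<omega>, L n \<omega>] ! k"
  have "indep_var seq_space ((\<lambda>f. f 1) \<circ> (\<lambda>\<omega>. restrict (\<lambda>i. ?Z i \<omega>) {1}))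
    seq_space ((\<lambda>f. f 2) \<circ> (\<lambda>\<omega>. restrict (\<lambda>i. ?Z i \<omega>) {2}))"
    by (rule indep_var_compose[OF indep_var_restrict[OF indep_YRL, of "{1}" "{2}"]])
      (auto intro!: measurable_component_singleton)
  thus ?thesis by (simp add: comp_def Rseq_def[abs_def] Lseq_def[abs_def])
qed

lemma indep_LR: "indep_var seq_space Lseq seq_space Rseq"
proof -
  let ?Z = "\<lambda>k \<omega>. \<lambda>n\<in>{1..}. [real (Y n \<omega>), R n \<omega>, L n \<omega>] ! k"
  have "indep_var seq_space ((\<lambda>f. f 2) \<circ> (\<lambda>\<omega>. restrict (\<lambda>i. ?Z i \<omega>) {2}))
    seq_space ((\<lambda>f. f 1) \<circ> (\<lambda>\<omega>. restrict (\<lambda>i. ?Z i \<omega>) {1}))"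
    by (rule indep_var_compose[OF indep_var_restrict[OF indep_YRL, of "{2}" "{1}"]])
      (auto intro!: measurable_component_singleton)
  thus ?thesis by (simp add: comp_def Rseq_def[abs_def] Lseq_def[abs_def])
qed

lemma partial_sum_seq:
  "partial_sum k (Rseq \<omega>) = renewal R k \<omega>" "partial_sum k (Lseq \<omega>) = renewal L k \<omega>"
  "partial_sum k (Yseq \<omega>) = real (ones Y k \<omega>)"
  by (simp_all add: partial_sum_def renewal_def ones_def Rseq_def Lseq_def Yseq_def)

text \<open>The event \<open>D\<close> involves both families of waiting times, so the urn has to be
  independent of the pair of sequences and not only of each of them.\<close>

lemma indep_trials_renewals:
  assumes D: "D \<in> sets ((borel \<Otimes>\<^sub>M borel) \<Otimes>\<^sub>M (borel \<Otimes>\<^sub>M borel) :: ((real \<times> real) \<times> (real \<times> real)) measure)"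
  shows "emeasure M {\<omega>\<in>space M. ((Y 1 \<omega> = 1 \<and> ones Y n \<omega> = k) \<and> Y (Suc n) \<omega> = y)
        \<and> ((renewal R i \<omega>, renewal R i' \<omega>), (renewal L l \<omega>, renewal L l' \<omega>)) \<in> D}
    = ennreal (prob {\<omega>\<in>space M. (Y 1 \<omega> = 1 \<and> ones Y n \<omega> = k) \<and> Y (Suc n) \<omega> = y})
      * emeasure M {\<omega>\<in>space M. ((renewal R i \<omega>, renewal R i' \<omega>), (renewal L l \<omega>, renewal L l' \<omega>)) \<in> D}"
proof -
  let ?T = "\<lambda>\<omega>. (Y 1 \<omega> = 1 \<and> ones Y n \<omega> = k) \<and> Y (Suc n) \<omega> = y"
  let ?W = "\<lambda>\<omega>. ((renewal R i \<omega>, renewal R i' \<omega>), (renewal L l \<omega>, renewal L l' \<omega>))"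
  let ?Z = "\<lambda>k \<omega>. \<lambda>n\<in>{1..}. [real (Y n \<omega>), R n \<omega>, L n \<omega>] ! k"
  let ?P = "\<lambda>I :: nat set. \<Pi>\<^sub>M k\<in>I. seq_space"
  let ?Z1 = "\<lambda>\<omega>. restrict (\<lambda>k. ?Z k \<omega>) {0}"
  let ?Z2 = "\<lambda>\<omega>. restrict (\<lambda>k. ?Z k \<omega>) {1, 2}"
  have ind: "indep_var (?P {0}) ?Z1 (?P {1, 2}) ?Z2"
    by (rule indep_var_restrict[OF indep_YRL]) auto
  define A where "A = {f \<in> space (?P {0}). (f 0 1 = 1 \<and> partial_sum n (f 0) = real k) \<and> f 0 (Suc n) = real y}"
  define g where "g f = ((partial_sum i (f 1), partial_sum i' (f 1)), (partial_sum l (f 2), partial_sum l' (f 2)))" for f :: "nat \<Rightarrow> nat \<Rightarrow> real"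
  have f0 [measurable]: "(\<lambda>f. f 0) \<in> measurable (?P {0}) seq_space" by (rule measurable_component_singleton) simp
  have f1 [measurable]: "(\<lambda>f. f 1) \<in> measurable (?P {1, 2}) seq_space" by (rule measurable_component_singleton) simp
  have f2 [measurable]: "(\<lambda>f. f 2) \<in> measurable (?P {1, 2}) seq_space" by (rule measurable_component_singleton) simp
  have A: "A \<in> sets (?P {0})"
  proof -
    have 1: "(\<lambda>f. f 0 j) \<in> borel_measurable (?P {0})" if "1 \<le> j" for j
      by (rule measurable_compose[OF f0 measurable_component_singleton]) (use that in simp)
    have 2: "(\<lambda>f. partial_sum n (f 0)) \<in> borel_measurable (?P {0})" by (rule measurable_compose[OF f0 partial_sum_measurable])
    show ?thesis unfolding A_def
      by (intro sets.sets_Collect_conj borel_measurable_eq 1 2 borel_measurable_const) simp_all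
  qed
  have g: "g \<in> measurable (?P {1, 2}) ((borel \<Otimes>\<^sub>M borel) \<Otimes>\<^sub>M (borel \<Otimes>\<^sub>M borel))"
    unfolding g_def[abs_def]
    by (intro measurable_Pair measurable_compose[OF f1 partial_sum_measurable] measurable_compose[OF f2 partial_sum_measurable])
  let ?C = "g -` D \<inter> space (?P {1, 2})"
  have C: "?C \<in> sets (?P {1, 2})" using g D by (rule measurable_sets)
  have sp: "?Z1 \<omega> \<in> space (?P {0})" "?Z2 \<omega> \<in> space (?P {1, 2})" for \<omega>
    by (auto simp: space_PiM)
  have seqs: "?Z1 \<omega> 0 = Yseq \<omega>" "?Z2 \<omega> 1 = Rseq \<omega>" "?Z2 \<omega> 2 = Lseq \<omega>" for \<omega>
    by (simp_all add: Yseq_def Rseq_def Lseq_def)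
  have YA: "?Z1 \<omega> \<in> A \<longleftrightarrow> ?T \<omega>" for \<omega>
    unfolding A_def mem_Collect_eq seqs partial_sum_seq using sp(1)[of \<omega>] by (simp add: Yseq_def)
  have RLC: "?Z2 \<omega> \<in> ?C \<longleftrightarrow> ?W \<omega> \<in> D" for \<omega>
    using sp(2)[of \<omega>] unfolding Int_iff vimage_eq g_def seqs partial_sum_seq by blast
  have "prob ((\<lambda>\<omega>. (?Z1 \<omega>, ?Z2 \<omega>)) -` (A \<times> ?C) \<inter> space M)
    = prob (?Z1 -` A \<inter> space M) * prob (?Z2 -` ?C \<inter> space M)"
    by (rule indep_varD[OF ind A C])
  also have "(\<lambda>\<omega>. (?Z1 \<omega>, ?Z2 \<omega>)) -` (A \<times> ?C) \<inter> space M
    = {\<omega>\<in>space M. ?T \<omega>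
        \<and> ?W \<omega> \<in> D}"
  proof -
    have "\<omega> \<in> (\<lambda>\<omega>. (?Z1 \<omega>, ?Z2 \<omega>)) -` (A \<times> ?C) \<inter> space M \<longleftrightarrow> ?Z1 \<omega> \<in> A \<and> ?Z2 \<omega> \<in> ?C \<and> \<omega> \<in> space M" for \<omega>
      by blast
    thus ?thesis unfolding YA RLC by blast
  qed
  also have "?Z1 -` A \<inter> space M = {\<omega>\<in>space M. ?T \<omega>}"
    unfolding vimage_eq set_eq_iff Int_iff YA by blast
  also have "?Z2 -` ?C \<inter> space M
    = {\<omega>\<in>space M. ?W \<omega> \<in> D}"
  proof -
    have "\<omega> \<in> ?Z2 -` ?C \<inter> space M \<longleftrightarrow> ?Z2 \<omega> \<in> ?C \<and> \<omega> \<in> space M" for \<omega> by blast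
    thus ?thesis unfolding RLC by blast
  qed
  finally show ?thesis by (simp add: emeasure_eq_measure ennreal_mult)
qed

end

section \<open>The time spent moving forward\<close>

lemma measurable_gml_gap:
  assumes "0 < \<alpha>" "0 < \<gamma>"
  shows "gml_gap \<alpha> \<kappa> \<gamma> \<in> borel_measurable borel"
  unfolding gml_gap_def[abs_def]
  by (rule borel_measurable_times[OF borel_measurable_const measurable_prabhakar])
    (use assms in \<open>simp_all add: add_pos_pos\<close>)

lemma (in gml_renewal) density_nonneg: "1 \<le> k \<Longrightarrow> 0 < s \<Longrightarrow> 0 \<le> gml \<alpha> \<kappa> (g0 + real k) s"
  using renewal_density[of k] by (simp add: has_pos_density_def)

lemma (in gml_renewal) renewal_distributed:
  "1 \<le> k \<Longrightarrow> distributed M lborel (renewal X k) (\<lambda>t. ennreal (if 0 < t then gml \<alpha> \<kappa> (g0 + real k) t else 0))"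
  using renewal_density[of k] by (simp add: has_pos_density_def)

lemma (in gml_renewal) measurable_density: "gml \<alpha> \<kappa> (g0 + real k) \<in> borel_measurable borel"
  by (rule measurable_gml) (use params in auto)

lemma (in gml_renewal) measurable_gap: "gml_gap \<alpha> \<kappa> (g0 + real k) \<in> borel_measurable borel"
  by (rule measurable_gml_gap) (use params in auto)

text \<open>For \<open>m = 0\<close> the sum is empty and \<open>gml_gap\<close> does not apply: only the
  survival of the first waiting time remains. This case is responsible for the separate single
  series in the backward density.\<close>

definition (in gml_renewal) gap :: "nat \<Rightarrow> real \<Rightarrow> real" where
  "gap m s = (if m = 0 then prob {\<omega>\<in>space M. s < X 1 \<omega>} else gml_gap \<alpha> \<kappa> (g0 + real m) s)"

lemma (in gml_renewal) emeasure_gap: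
  assumes "0 < s"
  shows "emeasure M {\<omega>\<in>space M. renewal X m \<omega> \<le> s \<and> s < renewal X (Suc m) \<omega>} = ennreal (gap m s)"
proof (cases "m = 0")
  case True
  have "{\<omega>\<in>space M. renewal X m \<omega> \<le> s \<and> s < renewal X (Suc m) \<omega>} = {\<omega>\<in>space M. s < X 1 \<omega>}"
    using assms by (auto simp: True renewal_simps)
  thus ?thesis by (simp add: True gap_def emeasure_eq_measure)
next
  case False
  thus ?thesis using renewal_gap(1)[of m s] assms by (simp add: gap_def)
qed

lemma (in gml_renewal) gap_nonneg: "0 < s \<Longrightarrow> 0 \<le> gap m s"
  using renewal_gap(2)[of m s] by (auto simp: gap_def)

lemma (in gml_renewal) gap_measurable: "gap m \<in> borel_measurable borel"
proof (cases "m = 0")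
  case True
  have "mono (\<lambda>s. - prob {\<omega>\<in>space M. s < X 1 \<omega>})"
    using X_measurable[of 1] by (auto intro!: monoI finite_measure_mono)
  hence "(\<lambda>s. - (- prob {\<omega>\<in>space M. s < X 1 \<omega>})) \<in> borel_measurable borel"
    by (intro borel_measurable_uminus borel_measurable_mono)
  thus ?thesis by (simp add: gap_def[abs_def] True)
next
  case False
  thus ?thesis using measurable_gap[of m] by (simp add: gap_def[abs_def])
qed

lemma nn_integral_reflect:
  fixes F :: "real \<Rightarrow> ennreal"
  assumes "F \<in> borel_measurable borel"
  shows "(\<integral>\<^sup>+w. F w \<partial>lborel) = (\<integral>\<^sup>+\<theta>. F (t - \<theta>) \<partial>lborel)"
  using nn_integral_real_affine[OF assms, of "-1" t] by simp

text \<open>The event that \<open>t\<close> falls into a forward waiting time between epochs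
  \<open>n\<close> and \<open>n + 1\<close> and that the time spent moving forward lies in
  \<open>B\<close>, expressed through the trials and the partial sums; see
  \<open>renewal_at_iff\<close>.\<close>

definition forward_renewal ::
  "(nat \<Rightarrow> 'a \<Rightarrow> nat) \<Rightarrow> (nat \<Rightarrow> 'a \<Rightarrow> real) \<Rightarrow> (nat \<Rightarrow> 'a \<Rightarrow> real) \<Rightarrow>
    real \<Rightarrow> real set \<Rightarrow> nat \<Rightarrow> nat \<Rightarrow> 'a \<Rightarrow> bool" where
  "forward_renewal Y R L t B n j \<omega> \<longleftrightarrow>
     ((Y 1 \<omega> = 1 \<and> ones Y n \<omega> = Suc j) \<and> Y (Suc n) \<omega> = 1)
      \<and> (renewal R (Suc j) \<omega> + renewal L (n - Suc j) \<omega> \<le> t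
        \<and> t < renewal R (Suc (Suc j)) \<omega> + renewal L (n - Suc j) \<omega> \<and> t - renewal L (n - Suc j) \<omega> \<in> B)"

definition backward_renewal ::
  "(nat \<Rightarrow> 'a \<Rightarrow> nat) \<Rightarrow> (nat \<Rightarrow> 'a \<Rightarrow> real) \<Rightarrow> (nat \<Rightarrow> 'a \<Rightarrow> real) \<Rightarrow>
    real \<Rightarrow> real set \<Rightarrow> nat \<Rightarrow> nat \<Rightarrow> 'a \<Rightarrow> bool" where
  "backward_renewal Y R L t B n j \<omega> \<longleftrightarrow>
     ((Y 1 \<omega> = 1 \<and> ones Y n \<omega> = Suc j) \<and> Y (Suc n) \<omega> = 0)
      \<and> (renewal R (Suc j) \<omega> + renewal L (n - Suc j) \<omega> \<le> t
        \<and> t < renewal R (Suc j) \<omega> + renewal L (Suc (n - Suc j)) \<omega> \<and> renewal R (Suc j) \<omega> \<in> B)"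

context ml_telegraph begin

text \<open>The completed sum is the backward time \<open>t - \<theta>\<close>, hence the reflection at the
  end.\<close>

lemma forward_waits:
  assumes km: "1 \<le> k" "1 \<le> m" and B [measurable]: "B \<in> sets borel" and Bt: "B \<subseteq> {0<..<t}"
  shows "emeasure M {\<omega>\<in>space M. renewal R k \<omega> + renewal L m \<omega> \<le> t
        \<and> t < renewal R (Suc k) \<omega> + renewal L m \<omega> \<and> t - renewal L m \<omega> \<in> B}
    = (\<integral>\<^sup>+\<theta>. ennreal (gml \<alpha> \<mu> (r / c + real m) (t - \<theta>) * gml_gap \<alpha> lam (b / c + real k) \<theta>) * indicator B \<theta> \<partial>lborel)"
proof -
  let ?f = "\<lambda>w. ennreal (if 0 < w then gml \<alpha> \<mu> (r / c + real m) w else 0)"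
  let ?F = "\<lambda>w. ennreal (gml \<alpha> \<mu> (r / c + real m) w * gml_gap \<alpha> lam (b / c + real k) (t - w)) * indicator B (t - w)"
  let ?B = "{w. t - w \<in> B}"
  have B': "?B \<in> sets borel"
  proof -
    have "{w \<in> space borel. t - w \<in> B} \<in> sets borel" by measurable
    thus ?thesis by simp
  qed
  have W: "distributed M lborel (\<lambda>\<omega>. partial_sum m (Lseq \<omega>)) ?f"
    using L.renewal_distributed[OF km(2)] by (simp add: partial_sum_seq)
  have set_eq: "{\<omega>\<in>space M. renewal R k \<omega> + renewal L m \<omega> \<le> t
        \<and> t < renewal R (Suc k) \<omega> + renewal L m \<omega> \<and> t - renewal L m \<omega> \<in> B}
     = {\<omega>\<in>space M. partial_sum m (Lseq \<omega>) \<in> ?B \<and> partial_sum k (Rseq \<omega>) + partial_sum m (Lseq \<omega>) \<le> t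
        \<and> t < partial_sum (Suc k) (Rseq \<omega>) + partial_sum m (Lseq \<omega>)}"
    by (auto simp: partial_sum_seq)
  have "emeasure M {\<omega>\<in>space M. renewal R k \<omega> + renewal L m \<omega> \<le> t
        \<and> t < renewal R (Suc k) \<omega> + renewal L m \<omega> \<and> t - renewal L m \<omega> \<in> B} = (\<integral>\<^sup>+w. ?f w * (indicator ?B w * emeasure M {\<omega>\<in>space M. partial_sum k (Rseq \<omega>) \<le> t - w \<and> t - w < partial_sum (Suc k) (Rseq \<omega>)}) \<partial>lborel)"
    unfolding set_eq
    by (rule residual_law[where h = "partial_sum m" and Z = Lseq and u = "partial_sum k"
        and N = seq_space and N' = seq_space and u' = "partial_sum (Suc k)" and Z' = Rseq and f = "?f" and B = "?B" and t = t,
        OF indep_LR partial_sum_measurable partial_sum_measurable partial_sum_measurable W B'])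
  also have "\<dots> = (\<integral>\<^sup>+w. ?F w \<partial>lborel)"
  proof (rule nn_integral_cong)
    fix w
    show "?f w * (indicator ?B w * emeasure M {\<omega>\<in>space M. partial_sum k (Rseq \<omega>) \<le> t - w \<and> t - w < partial_sum (Suc k) (Rseq \<omega>)}) = ?F w"
    proof (cases "t - w \<in> B")
      case True
      with Bt have w: "0 < w" "0 < t - w" by auto
      show ?thesis
        using True w R.renewal_gap[OF km(1) w(2)] L.density_nonneg[OF km(2) w(1)]
        by (simp add: partial_sum_seq ennreal_mult)
    qed simp
  qed
  also have "\<dots> = (\<integral>\<^sup>+\<theta>. ?F (t - \<theta>) \<partial>lborel)"
  proof (rule nn_integral_reflect)
    note [measurable] = L.measurable_density R.measurable_gap
    show "?F \<in> borel_measurable borel" by measurable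
  qed
  finally show ?thesis by simp
qed

lemma backward_waits:
  assumes km: "1 \<le> k" and B [measurable]: "B \<in> sets borel" and Bt: "B \<subseteq> {0<..<t}"
  shows "emeasure M {\<omega>\<in>space M. renewal R k \<omega> + renewal L m \<omega> \<le> t
        \<and> t < renewal R k \<omega> + renewal L (Suc m) \<omega> \<and> renewal R k \<omega> \<in> B}
    = (\<integral>\<^sup>+\<theta>. ennreal (gml \<alpha> lam (b / c + real k) \<theta> * L.gap m (t - \<theta>)) * indicator B \<theta> \<partial>lborel)"
proof -
  let ?f = "\<lambda>w. ennreal (if 0 < w then gml \<alpha> lam (b / c + real k) w else 0)"
  have W: "distributed M lborel (\<lambda>\<omega>. partial_sum k (Rseq \<omega>)) ?f"
    using R.renewal_distributed[OF km] by (simp add: partial_sum_seq)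
  have set_eq: "{\<omega>\<in>space M. renewal R k \<omega> + renewal L m \<omega> \<le> t
        \<and> t < renewal R k \<omega> + renewal L (Suc m) \<omega> \<and> renewal R k \<omega> \<in> B}
     = {\<omega>\<in>space M. partial_sum k (Rseq \<omega>) \<in> B \<and> partial_sum m (Lseq \<omega>) + partial_sum k (Rseq \<omega>) \<le> t
        \<and> t < partial_sum (Suc m) (Lseq \<omega>) + partial_sum k (Rseq \<omega>)}"
    by (auto simp: partial_sum_seq add.commute)
  have "emeasure M {\<omega>\<in>space M. renewal R k \<omega> + renewal L m \<omega> \<le> t
        \<and> t < renewal R k \<omega> + renewal L (Suc m) \<omega> \<and> renewal R k \<omega> \<in> B} = (\<integral>\<^sup>+w. ?f w * (indicator B w * emeasure M {\<omega>\<in>space M. partial_sum m (Lseq \<omega>) \<le> t - w \<and> t - w < partial_sum (Suc m) (Lseq \<omega>)}) \<partial>lborel)"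
    unfolding set_eq
    by (rule residual_law[where h = "partial_sum k" and Z = Rseq and u = "partial_sum m"
        and N = seq_space and N' = seq_space and u' = "partial_sum (Suc m)" and Z' = Lseq and f = "?f" and B = B and t = t,
        OF indep_RL partial_sum_measurable partial_sum_measurable partial_sum_measurable W B])
  also have "\<dots> = (\<integral>\<^sup>+\<theta>. ennreal (gml \<alpha> lam (b / c + real k) \<theta> * L.gap m (t - \<theta>)) * indicator B \<theta> \<partial>lborel)"
  proof (rule nn_integral_cong)
    fix w
    show "?f w * (indicator B w * emeasure M {\<omega>\<in>space M. partial_sum m (Lseq \<omega>) \<le> t - w \<and> t - w < partial_sum (Suc m) (Lseq \<omega>)})
      = ennreal (gml \<alpha> lam (b / c + real k) w * L.gap m (t - w)) * indicator B w"
    proof (cases "w \<in> B")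
      case True
      with Bt have w: "0 < w" "0 < t - w" by auto
      show ?thesis
        using True w L.emeasure_gap[OF w(2), of m] L.gap_nonneg[OF w(2), of m] R.density_nonneg[OF km w(1)]
        by (simp add: partial_sum_seq ennreal_mult)
    qed simp
  qed
  finally show ?thesis .
qed

definition forward_coeff :: "nat \<Rightarrow> nat \<Rightarrow> real" where
  "forward_coeff n j = real ((n - 1) choose j) * pochhammer ((b + c) / c) (j + 1) * pochhammer (r / c) (n - j - 1)
              * inverse (pochhammer ((b + r + c) / c) n)"

definition backward_coeff :: "nat \<Rightarrow> nat \<Rightarrow> real" where
  "backward_coeff n j = real ((n - 1) choose j) * pochhammer ((b + c) / c) j * pochhammer (r / c) (n - j)
              * inverse (pochhammer ((b + r + c) / c) n)"

definition forward_term :: "real \<Rightarrow> nat \<Rightarrow> nat \<Rightarrow> real \<Rightarrow> real" where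
  "forward_term t n j \<theta> = forward_coeff n j
     * (gml \<alpha> \<mu> (r / c + real (n - Suc j)) (t - \<theta>) * gml_gap \<alpha> lam (b / c + real (Suc j)) \<theta>)"

definition backward_term :: "real \<Rightarrow> nat \<Rightarrow> nat \<Rightarrow> real \<Rightarrow> real" where
  "backward_term t n j \<theta> = backward_coeff n j
     * (gml \<alpha> lam (b / c + real (Suc j)) \<theta> * L.gap (n - Suc j) (t - \<theta>))"

abbreviation "p_first \<equiv> b / (b + r)"

lemma p_first_pos: "0 < p_first" using positive by simp

lemma p_first_eq: "prob {\<omega>\<in>space M. Y 1 \<omega> = 1} = p_first"
  by (rule polya_first)

lemma coeff_nonneg: "0 \<le> forward_coeff n j" "0 \<le> backward_coeff n j"
  unfolding forward_coeff_def backward_coeff_def using positive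
  by (auto intro!: mult_nonneg_nonneg pochhammer_nonneg_real)

text \<open>Both coefficients are conditional probabilities given the first trial, which bounds them without
  any estimate of Pochhammer symbols.\<close>

lemma coeff_le_1:
  assumes "j < n"
  shows "forward_coeff n j \<le> 1" "backward_coeff n j \<le> 1"
proof -
  have Y [measurable]: "Y 1 \<in> measurable M (count_space UNIV)" by (rule Y_measurable) simp
  have "p_first * forward_coeff n j = prob {\<omega>\<in>space M. (Y 1 \<omega> = 1 \<and> ones Y n \<omega> = Suc j) \<and> Y (Suc n) \<omega> = 1}"
    unfolding forward_coeff_def by (rule polya_forward[OF assms, symmetric])
  also have "\<dots> \<le> prob {\<omega>\<in>space M. Y 1 \<omega> = 1}"
    by (rule finite_measure_mono) auto
  also have "\<dots> = p_first * 1" using p_first_eq by simp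
  finally have "p_first * forward_coeff n j \<le> p_first * 1" .
  thus "forward_coeff n j \<le> 1" using p_first_pos by (simp only: mult_le_cancel_left_pos)
  have "p_first * backward_coeff n j = prob {\<omega>\<in>space M. (Y 1 \<omega> = 1 \<and> ones Y n \<omega> = Suc j) \<and> Y (Suc n) \<omega> = 0}"
    unfolding backward_coeff_def by (rule polya_backward[OF assms, symmetric])
  also have "\<dots> \<le> prob {\<omega>\<in>space M. Y 1 \<omega> = 1}"
    by (rule finite_measure_mono) auto
  also have "\<dots> = p_first * 1" using p_first_eq by simp
  finally have "p_first * backward_coeff n j \<le> p_first * 1" .
  thus "backward_coeff n j \<le> 1" using p_first_pos by (simp only: mult_le_cancel_left_pos)
qed

lemma forward_event:
  assumes j: "j < n - 1" and B [measurable]: "B \<in> sets borel" and Bt: "B \<subseteq> {0<..<t}"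
  shows "emeasure M {\<omega>\<in>space M. forward_renewal Y R L t B n j \<omega>}
    = (\<integral>\<^sup>+\<theta>. ennreal (p_first * forward_term t n j \<theta>) * indicator B \<theta> \<partial>lborel)"
proof -
  let ?m = "n - Suc j"
  let ?S = "(borel \<Otimes>\<^sub>M borel) \<Otimes>\<^sub>M (borel \<Otimes>\<^sub>M borel) :: ((real \<times> real) \<times> (real \<times> real)) measure"
  define D where "D = {x \<in> space ?S. fst (fst x) + fst (snd x) \<le> t \<and> t < snd (fst x) + fst (snd x) \<and> t - fst (snd x) \<in> B}"
  have D: "D \<in> sets ?S" unfolding D_def by measurable
  have mem: "((u, u'), (w, w')) \<in> D \<longleftrightarrow> u + w \<le> t \<and> t < u' + w \<and> t - w \<in> B" for u u' w w'
    by (simp add: D_def space_pair_measure)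
  have m: "1 \<le> ?m" and jn: "j < n" using j by auto
  note [measurable] = L.measurable_density R.measurable_gap
  have "emeasure M {\<omega>\<in>space M. forward_renewal Y R L t B n j \<omega>}
    = ennreal (p_first * forward_coeff n j)
      * (\<integral>\<^sup>+\<theta>. ennreal (gml \<alpha> \<mu> (r / c + real ?m) (t - \<theta>) * gml_gap \<alpha> lam (b / c + real (Suc j)) \<theta>) * indicator B \<theta> \<partial>lborel)"
    using indep_trials_renewals[OF D, of n "Suc j" 1 "Suc j" "Suc (Suc j)" ?m ?m]
    unfolding forward_renewal_def mem polya_forward[OF jn] forward_waits[OF _ m B Bt, of "Suc j", simplified] forward_coeff_def
    by simp
  also have "\<dots> = (\<integral>\<^sup>+\<theta>. ennreal (p_first * forward_coeff n j) *
      (ennreal (gml \<alpha> \<mu> (r / c + real ?m) (t - \<theta>) * gml_gap \<alpha> lam (b / c + real (Suc j)) \<theta>) * indicator B \<theta>) \<partial>lborel)"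
    by (rule nn_integral_cmult[symmetric]) measurable
  also have "\<dots> = (\<integral>\<^sup>+\<theta>. ennreal (p_first * forward_term t n j \<theta>) * indicator B \<theta> \<partial>lborel)"
  proof (rule nn_integral_cong)
    fix \<theta>
    have "0 \<le> p_first * forward_coeff n j" by (intro mult_nonneg_nonneg less_imp_le[OF p_first_pos] coeff_nonneg)
    from ennreal_mult'[OF this]
    show "ennreal (p_first * forward_coeff n j) * (ennreal (gml \<alpha> \<mu> (r / c + real ?m) (t - \<theta>) * gml_gap \<alpha> lam (b / c + real (Suc j)) \<theta>) * indicator B \<theta>)
      = ennreal (p_first * forward_term t n j \<theta>) * indicator B \<theta>"
      unfolding forward_term_def by (simp only: mult.assoc)
  qed
  finally show ?thesis .
qed

lemma backward_event:
  assumes j: "j < n" and B [measurable]: "B \<in> sets borel" and Bt: "B \<subseteq> {0<..<t}"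
  shows "emeasure M {\<omega>\<in>space M. backward_renewal Y R L t B n j \<omega>}
    = (\<integral>\<^sup>+\<theta>. ennreal (p_first * backward_term t n j \<theta>) * indicator B \<theta> \<partial>lborel)"
proof -
  let ?m = "n - Suc j"
  let ?S = "(borel \<Otimes>\<^sub>M borel) \<Otimes>\<^sub>M (borel \<Otimes>\<^sub>M borel) :: ((real \<times> real) \<times> (real \<times> real)) measure"
  define D where "D = {x \<in> space ?S. fst (fst x) + fst (snd x) \<le> t \<and> t < fst (fst x) + snd (snd x) \<and> fst (fst x) \<in> B}"
  have D: "D \<in> sets ?S" unfolding D_def by measurable
  have mem: "((u, u'), (w, w')) \<in> D \<longleftrightarrow> u + w \<le> t \<and> t < u + w' \<and> u \<in> B" for u u' w w'
    by (simp add: D_def space_pair_measure)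
  note [measurable] = R.measurable_density L.gap_measurable
  have "emeasure M {\<omega>\<in>space M. backward_renewal Y R L t B n j \<omega>}
    = ennreal (p_first * backward_coeff n j)
      * (\<integral>\<^sup>+\<theta>. ennreal (gml \<alpha> lam (b / c + real (Suc j)) \<theta> * L.gap ?m (t - \<theta>)) * indicator B \<theta> \<partial>lborel)"
    using indep_trials_renewals[OF D, of n "Suc j" 0 "Suc j" "Suc j" ?m "Suc ?m"]
    unfolding backward_renewal_def mem polya_backward[OF j] backward_waits[OF _ B Bt, of "Suc j", simplified] backward_coeff_def
    by simp
  also have "\<dots> = (\<integral>\<^sup>+\<theta>. ennreal (p_first * backward_coeff n j) *
      (ennreal (gml \<alpha> lam (b / c + real (Suc j)) \<theta> * L.gap ?m (t - \<theta>)) * indicator B \<theta>) \<partial>lborel)"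
    by (rule nn_integral_cmult[symmetric]) measurable
  also have "\<dots> = (\<integral>\<^sup>+\<theta>. ennreal (p_first * backward_term t n j \<theta>) * indicator B \<theta> \<partial>lborel)"
  proof (rule nn_integral_cong)
    fix \<theta>
    have "0 \<le> p_first * backward_coeff n j" by (intro mult_nonneg_nonneg less_imp_le[OF p_first_pos] coeff_nonneg)
    from ennreal_mult'[OF this]
    show "ennreal (p_first * backward_coeff n j) * (ennreal (gml \<alpha> lam (b / c + real (Suc j)) \<theta> * L.gap ?m (t - \<theta>)) * indicator B \<theta>)
      = ennreal (p_first * backward_term t n j \<theta>) * indicator B \<theta>"
      unfolding backward_term_def by (simp only: mult.assoc)
  qed
  finally show ?thesis .
qed

lemma ones_le_space: "\<omega> \<in> space M \<Longrightarrow> ones Y n \<omega> \<le> n"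
  using Y_01 by (intro ones_le_trials) auto

lemma trial_velocity_measurable: "trial_velocity v1 v2 Y n \<in> borel_measurable M"
proof -
  have [measurable]: "Y (n + 1) \<in> measurable M (count_space UNIV)" by (rule Y_measurable) simp
  show ?thesis unfolding trial_velocity_def[abs_def] by measurable
qed

lemma epoch_measurable: "epoch v1 v2 Y R L n \<in> borel_measurable M"
proof (induction n)
  case 0
  have "epoch v1 v2 Y R L 0 = (\<lambda>_. 0)" by (simp add: fun_eq_iff)
  then show ?case by simp
next
  case (Suc n)
  note [measurable] = Suc trial_velocity_measurable
  have R [measurable]: "(\<lambda>\<omega>. R (Suc (ones Y n \<omega>)) \<omega>) \<in> borel_measurable M"
    by (rule measurable_compose_countable[of "\<lambda>i. R (Suc i)", OF R.X_measurable ones_meas]) simp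
  have L [measurable]: "(\<lambda>\<omega>. L (Suc (n - ones Y n \<omega>)) \<omega>) \<in> borel_measurable M"
    by (rule measurable_compose_countable[of "\<lambda>i. L (Suc (n - i))", OF L.X_measurable ones_meas]) simp
  have "(\<lambda>\<omega>. epoch v1 v2 Y R L n \<omega> + (if trial_velocity v1 v2 Y n \<omega> = v1 then R (Suc (ones Y n \<omega>)) \<omega> else L (Suc (n - ones Y n \<omega>)) \<omega>)) \<in> borel_measurable M"
    by measurable
  also have "?this \<longleftrightarrow> epoch v1 v2 Y R L (Suc n) \<in> borel_measurable M"
    by (rule measurable_cong) (use ones_le_space[of _ n] in \<open>simp add: ones_def Suc_diff_le\<close>)
  finally show ?case .
qed

abbreviation "V \<equiv> velocity v1 v2 Y R L"
abbreviation "X \<equiv> position v1 v2 Y R L"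
abbreviation "forward_share t x \<equiv> (v2 * t + x) / (v1 + v2)"
abbreviation "moving v t \<equiv> {\<omega>\<in>space M. Y 1 \<omega> = 1 \<and> V t \<omega> = v}"

lemma velocity_jointly_measurable:
  "(\<lambda>x. V (snd x) (fst x)) \<in> borel_measurable (M \<Otimes>\<^sub>M borel)"
proof -
  note [measurable] = epoch_measurable trial_velocity_measurable
  have "(\<lambda>x. counting v1 v2 Y R L (snd x) (fst x)) \<in> measurable (M \<Otimes>\<^sub>M borel) (count_space UNIV)"
    unfolding counting_def by measurable
  thus ?thesis unfolding velocity_def
    by (rule measurable_compose_countable[of "\<lambda>n x. trial_velocity v1 v2 Y n (fst x)", rotated]) measurable
qed

lemma velocity_measurable: "V t \<in> borel_measurable M"
proof -
  have "(\<lambda>\<omega>. (\<omega>, t)) \<in> measurable M (M \<Otimes>\<^sub>M borel)" by measurable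
  from measurable_compose[OF this velocity_jointly_measurable] show ?thesis by simp
qed

lemma position_measurable: "X t \<in> borel_measurable M"
proof -
  note [measurable] = velocity_jointly_measurable
  have "(\<lambda>x. indicator {0..t} (snd x) *\<^sub>R V (snd x) (fst x)) \<in> borel_measurable (M \<Otimes>\<^sub>M lborel)"
  proof -
    have "(\<lambda>x. indicator {0..t} (snd x) *\<^sub>R V (snd x) (fst x)) \<in> borel_measurable (M \<Otimes>\<^sub>M borel)"
      by measurable
    thus ?thesis by (simp cong: measurable_cong_sets sets_pair_measure_cong)
  qed
  thus ?thesis unfolding position_def[abs_def] set_lebesgue_integral_def
    by (intro lborel.borel_measurable_lebesgue_integral) (simp add: case_prod_unfold)
qed

end

section \<open>Summation over the renewals\<close>

text \<open>The events \<open>G n j\<close> need to be disjoint only almost everywhere. This matters because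
  the epochs are increasing only almost surely.\<close>

lemma emeasure_AE_double_suminf:
  assumes E: "E \<in> sets M" and G: "\<And>n j. G n j \<in> sets M"
    and dec: "AE \<omega> in M. (indicator E \<omega> :: ennreal) = (\<Sum>n. \<Sum>j<J n. indicator (G n j) \<omega>)"
    and law: "\<And>n j. j < J n \<Longrightarrow> emeasure M (G n j) = (\<integral>\<^sup>+\<theta>. f n j \<theta> * indicator B \<theta> \<partial>lborel)"
    and f [measurable]: "\<And>n j. f n j \<in> borel_measurable borel" and B [measurable]: "B \<in> sets borel"
  shows "emeasure M E = (\<integral>\<^sup>+\<theta>. (\<Sum>n. \<Sum>j<J n. f n j \<theta>) * indicator B \<theta> \<partial>(lborel :: real measure))"
proof -
  have "emeasure M E = (\<integral>\<^sup>+\<omega>. indicator E \<omega> \<partial>M)" using E by simp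
  also have "\<dots> = (\<integral>\<^sup>+\<omega>. (\<Sum>n. \<Sum>j<J n. indicator (G n j) \<omega>) \<partial>M)"
    by (rule nn_integral_cong_AE[OF dec])
  also have "\<dots> = (\<Sum>n. \<integral>\<^sup>+\<omega>. (\<Sum>j<J n. indicator (G n j) \<omega>) \<partial>M)"
    using G by (intro nn_integral_suminf borel_measurable_sum) auto
  also have "\<dots> = (\<Sum>n. \<Sum>j<J n. emeasure M (G n j))"
    using G by (simp add: nn_integral_sum)
  also have "\<dots> = (\<Sum>n. \<Sum>j<J n. \<integral>\<^sup>+\<theta>. f n j \<theta> * indicator B \<theta> \<partial>lborel)"
    using law by simp
  also have "\<dots> = (\<Sum>n. \<integral>\<^sup>+\<theta>. (\<Sum>j<J n. f n j \<theta> * indicator B \<theta>) \<partial>lborel)"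
    by (subst nn_integral_sum) auto
  also have "\<dots> = (\<integral>\<^sup>+\<theta>. (\<Sum>n. \<Sum>j<J n. f n j \<theta> * indicator B \<theta>) \<partial>lborel)"
    by (rule nn_integral_suminf[symmetric]) measurable
  also have "\<dots> = (\<integral>\<^sup>+\<theta>. (\<Sum>n. \<Sum>j<J n. f n j \<theta>) * indicator B \<theta> \<partial>lborel)"
    by (simp add: sum_distrib_right[symmetric])
  finally show ?thesis .
qed

lemma indicator_double_suminf:
  assumes P: "\<And>n j. j < J n \<Longrightarrow> P n j \<longleftrightarrow> E \<and> n = n0 \<and> j = j0" and j0: "E \<Longrightarrow> j0 < (J n0 :: nat)"
  shows "(of_bool E :: ennreal) = (\<Sum>n. \<Sum>j<J n. of_bool (P n j))"
proof -
  have "(\<Sum>j<J n. of_bool (P n j)) = (if n = n0 then of_bool E else 0 :: ennreal)" for n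
  proof (cases "E \<and> n = n0")
    case True
    hence "(\<Sum>j<J n. of_bool (P n j) :: ennreal) = (\<Sum>j<J n. if j = j0 then 1 else 0)"
      by (intro sum.cong) (auto simp: P)
    thus ?thesis using True j0 by simp
  next
    case False
    hence "(\<Sum>j<J n. of_bool (P n j) :: ennreal) = (\<Sum>j<J n. 0)"
      by (intro sum.cong) (auto simp: P)
    thus ?thesis using False by auto
  qed
  thus ?thesis using sums_unique[OF sums_single[of n0 "\<lambda>_. of_bool E :: ennreal"]] by simp
qed

lemma continuous_on_suminf_geometric:
  fixes f :: "nat \<Rightarrow> real \<Rightarrow> real"
  assumes cont: "\<And>n. continuous_on {l<..<u} (f n)"
    and bound: "\<And>a d. l < a \<Longrightarrow> a \<le> d \<Longrightarrow> d < u \<Longrightarrow> \<exists>C. \<forall>n. \<forall>x\<in>{a..d}. \<bar>f n x\<bar> \<le> C * (1/2) ^ n"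
  shows "continuous_on {l<..<u} (\<lambda>x. \<Sum>n. f n x)"
proof (rule continuous_at_imp_continuous_on, intro ballI)
  fix x assume x: "x \<in> {l<..<u}"
  define a where "a = (l + x) / 2"
  define d where "d = (x + u) / 2"
  have ad: "l < a" "a < x" "x < d" "d < u" using x by (auto simp: a_def d_def field_simps)
  obtain C where C: "\<And>n y. y \<in> {a..d} \<Longrightarrow> \<bar>f n y\<bar> \<le> C * (1/2) ^ n"
    using bound[of a d] ad by fastforce
  have "summable (\<lambda>n. C * (1/2 :: real) ^ n)" by (intro summable_mult summable_geometric) simp
  hence "uniform_limit {a..d} (\<lambda>n x. \<Sum>i<n. f i x) (\<lambda>x. \<Sum>n. f n x) sequentially"
    using C by (intro Weierstrass_m_test) auto
  moreover have "continuous_on {a..d} (\<lambda>x. \<Sum>i<n. f i x)" for n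
    using ad by (intro continuous_on_sum continuous_on_subset[OF cont]) auto
  ultimately have "continuous_on {a..d} (\<lambda>x. \<Sum>n. f n x)"
    by (intro uniform_limit_theorem[where F = sequentially]) auto
  thus "isCont (\<lambda>x. \<Sum>n. f n x) x"
    by (rule continuous_on_interior) (use ad in auto)
qed

text \<open>The distribution function is compared with its value at an interior base point
  \<open>a < x\<close>, so that whatever mass lies at or below \<open>lo\<close> enters only as
  a constant. Continuity of \<open>g\<close> gives the derivative at each point.\<close>

lemma (in finite_measure) cdf_has_derivative:
  fixes X :: "'a \<Rightarrow> real" and g :: "real \<Rightarrow> real"
  assumes X [measurable]: "X \<in> borel_measurable M" and Q [measurable]: "Q \<in> sets M"
    and cont: "continuous_on {lo<..<hi} g" and nonneg: "\<And>x. lo < x \<Longrightarrow> x < hi \<Longrightarrow> 0 \<le> g x"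
    and law: "\<And>A. A \<in> sets borel \<Longrightarrow> A \<subseteq> {lo<..<hi} \<Longrightarrow>
       emeasure M {\<omega>\<in>space M. \<omega> \<in> Q \<and> X \<omega> \<in> A} = (\<integral>\<^sup>+x. ennreal (g x) * indicator A x \<partial>lborel)"
    and x: "lo < x" "x < hi"
  shows "((\<lambda>y. measure M {\<omega>\<in>space M. \<omega> \<in> Q \<and> X \<omega> \<le> y}) has_real_derivative g x) (at x)"
proof -
  define a where "a = (lo + x) / 2"
  define d where "d = (x + hi) / 2"
  have ad: "lo < a" "a < x" "x < d" "d < hi" using x by (auto simp: a_def d_def field_simps)
  let ?H = "\<lambda>y. measure M {\<omega>\<in>space M. \<omega> \<in> Q \<and> X \<omega> \<le> y}"
  have contad: "continuous_on {a..d} g" by (rule continuous_on_subset[OF cont]) (use ad in auto)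
  have H: "?H y = ?H a + integral {a..y} g" if y: "y \<in> {a..d}" for y
  proof -
    have g0: "0 \<le> g u" if "u \<in> {a..y}" for u using that y ad by (intro nonneg) auto
    have int: "set_integrable lborel {a..y} g"
      by (rule borel_integrable_atLeastAtMost', rule continuous_on_subset[OF contad]) (use y in auto)
    have "emeasure M {\<omega>\<in>space M. \<omega> \<in> Q \<and> X \<omega> \<in> {a<..y}} = (\<integral>\<^sup>+u. ennreal (g u) * indicator {a<..y} u \<partial>lborel)"
      by (rule law) (use y ad in auto)
    also have "\<dots> = (\<integral>\<^sup>+u. ennreal (indicator {a..y} u *\<^sub>R g u) \<partial>lborel)"
      using AE_lborel_singleton[of a]
      by (intro nn_integral_cong_AE) (auto simp: indicator_def elim!: eventually_mono)
    also have "\<dots> = ennreal (\<integral>u. indicator {a..y} u *\<^sub>R g u \<partial>lborel)"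
      using int g0 by (intro nn_integral_eq_integral) (auto simp: set_integrable_def indicator_def)
    also have "(\<integral>u. indicator {a..y} u *\<^sub>R g u \<partial>lborel) = integral {a..y} g"
      using set_borel_integral_eq_integral(2)[OF int] by (simp add: set_lebesgue_integral_def)
    finally have "emeasure M {\<omega>\<in>space M. \<omega> \<in> Q \<and> X \<omega> \<in> {a<..y}} = ennreal (integral {a..y} g)" .
    moreover have "0 \<le> integral {a..y} g"
      using g0 int by (intro integral_nonneg) (auto dest: set_borel_integral_eq_integral(1))
    ultimately have m: "measure M {\<omega>\<in>space M. \<omega> \<in> Q \<and> X \<omega> \<in> {a<..y}} = integral {a..y} g"
      by (simp add: measure_def)
    have "{\<omega>\<in>space M. \<omega> \<in> Q \<and> X \<omega> \<le> y} = {\<omega>\<in>space M. \<omega> \<in> Q \<and> X \<omega> \<le> a} \<union> {\<omega>\<in>space M. \<omega> \<in> Q \<and> X \<omega> \<in> {a<..y}}"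
      using y by auto
    moreover have "measure M ({\<omega>\<in>space M. \<omega> \<in> Q \<and> X \<omega> \<le> a} \<union> {\<omega>\<in>space M. \<omega> \<in> Q \<and> X \<omega> \<in> {a<..y}})
       = ?H a + measure M {\<omega>\<in>space M. \<omega> \<in> Q \<and> X \<omega> \<in> {a<..y}}"
    proof (rule finite_measure_Union)
      show "{\<omega>\<in>space M. \<omega> \<in> Q \<and> X \<omega> \<le> a} \<in> sets M" by measurable
      show "{\<omega>\<in>space M. \<omega> \<in> Q \<and> X \<omega> \<in> {a<..y}} \<in> sets M" by measurable
    qed auto
    ultimately show ?thesis using m by simp
  qed
  have "((\<lambda>y. integral {a..y} g) has_real_derivative g x) (at x within {a..d})"
    by (rule integral_has_real_derivative[OF contad]) (use ad in auto)
  hence "((\<lambda>y. integral {a..y} g) has_real_derivative g x) (at x)"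
    by (simp only: at_within_Icc_at[OF ad(2,3)])
  from DERIV_add[OF DERIV_const this, of "?H a"]
  have "((\<lambda>y. ?H a + integral {a..y} g) has_real_derivative g x) (at x)" by simp
  thus ?thesis
  proof (rule has_field_derivative_transform_within_open[where S = "{a<..<d}"])
    show "?H a + integral {a..y} g = ?H y" if "y \<in> {a<..<d}" for y using H[of y] that by simp
  qed (use ad in auto)
qed

context telegraph_path begin

text \<open>With \<open>j + 1\<close> ones among the first \<open>n\<close> trials, the epochs
  \<open>n\<close> and \<open>n + 1\<close> are explicit sums, and the trial
  \<open>n + 1\<close> decides which of the two sums grows.\<close>

lemma renewal_at_iff:
  assumes t: "0 < t" and Kn: "K n = Suc j"
  shows "Y (Suc n) \<omega> = 1 \<and> renewal R (Suc j) \<omega> + renewal L (n - Suc j) \<omega> \<le> t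
           \<and> t < renewal R (Suc (Suc j)) \<omega> + renewal L (n - Suc j) \<omega> \<longleftrightarrow> N t = n \<and> V t = v1"
    and "Y (Suc n) \<omega> = 0 \<and> renewal R (Suc j) \<omega> + renewal L (n - Suc j) \<omega> \<le> t
           \<and> t < renewal R (Suc j) \<omega> + renewal L (Suc (n - Suc j)) \<omega> \<longleftrightarrow> N t = n \<and> V t = - v2"
proof -
  have Tn: "T n = renewal R (Suc j) \<omega> + renewal L (n - Suc j) \<omega>"
    unfolding epoch_eq Kn ..
  have le: "Suc j \<le> n" using ones_le[of n] Kn by simp
  have one: "T (Suc n) = renewal R (Suc (Suc j)) \<omega> + renewal L (n - Suc j) \<omega>" if "Y (Suc n) \<omega> = 1"
    unfolding epoch_eq using that Kn by (simp add: ones_simps)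
  have zero: "T (Suc n) = renewal R (Suc j) \<omega> + renewal L (Suc (n - Suc j)) \<omega>" if "Y (Suc n) \<omega> = 0"
    unfolding epoch_eq using that Kn le by (simp add: ones_simps Suc_diff_Suc)
  have V: "V t = v1 \<longleftrightarrow> Y (Suc n) \<omega> = 1" "V t = - v2 \<longleftrightarrow> Y (Suc n) \<omega> = 0" if "N t = n"
    unfolding velocity_def that S_eq by simp_all
  have N: "N t = n \<longleftrightarrow> T n \<le> t \<and> t < T (Suc n)" using counting_eq_iff t by simp
  show "Y (Suc n) \<omega> = 1 \<and> renewal R (Suc j) \<omega> + renewal L (n - Suc j) \<omega> \<le> t
           \<and> t < renewal R (Suc (Suc j)) \<omega> + renewal L (n - Suc j) \<omega> \<longleftrightarrow> N t = n \<and> V t = v1"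
    using V(1) N one Tn by metis
  show "Y (Suc n) \<omega> = 0 \<and> renewal R (Suc j) \<omega> + renewal L (n - Suc j) \<omega> \<le> t
           \<and> t < renewal R (Suc j) \<omega> + renewal L (Suc (n - Suc j)) \<omega> \<longleftrightarrow> N t = n \<and> V t = - v2"
    using V(2) N zero Tn by metis
qed

abbreviation "forward_time t \<equiv> (v2 * t + X t) / (v1 + v2)"

text \<open>The forward time \<open>t\<close> is excluded by \<open>B \<subseteq> {0<..<t}\<close>, so at
  least one backward waiting time is complete. This is why \<open>j\<close> stays below
  \<open>n - 1\<close> and why paths that never turn back, whose position is the atom
  \<open>v1 * t\<close>, do not appear.\<close>

lemma forward_decomposition:
  assumes t: "0 < t" and B: "B \<subseteq> {0<..<t}"
  shows "(of_bool (Y 1 \<omega> = 1 \<and> V t = v1 \<and> forward_time t \<in> B) :: ennreal)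
    = (\<Sum>n. \<Sum>j<n - 1. of_bool (forward_renewal Y R L t B n j \<omega>))"
proof (rule indicator_double_suminf[where ?n0.0 = "N t" and ?j0.0 = "K (N t) - 1"])
  fix n j :: nat assume j: "j < n - 1"
  let ?E = "Y 1 \<omega> = 1 \<and> V t = v1 \<and> forward_time t \<in> B"
  have theta: "forward_time t = t - renewal L (N t - K (N t)) \<omega>" if "V t = v1"
    using position_forward[of t] t that by simp
  show "forward_renewal Y R L t B n j \<omega>
    \<longleftrightarrow> ?E \<and> n = N t \<and> j = K (N t) - 1" (is "?P \<longleftrightarrow> ?Q")
  proof
    assume P: ?P
    hence "N t = n \<and> V t = v1" using renewal_at_iff(1)[OF t, of n j] unfolding forward_renewal_def by blast
    thus ?Q using P theta unfolding forward_renewal_def by auto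
  next
    assume Q: ?Q
    hence "1 \<le> K n" using ones_pos[of n Y \<omega>] j by auto
    hence Kn: "K n = Suc j" using Q by simp
    show ?P unfolding forward_renewal_def using renewal_at_iff(1)[OF t Kn] Q theta Kn by auto
  qed
next
  assume E: "Y 1 \<omega> = 1 \<and> V t = v1 \<and> forward_time t \<in> B"
  hence "t - renewal L (N t - K (N t)) \<omega> \<in> B" using position_forward[of t] t by simp
  hence "renewal L (N t - K (N t)) \<omega> \<noteq> 0" using B by auto
  hence "K (N t) < N t" by (cases "N t - K (N t)") (auto simp: renewal_simps)
  moreover from this have "1 \<le> K (N t)" using E ones_pos[of "N t" Y \<omega>] by simp
  ultimately show "K (N t) - 1 < N t - 1" by simp
qed

text \<open>Here \<open>j = n - 1\<close> is allowed: the process may be in its first backward waiting time.\<close>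

lemma backward_decomposition:
  assumes t: "0 < t" and B: "B \<subseteq> {0<..<t}"
  shows "(of_bool (Y 1 \<omega> = 1 \<and> V t = - v2 \<and> forward_time t \<in> B) :: ennreal)
    = (\<Sum>n. \<Sum>j<n. of_bool (backward_renewal Y R L t B n j \<omega>))"
proof (rule indicator_double_suminf[where ?n0.0 = "N t" and ?j0.0 = "K (N t) - 1"])
  fix n j :: nat assume j: "j < n"
  let ?E = "Y 1 \<omega> = 1 \<and> V t = - v2 \<and> forward_time t \<in> B"
  have theta: "forward_time t = renewal R (K (N t)) \<omega>" if "V t = - v2"
    using position_backward[of t] t that by simp
  show "backward_renewal Y R L t B n j \<omega>
    \<longleftrightarrow> ?E \<and> n = N t \<and> j = K (N t) - 1" (is "?P \<longleftrightarrow> ?Q")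
  proof
    assume P: ?P
    hence "N t = n \<and> V t = - v2" using renewal_at_iff(2)[OF t, of n j] unfolding backward_renewal_def by blast
    thus ?Q using P theta unfolding backward_renewal_def by auto
  next
    assume Q: ?Q
    hence "1 \<le> K n" using ones_pos[of n Y \<omega>] j by auto
    hence Kn: "K n = Suc j" using Q by simp
    show ?P unfolding backward_renewal_def using renewal_at_iff(2)[OF t Kn] Q theta Kn by auto
  qed
next
  assume E: "Y 1 \<omega> = 1 \<and> V t = - v2 \<and> forward_time t \<in> B"
  hence "renewal R (K (N t)) \<omega> \<in> B" using position_backward[of t] t by simp
  hence "renewal R (K (N t)) \<omega> \<noteq> 0" using B by auto
  hence "1 \<le> K (N t)" by (cases "K (N t)") (auto simp: renewal_simps)
  thus "K (N t) - 1 < N t" using ones_le[of "N t"] by simp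
qed

end

section \<open>Convergence of the density series\<close>

lemma powr_quarter_le:
  fixes g :: real
  assumes "0 \<le> g"
  shows "(1/4) powr (g + real m) \<le> (1/4) ^ m"
proof -
  have "(1/4 :: real) powr g \<le> 1" using assms by (simp add: powr_le_one_le powr_mono' powr_le1)
  thus ?thesis by (simp add: powr_add powr_realpow)
qed

lemma sum_quarter_le:
  fixes f :: "nat \<Rightarrow> real"
  assumes C: "0 \<le> C" and m: "m \<le> n" and f: "\<And>j. j < m \<Longrightarrow> \<bar>f j\<bar> \<le> C * (1/4) ^ n"
  shows "\<bar>\<Sum>j<m. f j\<bar> \<le> C * (1/2) ^ n"
proof -
  have "\<bar>\<Sum>j<m. f j\<bar> \<le> (\<Sum>j<m. C * (1/4) ^ n)"
    using f by (intro order_trans[OF sum_abs] sum_mono) auto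
  also have "\<dots> = C * (real m * (1/4) ^ n)" by simp
  also have "\<dots> \<le> C * (2 ^ n * (1/4) ^ n)"
  proof (intro mult_left_mono mult_right_mono C)
    \<comment> \<open>The number of terms in the row is absorbed by \<open>n \<le> 2 ^ n\<close>.\<close>
    have "real m \<le> real n" using m by simp
    also have "real n \<le> 2 ^ n" using of_nat_less_two_power[of n, where ?'a = real] by simp
    finally show "real m \<le> 2 ^ n" .
  qed simp
  also have "2 ^ n * (1/4) ^ n = (1/2 :: real) ^ n" by (simp flip: power_mult_distrib)
  finally show ?thesis .
qed

lemma product_row_bound:
  fixes k u w :: "nat \<Rightarrow> real"
  assumes m: "m \<le> n" and k: "\<And>j. j < m \<Longrightarrow> 0 \<le> k j" "\<And>j. j < m \<Longrightarrow> k j \<le> 1"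
    and u: "\<And>i. \<bar>u i\<bar> \<le> A * (1/4) ^ i" and w: "\<And>i. \<bar>w i\<bar> \<le> B * (1/4) ^ i"
  shows "\<bar>\<Sum>j<m. k j * (u (n - Suc j) * w (Suc j))\<bar> \<le> A * B * (1/2) ^ n"
proof (rule sum_quarter_le[OF _ m])
  have AB: "0 \<le> A" "0 \<le> B" using u[of 0] w[of 0] by auto
  thus "0 \<le> A * B" by simp
  fix j assume j: "j < m"
  have "\<bar>k j * (u (n - Suc j) * w (Suc j))\<bar> = k j * (\<bar>u (n - Suc j)\<bar> * \<bar>w (Suc j)\<bar>)"
    using k(1)[OF j] by (simp add: abs_mult)
  also have "\<dots> \<le> 1 * ((A * (1/4) ^ (n - Suc j)) * (B * (1/4) ^ Suc j))"
    using AB by (intro mult_mono k(2) j u w) auto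
  also have "\<dots> = A * B * ((1/4) ^ (n - Suc j) * (1/4) ^ Suc j)" by simp
  also have "(1/4 :: real) ^ (n - Suc j) * (1/4) ^ Suc j = (1/4) ^ n"
    using j m by (simp flip: power_add power_Suc)
  finally show "\<bar>k j * (u (n - Suc j) * w (Suc j))\<bar> \<le> A * B * (1/4) ^ n" .
qed

lemma (in gml_renewal) gap_bound:
  obtains C where "1 \<le> C" "\<And>m s. 0 < s \<Longrightarrow> s \<le> T \<Longrightarrow> \<bar>gap m s\<bar> \<le> C * (1/4) ^ m"
proof -
  obtain C where C: "0 \<le> C" "\<And>\<gamma> s. 0 < \<gamma> \<Longrightarrow> 0 < s \<Longrightarrow> s \<le> T \<Longrightarrow> \<bar>gml_gap \<alpha> \<kappa> \<gamma> s\<bar> \<le> C * (1/4) powr \<gamma>"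
    using gml_bounds[OF params(1,2), of T] by metis
  show thesis
  proof (rule that[of "max 1 C"])
    fix m s assume s: "0 < s" "s \<le> T"
    show "\<bar>gap m s\<bar> \<le> max 1 C * (1/4) ^ m"
    proof (cases "m = 0")
      case True
      thus ?thesis by (simp add: gap_def le_max_iff_disj)
    next
      case False
      have "\<bar>gap m s\<bar> \<le> C * (1/4) powr (g0 + real m)"
        using False C(2)[of "g0 + real m" s] s params by (simp add: gap_def)
      also have "\<dots> \<le> max 1 C * (1/4) ^ m"
        using C(1) params powr_quarter_le[of g0 m] by (intro mult_mono) auto
      finally show ?thesis .
    qed
  qed simp
qed

lemma (in gml_renewal) density_bound:
  obtains C where "0 \<le> C" "\<And>m s. 0 < s \<Longrightarrow> s \<le> T \<Longrightarrow> \<bar>gml \<alpha> \<kappa> (g0 + real m) s\<bar> \<le> C * (1/4) ^ m / s"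
proof -
  obtain C where C: "0 \<le> C" "\<And>\<gamma> s. 0 < \<gamma> \<Longrightarrow> 0 < s \<Longrightarrow> s \<le> T \<Longrightarrow> \<bar>gml \<alpha> \<kappa> \<gamma> s\<bar> \<le> C * (1/4) powr \<gamma> / s"
    using gml_bounds[OF params(1,2), of T] by metis
  show thesis
  proof (rule that[OF C(1)])
    fix m s assume s: "0 < s" "s \<le> T"
    have "\<bar>gml \<alpha> \<kappa> (g0 + real m) s\<bar> \<le> C * (1/4) powr (g0 + real m) / s"
      using C(2)[of "g0 + real m" s] s params by simp
    also have "\<dots> \<le> C * (1/4) ^ m / s"
      using C(1) params s powr_quarter_le[of g0 m] by (intro divide_right_mono mult_left_mono) auto
    finally show "\<bar>gml \<alpha> \<kappa> (g0 + real m) s\<bar> \<le> C * (1/4) ^ m / s" .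
  qed
qed

lemma (in gml_renewal) gap_continuous: "continuous_on {0<..} (gap m)"
proof (cases "m = 0")
  case True
  have "gap m s = 1 - gml_cdf \<alpha> \<kappa> (g0 + 1) s" if "s \<in> {0<..}" for s
  proof -
    have [measurable]: "X 1 \<in> borel_measurable M" by (rule X_measurable) simp
    have "gap m s = prob {\<omega>\<in>space M. \<not> X 1 \<omega> \<le> s}" by (simp add: gap_def True not_le)
    also have "\<dots> = 1 - prob {\<omega>\<in>space M. X 1 \<omega> \<le> s}" by (rule prob_neg) measurable
    also have "prob {\<omega>\<in>space M. X 1 \<omega> \<le> s} = gml_cdf \<alpha> \<kappa> (g0 + 1) s"
      using renewal_prob_le[of 1 s] that by (simp add: renewal_def)
    finally show ?thesis .
  qed
  moreover have "continuous_on {0<..} (\<lambda>s. 1 - gml_cdf \<alpha> \<kappa> (g0 + 1) s)"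
    by (intro continuous_on_diff continuous_on_const continuous_on_gml_cdf) (use params in auto)
  ultimately show ?thesis by (metis (no_types, lifting) continuous_on_eq)
next
  case False
  have "gap m = gml_gap \<alpha> \<kappa> (g0 + real m)" using False by (simp add: gap_def fun_eq_iff)
  thus ?thesis using continuous_on_gml_gap[of \<alpha> "g0 + real m" \<kappa>] params by simp
qed

lemma (in gml_renewal) density_continuous: "continuous_on {0<..} (gml \<alpha> \<kappa> (g0 + real m))"
  by (rule continuous_on_gml) (use params in auto)

lemma (in gml_renewal) gml_gap_continuous: "continuous_on {0<..} (gml_gap \<alpha> \<kappa> (g0 + real m))"
  by (rule continuous_on_gml_gap) (use params in auto)

context ml_telegraph begin

lemma renewal_coordinate_measurable:
  "renewal R k \<in> borel_measurable M" "renewal L k \<in> borel_measurable M"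
  by (rule R.renewal_measurable, rule L.renewal_measurable)

lemma forward_term_measurable: "forward_term t n j \<in> borel_measurable borel"
proof -
  note [measurable] = L.measurable_density R.measurable_gap
  show ?thesis unfolding forward_term_def[abs_def] by measurable
qed

lemma backward_term_measurable: "backward_term t n j \<in> borel_measurable borel"
proof -
  note [measurable] = R.measurable_density L.gap_measurable
  show ?thesis unfolding backward_term_def[abs_def] by measurable
qed

lemma forward_law:
  assumes t: "0 < t" and B: "B \<in> sets borel" "B \<subseteq> {0<..<t}"
  shows "emeasure M {\<omega>\<in>space M. Y 1 \<omega> = 1 \<and> V t \<omega> = v1 \<and> forward_share t (X t \<omega>) \<in> B}
    = (\<integral>\<^sup>+\<theta>. (\<Sum>n. \<Sum>j<n - 1. ennreal (p_first * forward_term t n j \<theta>)) * indicator B \<theta> \<partial>lborel)"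
proof -
  note [measurable] = velocity_measurable position_measurable renewal_coordinate_measurable B(1) forward_term_measurable
  have [measurable]: "Y 1 \<in> measurable M (count_space UNIV)" "Y (Suc n) \<in> measurable M (count_space UNIV)" for n
    by (auto intro: Y_measurable)
  define G where "G n j = {\<omega>\<in>space M. forward_renewal Y R L t B n j \<omega>}" for n j
  show ?thesis
  proof (rule emeasure_AE_double_suminf[where G = G])
    show "{\<omega>\<in>space M. Y 1 \<omega> = 1 \<and> V t \<omega> = v1 \<and> forward_share t (X t \<omega>) \<in> B} \<in> sets M"
      by measurable
    show "G n j \<in> sets M" for n j unfolding G_def forward_renewal_def by measurable
    show "AE \<omega> in M. (indicator {\<omega>\<in>space M. Y 1 \<omega> = 1 \<and> V t \<omega> = v1 \<and> forward_share t (X t \<omega>) \<in> B} \<omega> :: ennreal)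
       = (\<Sum>n. \<Sum>j<n - 1. indicator (G n j) \<omega>)"
      using AE_telegraph_path AE_space
    proof eventually_elim
      case (elim \<omega>)
      show ?case unfolding G_def indicator_def
        using telegraph_path.forward_decomposition[OF elim(1) t B(2)] elim(2) by simp
    qed
    show "emeasure M (G n j) = (\<integral>\<^sup>+\<theta>. ennreal (p_first * forward_term t n j \<theta>) * indicator B \<theta> \<partial>lborel)"
      if "j < n - 1" for n j
      unfolding G_def by (rule forward_event[OF that B])
    show "(\<lambda>\<theta>. ennreal (p_first * forward_term t n j \<theta>)) \<in> borel_measurable borel" for n j by measurable
  qed (rule B(1))
qed

lemma backward_law:
  assumes t: "0 < t" and B: "B \<in> sets borel" "B \<subseteq> {0<..<t}"
  shows "emeasure M {\<omega>\<in>space M. Y 1 \<omega> = 1 \<and> V t \<omega> = - v2 \<and> forward_share t (X t \<omega>) \<in> B}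
    = (\<integral>\<^sup>+\<theta>. (\<Sum>n. \<Sum>j<n. ennreal (p_first * backward_term t n j \<theta>)) * indicator B \<theta> \<partial>lborel)"
proof -
  note [measurable] = velocity_measurable position_measurable renewal_coordinate_measurable B(1) backward_term_measurable
  have [measurable]: "Y 1 \<in> measurable M (count_space UNIV)" "Y (Suc n) \<in> measurable M (count_space UNIV)" for n
    by (auto intro: Y_measurable)
  define G where "G n j = {\<omega>\<in>space M. backward_renewal Y R L t B n j \<omega>}" for n j
  show ?thesis
  proof (rule emeasure_AE_double_suminf[where G = G])
    show "{\<omega>\<in>space M. Y 1 \<omega> = 1 \<and> V t \<omega> = - v2 \<and> forward_share t (X t \<omega>) \<in> B} \<in> sets M"
      by measurable
    show "G n j \<in> sets M" for n j unfolding G_def backward_renewal_def by measurable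
    show "AE \<omega> in M. (indicator {\<omega>\<in>space M. Y 1 \<omega> = 1 \<and> V t \<omega> = - v2 \<and> forward_share t (X t \<omega>) \<in> B} \<omega> :: ennreal)
       = (\<Sum>n. \<Sum>j<n. indicator (G n j) \<omega>)"
      using AE_telegraph_path AE_space
    proof eventually_elim
      case (elim \<omega>)
      show ?case unfolding G_def indicator_def
        using telegraph_path.backward_decomposition[OF elim(1) t B(2)] elim(2) by simp
    qed
    show "emeasure M (G n j) = (\<integral>\<^sup>+\<theta>. ennreal (p_first * backward_term t n j \<theta>) * indicator B \<theta> \<partial>lborel)"
      if "j < n" for n j
      unfolding G_def by (rule backward_event[OF that B])
    show "(\<lambda>\<theta>. ennreal (p_first * backward_term t n j \<theta>)) \<in> borel_measurable borel" for n j by measurable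
  qed (rule B(1))
qed

lemma term_nonneg:
  assumes "0 < \<theta>" "\<theta> < t"
  shows "j < n - 1 \<Longrightarrow> 0 \<le> forward_term t n j \<theta>" "0 \<le> backward_term t n j \<theta>"
  unfolding forward_term_def backward_term_def
  using assms coeff_nonneg L.density_nonneg[of "n - Suc j" "t - \<theta>"] R.renewal_gap(2)[of "Suc j" \<theta>]
    R.density_nonneg[of "Suc j" \<theta>] L.gap_nonneg[of "t - \<theta>" "n - Suc j"]
  by (auto intro!: mult_nonneg_nonneg simp del: of_nat_Suc)

definition forward_row :: "real \<Rightarrow> nat \<Rightarrow> real \<Rightarrow> real" where
  "forward_row t n \<theta> = (\<Sum>j<n - 1. forward_term t n j \<theta>)"

definition backward_row :: "real \<Rightarrow> nat \<Rightarrow> real \<Rightarrow> real" where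
  "backward_row t n \<theta> = (\<Sum>j<n. backward_term t n j \<theta>)"

text \<open>In row \<open>n\<close> the two factors of each term together decay like
  \<open>(1/4) ^ n\<close>, uniformly as long as \<open>\<theta>\<close> stays away from
  \<open>0\<close> and \<open>t\<close>, where the densities may be singular.\<close>

lemma row_bounds:
  assumes ad: "0 < a" "a \<le> d" "d < t"
  shows "\<exists>C. \<forall>n. \<forall>\<theta>\<in>{a..d}. \<bar>forward_row t n \<theta>\<bar> \<le> C * (1/2) ^ n"
    and "\<exists>C. \<forall>n. \<forall>\<theta>\<in>{a..d}. \<bar>backward_row t n \<theta>\<bar> \<le> C * (1/2) ^ n"
proof -
  obtain CL where CL: "0 \<le> CL" "\<And>m s. 0 < s \<Longrightarrow> s \<le> t \<Longrightarrow> \<bar>gml \<alpha> \<mu> (r / c + real m) s\<bar> \<le> CL * (1/4) ^ m / s"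
    using L.density_bound[of t] by metis
  obtain CR where CR: "0 \<le> CR" "\<And>m s. 0 < s \<Longrightarrow> s \<le> t \<Longrightarrow> \<bar>gml \<alpha> lam (b / c + real m) s\<bar> \<le> CR * (1/4) ^ m / s"
    using R.density_bound[of t] by metis
  obtain DL where DL: "1 \<le> DL" "\<And>m s. 0 < s \<Longrightarrow> s \<le> t \<Longrightarrow> \<bar>L.gap m s\<bar> \<le> DL * (1/4) ^ m"
    using L.gap_bound[of t] by metis
  obtain DR where DR: "1 \<le> DR" "\<And>m s. 0 < s \<Longrightarrow> s \<le> t \<Longrightarrow> \<bar>R.gap m s\<bar> \<le> DR * (1/4) ^ m"
    using R.gap_bound[of t] by metis
  have away: "C * (1/4) ^ m / s \<le> C / e * (1/4) ^ m" if "0 \<le> C" "0 < e" "e \<le> s" for C e s :: real and m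
    using that by (simp add: divide_left_mono)
  show "\<exists>C. \<forall>n. \<forall>\<theta>\<in>{a..d}. \<bar>forward_row t n \<theta>\<bar> \<le> C * (1/2) ^ n"
  proof (intro exI allI ballI)
    fix n \<theta> assume \<theta>: "\<theta> \<in> {a..d}"
    have u: "\<bar>gml \<alpha> \<mu> (r / c + real i) (t - \<theta>)\<bar> \<le> CL / (t - d) * (1/4) ^ i" for i
      using CL(2)[of "t - \<theta>" i] away[OF CL(1), of "t - d" "t - \<theta>" i] \<theta> ad by simp
    have w: "\<bar>R.gap i \<theta>\<bar> \<le> DR * (1/4) ^ i" for i
      using \<theta> ad by (intro DR(2)) auto
    have "forward_row t n \<theta> = (\<Sum>j<n - 1. forward_coeff n j
        * (gml \<alpha> \<mu> (r / c + real (n - Suc j)) (t - \<theta>) * R.gap (Suc j) \<theta>))"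
      by (simp add: forward_row_def forward_term_def R.gap_def)
    thus "\<bar>forward_row t n \<theta>\<bar> \<le> CL / (t - d) * DR * (1/2) ^ n"
      using product_row_bound[OF _ _ _ u w, of "n - 1" n "forward_coeff n"] coeff_nonneg(1) coeff_le_1(1)[of _ n]
      by simp
  qed
  show "\<exists>C. \<forall>n. \<forall>\<theta>\<in>{a..d}. \<bar>backward_row t n \<theta>\<bar> \<le> C * (1/2) ^ n"
  proof (intro exI allI ballI)
    fix n \<theta> assume \<theta>: "\<theta> \<in> {a..d}"
    have w: "\<bar>gml \<alpha> lam (b / c + real i) \<theta>\<bar> \<le> CR / a * (1/4) ^ i" for i
      using CR(2)[of \<theta> i] away[OF CR(1), of a \<theta> i] \<theta> ad by simp
    have u: "\<bar>L.gap i (t - \<theta>)\<bar> \<le> DL * (1/4) ^ i" for i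
      using \<theta> ad by (intro DL(2)) auto
    have "backward_row t n \<theta> = (\<Sum>j<n. backward_coeff n j
        * (L.gap (n - Suc j) (t - \<theta>) * gml \<alpha> lam (b / c + real (Suc j)) \<theta>))"
      by (simp add: backward_row_def backward_term_def mult_ac)
    thus "\<bar>backward_row t n \<theta>\<bar> \<le> DL * (CR / a) * (1/2) ^ n"
      using product_row_bound[OF _ _ _ u w, of n n "backward_coeff n"] coeff_nonneg(2) coeff_le_1(2)[of _ n]
      by simp
  qed
qed

lemma row_summable:
  assumes "0 < \<theta>" "\<theta> < t"
  shows "summable (\<lambda>n. \<bar>forward_row t n \<theta>\<bar>)" "summable (\<lambda>n. \<bar>backward_row t n \<theta>\<bar>)"
proof -
  have g: "summable (\<lambda>n. C * (1/2 :: real) ^ n)" for C by (intro summable_mult summable_geometric) simp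
  obtain C where "\<And>n. \<bar>forward_row t n \<theta>\<bar> \<le> C * (1/2) ^ n"
    using row_bounds(1)[of \<theta> \<theta> t] assms by auto
  thus "summable (\<lambda>n. \<bar>forward_row t n \<theta>\<bar>)" by (intro summable_comparison_test'[OF g]) simp
  obtain C where "\<And>n. \<bar>backward_row t n \<theta>\<bar> \<le> C * (1/2) ^ n"
    using row_bounds(2)[of \<theta> \<theta> t] assms by auto
  thus "summable (\<lambda>n. \<bar>backward_row t n \<theta>\<bar>)" by (intro summable_comparison_test'[OF g]) simp
qed

lemma row_continuous:
  "continuous_on {0<..<t} (forward_row t n)" "continuous_on {0<..<t} (backward_row t n)"
proof -
  show "continuous_on {0<..<t} (forward_row t n)"
    unfolding forward_row_def[abs_def] forward_term_def
    by (intro continuous_on_sum continuous_on_mult continuous_on_const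
        continuous_on_compose2[OF L.density_continuous] continuous_on_subset[OF R.gml_gap_continuous]
        continuous_intros) auto
  show "continuous_on {0<..<t} (backward_row t n)"
    unfolding backward_row_def[abs_def] backward_term_def
    by (intro continuous_on_sum continuous_on_mult continuous_on_const
        continuous_on_compose2[OF L.gap_continuous] continuous_on_subset[OF R.density_continuous]
        continuous_intros) auto
qed

definition forward_sum :: "real \<Rightarrow> real \<Rightarrow> real" where
  "forward_sum t \<theta> = (\<Sum>n. forward_row t n \<theta>)"

definition backward_sum :: "real \<Rightarrow> real \<Rightarrow> real" where
  "backward_sum t \<theta> = (\<Sum>n. backward_row t n \<theta>)"

lemma row_sum_continuous:
  "continuous_on {0<..<t} (forward_sum t)" "continuous_on {0<..<t} (backward_sum t)"
  unfolding forward_sum_def[abs_def] backward_sum_def[abs_def]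
  by (rule continuous_on_suminf_geometric[OF row_continuous(1) row_bounds(1)]; simp)
    (rule continuous_on_suminf_geometric[OF row_continuous(2) row_bounds(2)]; simp)

lemma row_nonneg:
  assumes "0 < \<theta>" "\<theta> < t"
  shows "0 \<le> forward_row t n \<theta>" "0 \<le> backward_row t n \<theta>"
  unfolding forward_row_def backward_row_def using term_nonneg[OF assms] by (auto intro!: sum_nonneg)

lemma row_sum_nonneg:
  assumes "0 < \<theta>" "\<theta> < t"
  shows "0 \<le> forward_sum t \<theta>" "0 \<le> backward_sum t \<theta>"
  unfolding forward_sum_def backward_sum_def using row_nonneg[OF assms] row_summable[OF assms]
  by (auto intro!: suminf_nonneg)

lemma ennreal_row_sum:
  assumes \<theta>: "0 < \<theta>" "\<theta> < t"
  shows "(\<Sum>n. \<Sum>j<n - 1. ennreal (p_first * forward_term t n j \<theta>)) = ennreal (p_first * forward_sum t \<theta>)"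
    and "(\<Sum>n. \<Sum>j<n. ennreal (p_first * backward_term t n j \<theta>)) = ennreal (p_first * backward_sum t \<theta>)"
proof -
  have p: "0 \<le> p_first * y" if "0 \<le> y" for y using p_first_pos that by (intro mult_nonneg_nonneg) simp_all
  have f: "(\<Sum>j<n - 1. ennreal (p_first * forward_term t n j \<theta>)) = ennreal (p_first * forward_row t n \<theta>)" for n
    unfolding forward_row_def sum_distrib_left by (rule sum_ennreal) (use term_nonneg[OF \<theta>] p in auto)
  have bw: "(\<Sum>j<n. ennreal (p_first * backward_term t n j \<theta>)) = ennreal (p_first * backward_row t n \<theta>)" for n
    unfolding backward_row_def sum_distrib_left by (rule sum_ennreal) (use term_nonneg[OF \<theta>] p in auto)
  have s: "summable (\<lambda>n. forward_row t n \<theta>)" "summable (\<lambda>n. backward_row t n \<theta>)"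
    using row_summable[OF \<theta>] by (auto intro: summable_rabs_cancel)
  show "(\<Sum>n. \<Sum>j<n - 1. ennreal (p_first * forward_term t n j \<theta>)) = ennreal (p_first * forward_sum t \<theta>)"
    unfolding f forward_sum_def suminf_mult[OF s(1), symmetric]
    using row_nonneg[OF \<theta>] p s by (intro suminf_ennreal2 summable_mult) auto
  show "(\<Sum>n. \<Sum>j<n. ennreal (p_first * backward_term t n j \<theta>)) = ennreal (p_first * backward_sum t \<theta>)"
    unfolding bw backward_sum_def suminf_mult[OF s(2), symmetric]
    using row_nonneg[OF \<theta>] p s by (intro suminf_ennreal2 summable_mult) auto
qed

end

section \<open>The law of the position\<close>

context ml_telegraph begin

abbreviation "f_dens t x \<equiv> forward_sum t (forward_share t x) / (v1 + v2)"
abbreviation "b_dens t x \<equiv> backward_sum t (forward_share t x) / (v1 + v2)"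

text \<open>The affine change of variable from the forward time to the position.\<close>

lemma position_density_from_forward_time:
  assumes h [measurable]: "h \<in> borel_measurable borel" and A [measurable]: "A \<in> sets borel"
    and A_sub: "A \<subseteq> {- v2 * t<..<v1 * t}"
    and law: "\<And>B. B \<in> sets borel \<Longrightarrow> B \<subseteq> {0<..<t} \<Longrightarrow>
      emeasure M {\<omega>\<in>space M. Y 1 \<omega> = 1 \<and> V t \<omega> = v \<and> forward_share t (X t \<omega>) \<in> B}
        = (\<integral>\<^sup>+\<theta>. h \<theta> * indicator B \<theta> \<partial>lborel)"
    and h_eq: "\<And>\<theta>. 0 < \<theta> \<Longrightarrow> \<theta> < t \<Longrightarrow> h \<theta> = ennreal (p_first * \<phi> \<theta>)"
  shows "emeasure M {\<omega>\<in>space M. \<omega> \<in> moving v t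
      \<and> X t \<omega> \<in> A}
    = (\<integral>\<^sup>+x. ennreal (p_first * (\<phi> (forward_share t x) / (v1 + v2))) * indicator A x \<partial>lborel)"
proof -
  let ?x = "\<lambda>x. v2 * t / (v1 + v2) + 1 / (v1 + v2) * x"
  let ?s = "v1 + v2"
  have s: "0 < ?s" using positive by simp
  define B where "B = {\<theta>. ?s * \<theta> - v2 * t \<in> A}"
  have B [measurable]: "B \<in> sets borel"
  proof -
    have "{\<theta> \<in> space borel. ?s * \<theta> - v2 * t \<in> A} \<in> sets borel" by measurable
    thus ?thesis by (simp add: B_def)
  qed
  have B_sub: "B \<subseteq> {0<..<t}"
  proof
    fix \<theta> assume "\<theta> \<in> B"
    hence "- v2 * t < ?s * \<theta> - v2 * t" "?s * \<theta> - v2 * t < v1 * t" using A_sub by (auto simp: B_def)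
    hence "0 < ?s * \<theta>" "?s * \<theta> < ?s * t" by (auto simp: algebra_simps)
    thus "\<theta> \<in> {0<..<t}" using s by (simp add: zero_less_mult_iff)
  qed
  have mem: "forward_share t x \<in> B \<longleftrightarrow> x \<in> A" for x using s by (simp add: B_def)
  have "emeasure M {\<omega>\<in>space M. \<omega> \<in> moving v t
      \<and> X t \<omega> \<in> A}
    = emeasure M {\<omega>\<in>space M. Y 1 \<omega> = 1 \<and> V t \<omega> = v \<and> forward_share t (X t \<omega>) \<in> B}"
    unfolding mem by (rule arg_cong[of _ _ "emeasure M"]) auto
  also have "\<dots> = (\<integral>\<^sup>+\<theta>. h \<theta> * indicator B \<theta> \<partial>lborel)"
    by (rule law[OF B B_sub])
  also have "\<dots> = ennreal \<bar>1 / ?s\<bar> * (\<integral>\<^sup>+x. h (?x x) * indicator B (?x x) \<partial>lborel)"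
    by (rule nn_integral_real_affine) (use s in auto)
  also have "\<dots> = (\<integral>\<^sup>+x. ennreal (1 / ?s) * (h (?x x) * indicator B (?x x)) \<partial>lborel)"
    using s by (subst nn_integral_cmult) auto
  also have "\<dots> = (\<integral>\<^sup>+x. ennreal (p_first * (\<phi> (forward_share t x) / ?s)) * indicator A x \<partial>lborel)"
  proof (rule nn_integral_cong)
    fix x
    have eq: "?x x = forward_share t x" by (simp add: add_divide_distrib)
    show "ennreal (1 / ?s) * (h (?x x) * indicator B (?x x))
      = ennreal (p_first * (\<phi> (forward_share t x) / ?s)) * indicator A x"
    proof (cases "x \<in> A")
      case True
      hence m: "forward_share t x \<in> B" by (simp add: mem)
      hence "h (forward_share t x) = ennreal (p_first * \<phi> (forward_share t x))"
        using B_sub by (intro h_eq) auto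
      hence "ennreal (1 / ?s) * h (forward_share t x) = ennreal (1 / ?s * (p_first * \<phi> (forward_share t x)))"
        using s by (subst ennreal_mult') simp_all
      also have "1 / ?s * (p_first * \<phi> (forward_share t x)) = p_first * (\<phi> (forward_share t x) / ?s)"
        by simp
      finally show ?thesis unfolding eq using True m by simp
    next
      case False
      thus ?thesis unfolding eq using mem by simp
    qed
  qed
  finally show ?thesis .
qed

lemma position_law_forward:
  assumes t: "0 < t" and A: "A \<in> sets borel" "A \<subseteq> {- v2 * t<..<v1 * t}"
  shows "emeasure M {\<omega>\<in>space M. \<omega> \<in> moving v1 t
      \<and> X t \<omega> \<in> A}
    = (\<integral>\<^sup>+x. ennreal (p_first * f_dens t x) * indicator A x \<partial>lborel)"
proof (rule position_density_from_forward_time[OF _ A forward_law[OF t] ennreal_row_sum(1)])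
  note [measurable] = forward_term_measurable
  show "(\<lambda>\<theta>. \<Sum>n. \<Sum>j<n - 1. ennreal (p_first * forward_term t n j \<theta>)) \<in> borel_measurable borel" by measurable
qed

lemma position_law_backward:
  assumes t: "0 < t" and A: "A \<in> sets borel" "A \<subseteq> {- v2 * t<..<v1 * t}"
  shows "emeasure M {\<omega>\<in>space M. \<omega> \<in> moving (- v2) t
      \<and> X t \<omega> \<in> A}
    = (\<integral>\<^sup>+x. ennreal (p_first * b_dens t x) * indicator A x \<partial>lborel)"
proof (rule position_density_from_forward_time[OF _ A backward_law[OF t] ennreal_row_sum(2)])
  note [measurable] = backward_term_measurable
  show "(\<lambda>\<theta>. \<Sum>n. \<Sum>j<n. ennreal (p_first * backward_term t n j \<theta>)) \<in> borel_measurable borel" by measurable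
qed

lemma forward_share_range:
  assumes "- v2 * t < x" "x < v1 * t"
  shows "0 < forward_share t x" "forward_share t x < t"
  using assms positive by (auto simp: field_simps)

lemma initial_velocity_AE: "AE \<omega> in M. V 0 \<omega> = v1 \<longleftrightarrow> Y 1 \<omega> = 1"
  using AE_telegraph_path by (rule eventually_mono) (rule telegraph_path.velocity_initial)

lemma trial_one_measurable: "Y 1 \<in> measurable M (count_space UNIV)"
  by (rule Y_measurable) simp

text \<open>The waiting times are almost surely positive, so that the velocity at time \<open>0\<close> is
  decided by the first trial.\<close>

lemma prob_initial: "emeasure M {\<omega>\<in>space M. V 0 \<omega> = v1} = ennreal p_first"
proof -
  note [measurable] = trial_one_measurable velocity_measurable
  have "emeasure M {\<omega>\<in>space M. V 0 \<omega> = v1} = emeasure M {\<omega>\<in>space M. Y 1 \<omega> = 1}"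
    using initial_velocity_AE by (intro emeasure_eq_AE) (auto elim!: eventually_mono)
  thus ?thesis unfolding emeasure_eq_measure p_first_eq .
qed

lemma joint_cdf_eq:
  "joint_cdf M v1 v2 Y R L t v y =
    prob {\<omega>\<in>space M. \<omega> \<in> moving v t \<and> X t \<omega> \<le> y} / p_first"
proof -
  note [measurable] = trial_one_measurable velocity_measurable position_measurable
  have "prob {\<omega>\<in>space M. (X t \<omega> \<le> y \<and> V t \<omega> = v) \<and> V 0 \<omega> = v1}
    = prob {\<omega>\<in>space M. \<omega> \<in> moving v t \<and> X t \<omega> \<le> y}"
  proof (rule measure_eq_AE)
    show "AE \<omega> in M. \<omega> \<in> {\<omega>\<in>space M. (X t \<omega> \<le> y \<and> V t \<omega> = v) \<and> V 0 \<omega> = v1}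
      \<longleftrightarrow> \<omega> \<in> {\<omega>\<in>space M. \<omega> \<in> moving v t \<and> X t \<omega> \<le> y}"
      using initial_velocity_AE by (rule eventually_mono) auto
  qed measurable
  moreover have "prob {\<omega>\<in>space M. V 0 \<omega> = v1} = p_first"
    using prob_initial p_first_pos by (simp add: measure_def del: divide_pos_pos)
  ultimately show ?thesis by (simp only: joint_cdf_def cond_prob_def)
qed

lemma joint_cdf_derivative:
  assumes cont: "continuous_on {0<..<t} \<phi>" and nonneg: "\<And>\<theta>. 0 < \<theta> \<Longrightarrow> \<theta> < t \<Longrightarrow> 0 \<le> \<phi> \<theta>"
    and law: "\<And>A. A \<in> sets borel \<Longrightarrow> A \<subseteq> {- v2 * t<..<v1 * t} \<Longrightarrow>
      emeasure M {\<omega>\<in>space M. \<omega> \<in> moving v t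
        \<and> X t \<omega> \<in> A}
      = (\<integral>\<^sup>+x. ennreal (p_first * (\<phi> (forward_share t x) / (v1 + v2))) * indicator A x \<partial>lborel)"
    and x: "- v2 * t < x" "x < v1 * t"
  shows "(joint_cdf M v1 v2 Y R L t v has_real_derivative \<phi> (forward_share t x) / (v1 + v2)) (at x)"
proof -
  note [measurable] = trial_one_measurable velocity_measurable
  let ?Q = "moving v t"
  let ?g = "\<lambda>x. p_first * (\<phi> (forward_share t x) / (v1 + v2))"
  have s: "0 < v1 + v2" using positive by simp
  have "((\<lambda>y. prob {\<omega>\<in>space M. \<omega> \<in> ?Q \<and> X t \<omega> \<le> y}) has_real_derivative ?g x) (at x)"
  proof (rule cdf_has_derivative[OF position_measurable _ _ _ law x])
    show "?Q \<in> sets M" by measurable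
    show "continuous_on {- v2 * t<..<v1 * t} ?g"
      using forward_share_range s
      by (intro continuous_on_mult continuous_on_divide continuous_on_const
          continuous_on_compose2[OF cont] continuous_intros) auto
    show "0 \<le> ?g y" if "- v2 * t < y" "y < v1 * t" for y
      by (rule mult_nonneg_nonneg[OF less_imp_le[OF p_first_pos]])
        (use nonneg[OF forward_share_range[OF that]] s in simp)
  qed
  from DERIV_cdivide[OF this, of p_first]
  have "((\<lambda>y. prob {\<omega>\<in>space M. \<omega> \<in> ?Q \<and> X t \<omega> \<le> y} / p_first) has_real_derivative
      \<phi> (forward_share t x) / (v1 + v2)) (at x)"
    using p_first_pos by (simp only: nonzero_mult_div_cancel_left less_imp_neq[symmetric] not_False_eq_True)
  moreover have "joint_cdf M v1 v2 Y R L t v = (\<lambda>y. prob {\<omega>\<in>space M. \<omega> \<in> ?Q \<and> X t \<omega> \<le> y} / p_first)"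
    by (rule ext) (rule joint_cdf_eq)
  ultimately show ?thesis by (simp only:)
qed

lemma joint_cdf_derivatives:
  assumes t: "0 < t" and x: "- v2 * t < x" "x < v1 * t"
  shows "(joint_cdf M v1 v2 Y R L t v1 has_real_derivative f_dens t x) (at x)"
    and "(joint_cdf M v1 v2 Y R L t (- v2) has_real_derivative b_dens t x) (at x)"
  using joint_cdf_derivative[OF row_sum_continuous(1) row_sum_nonneg(1) position_law_forward[OF t] x]
    joint_cdf_derivative[OF row_sum_continuous(2) row_sum_nonneg(2) position_law_backward[OF t] x]
  by blast+

lemma density_eqs:
  assumes t: "0 < t" and x: "- v2 * t < x" "x < v1 * t"
  shows "forward_density M v1 v2 Y R L x t = f_dens t x"
    and "backward_density M v1 v2 Y R L x t = b_dens t x"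
  unfolding forward_density_def backward_density_def
  using joint_cdf_derivatives[OF assms] by (auto intro: DERIV_imp_deriv)

lemma position_law_emeasure:
  assumes A: "A \<in> sets borel"
  shows "emeasure (position_law M v1 v2 Y R L t) A
    = emeasure M {\<omega>\<in>space M. Y 1 \<omega> = 1 \<and> X t \<omega> \<in> A} / ennreal p_first"
proof -
  note [measurable] = trial_one_measurable velocity_measurable position_measurable A
  let ?E = "{\<omega>\<in>space M. V 0 \<omega> = v1}"
  let ?X = "X t -` A \<inter> space M"
  have X: "?X \<in> sets M" using position_measurable A by (rule measurable_sets)
  have E: "?E \<in> sets M" by measurable
  have "emeasure (position_law M v1 v2 Y R L t) A = emeasure (uniform_measure M ?E) ?X"
    unfolding position_law_def using position_measurable A
    by (subst emeasure_distr) (auto simp: measurable_cong_sets[OF sets_uniform_measure refl] space_uniform_measure)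
  also have "\<dots> = emeasure M (?E \<inter> ?X) / ennreal p_first"
    using E X by (simp add: prob_initial)
  also have "emeasure M (?E \<inter> ?X) = emeasure M {\<omega>\<in>space M. Y 1 \<omega> = 1 \<and> X t \<omega> \<in> A}"
  proof (rule emeasure_eq_AE)
    show "AE \<omega> in M. \<omega> \<in> ?E \<inter> ?X \<longleftrightarrow> \<omega> \<in> {\<omega>\<in>space M. Y 1 \<omega> = 1 \<and> X t \<omega> \<in> A}"
      using initial_velocity_AE by (rule eventually_mono) auto
    show "?E \<inter> ?X \<in> sets M" using E X by auto
    show "{\<omega>\<in>space M. Y 1 \<omega> = 1 \<and> X t \<omega> \<in> A} \<in> sets M" by measurable
  qed
  finally show ?thesis .
qed

lemma position_law_interior:
  assumes t: "0 < t" and A [measurable]: "A \<in> sets borel" and A_sub: "A \<subseteq> {- v2 * t<..<v1 * t}"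
  shows "emeasure (position_law M v1 v2 Y R L t) A
    = (\<integral>\<^sup>+x. ennreal (if - v2 * t < x \<and> x < v1 * t then
          f_dens t x + b_dens t x else 0)
        * indicator A x \<partial>lborel)"
proof -
  note [measurable] = trial_one_measurable velocity_measurable position_measurable
  let ?I = "{- v2 * t<..<v1 * t}"
  let ?p = "\<lambda>x. if - v2 * t < x \<and> x < v1 * t then
      f_dens t x + b_dens t x else 0"
  let ?f = "\<lambda>x. f_dens t x"
  let ?b = "\<lambda>x. b_dens t x"
  let ?Q = "\<lambda>v. {\<omega>\<in>space M. \<omega> \<in> moving v t \<and> X t \<omega> \<in> A}"
  have s: "0 < v1 + v2" using positive by simp
  have cont: "continuous_on ?I (\<lambda>x. \<phi> (forward_share t x) / (v1 + v2))"
    if "continuous_on {0<..<t} \<phi>" for \<phi> :: "real \<Rightarrow> real"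
    using forward_share_range s
    by (intro continuous_on_divide continuous_on_const continuous_on_compose2[OF that] continuous_intros) auto
  have meas: "(\<lambda>x. ennreal (p_first * \<psi> x) * indicator A x) \<in> borel_measurable borel"
    if "continuous_on ?I \<psi>" for \<psi>
  proof -
    have "(\<lambda>x. indicator ?I x *\<^sub>R \<psi> x) \<in> borel_measurable borel"
      by (rule borel_measurable_continuous_on_indicator[OF _ that]) simp
    hence "(\<lambda>x. ennreal (p_first * (indicator ?I x *\<^sub>R \<psi> x)) * indicator A x) \<in> borel_measurable borel"
      by measurable
    also have "(\<lambda>x. ennreal (p_first * (indicator ?I x *\<^sub>R \<psi> x)) * indicator A x) = (\<lambda>x. ennreal (p_first * \<psi> x) * indicator A x)"
      using A_sub by (auto simp: fun_eq_iff indicator_def)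
    finally show ?thesis .
  qed
  have nn: "0 \<le> ?f x" "0 \<le> ?b x" if "x \<in> ?I" for x
    using row_sum_nonneg[OF forward_share_range[of t x]] that s by auto
  have "{\<omega>\<in>space M. Y 1 \<omega> = 1 \<and> X t \<omega> \<in> A} = ?Q v1 \<union> ?Q (- v2)"
    by (auto simp: velocity_def trial_velocity_def)
  moreover have "emeasure M (?Q v1 \<union> ?Q (- v2)) = emeasure M (?Q v1) + emeasure M (?Q (- v2))"
  proof (rule plus_emeasure[symmetric])
    show "?Q v1 \<in> sets M" by measurable
    show "?Q (- v2) \<in> sets M" by measurable
    show "?Q v1 \<inter> ?Q (- v2) = {}" using positive by auto
  qed
  ultimately have "emeasure M {\<omega>\<in>space M. Y 1 \<omega> = 1 \<and> X t \<omega> \<in> A}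
    = (\<integral>\<^sup>+x. ennreal (p_first * ?f x) * indicator A x \<partial>lborel) + (\<integral>\<^sup>+x. ennreal (p_first * ?b x) * indicator A x \<partial>lborel)"
    unfolding position_law_forward[OF t A A_sub] position_law_backward[OF t A A_sub] by simp
  also have "\<dots> = (\<integral>\<^sup>+x. ennreal (p_first * ?f x) * indicator A x + ennreal (p_first * ?b x) * indicator A x \<partial>lborel)"
    using meas[OF cont[OF row_sum_continuous(1)]] meas[OF cont[OF row_sum_continuous(2)]]
    by (intro nn_integral_add[symmetric]) auto
  finally have total: "emeasure M {\<omega>\<in>space M. Y 1 \<omega> = 1 \<and> X t \<omega> \<in> A}
    = (\<integral>\<^sup>+x. ennreal (p_first * ?f x) * indicator A x + ennreal (p_first * ?b x) * indicator A x \<partial>lborel)" .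
  have "emeasure (position_law M v1 v2 Y R L t) A
    = (\<integral>\<^sup>+x. ennreal (p_first * ?f x) * indicator A x + ennreal (p_first * ?b x) * indicator A x \<partial>lborel) / ennreal p_first"
    unfolding position_law_emeasure[OF A] total ..
  also have "\<dots> = (\<integral>\<^sup>+x. (ennreal (p_first * ?f x) * indicator A x + ennreal (p_first * ?b x) * indicator A x) / ennreal p_first \<partial>lborel)"
    using meas[OF cont[OF row_sum_continuous(1)]] meas[OF cont[OF row_sum_continuous(2)]]
    by (intro nn_integral_divide[symmetric]) auto
  also have "\<dots> = (\<integral>\<^sup>+x. ennreal (?p x)
        * indicator A x \<partial>lborel)"
  proof (rule nn_integral_cong)
    fix x
    show "(ennreal (p_first * ?f x) * indicator A x + ennreal (p_first * ?b x) * indicator A x) / ennreal p_first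
      = ennreal (?p x)
        * indicator A x"
    proof (cases "x \<in> A")
      case True
      hence I: "x \<in> ?I" using A_sub by auto
      note n = nn[OF I]
      have "ennreal (p_first * ?f x) + ennreal (p_first * ?b x) = ennreal (p_first * (?f x + ?b x))"
        using n p_first_pos unfolding distrib_left
        by (intro ennreal_plus[symmetric] mult_nonneg_nonneg) simp_all
      also have "\<dots> / ennreal p_first = ennreal (p_first * (?f x + ?b x) / p_first)"
        using n p_first_pos by (intro divide_ennreal mult_nonneg_nonneg) simp_all
      also have "p_first * (?f x + ?b x) / p_first = ?f x + ?b x"
        by (rule nonzero_mult_div_cancel_left[OF less_imp_neq[OF p_first_pos, symmetric]])
      finally show ?thesis using True I by (simp add: add_divide_distrib)
    qed simp
  qed
  finally show ?thesis .
qed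

text \<open>The forward time of almost every path lies in \<open>{0..t}\<close>.\<close>

lemma position_law_outside:
  assumes t: "0 < t"
  shows "emeasure (position_law M v1 v2 Y R L t) (- {- v2 * t..v1 * t}) = 0"
proof -
  note [measurable] = trial_one_measurable position_measurable
  have *: "AE \<omega> in M. X t \<omega> \<in> {- v2 * t..v1 * t}"
    using AE_telegraph_path
    by (rule eventually_mono) (use t telegraph_path.position_range[where t = t] in auto)
  have "emeasure M {\<omega>\<in>space M. Y 1 \<omega> = 1 \<and> X t \<omega> \<in> - {- v2 * t..v1 * t}} = emeasure M {}"
  proof (intro emeasure_eq_AE)
    show "AE \<omega> in M. \<omega> \<in> {\<omega>\<in>space M. Y 1 \<omega> = 1 \<and> X t \<omega> \<in> - {- v2 * t..v1 * t}} \<longleftrightarrow> \<omega> \<in> {}"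
      using * by (rule eventually_mono) auto
  qed measurable
  thus ?thesis by (subst position_law_emeasure) auto
qed

text \<open>The singular part is the restriction of the law to the complement of the open interval; it is
  carried by the two endpoints.\<close>

lemma position_law_ac_component:
  assumes t: "0 < t"
  shows "has_ac_component (position_law M v1 v2 Y R L t)
     (\<lambda>y. if - v2 * t < y \<and> y < v1 * t
           then forward_density M v1 v2 Y R L y t + backward_density M v1 v2 Y R L y t else 0)"
proof -
  let ?I = "{- v2 * t<..<v1 * t}"
  let ?N = "position_law M v1 v2 Y R L t"
  define p where "p = (\<lambda>y. if - v2 * t < y \<and> y < v1 * t
           then forward_density M v1 v2 Y R L y t + backward_density M v1 v2 Y R L y t else 0)"
  have s: "0 < v1 + v2" using positive by simp
  have p: "p = (\<lambda>x. if - v2 * t < x \<and> x < v1 * t then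
          f_dens t x + b_dens t x else 0)"
    unfolding p_def using density_eqs[OF t] by (auto simp: fun_eq_iff add_divide_distrib)
  have cont: "continuous_on ?I (\<lambda>x. f_dens t x + b_dens t x)"
    using forward_share_range s
    by (intro continuous_on_divide continuous_on_add continuous_on_const
        continuous_on_compose2[OF row_sum_continuous(1)] continuous_on_compose2[OF row_sum_continuous(2)]
        continuous_intros) auto
  have p_meas: "p \<in> borel_measurable borel"
  proof -
    have "(\<lambda>x. indicator ?I x *\<^sub>R (f_dens t x + b_dens t x)) \<in> borel_measurable borel"
      by (rule borel_measurable_continuous_on_indicator[OF _ cont]) simp
    also have "(\<lambda>x. indicator ?I x *\<^sub>R (f_dens t x + b_dens t x)) = p"
      unfolding p by (auto simp: fun_eq_iff indicator_def)
    finally show ?thesis .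
  qed
  have p_nonneg: "0 \<le> p y" for y
    unfolding p using row_sum_nonneg[OF forward_share_range[of t y]] s by auto
  have sets_N: "sets ?N = sets borel" by (simp add: position_law_def)
  define \<nu> where "\<nu> = density ?N (indicator (- ?I))"
  have ind_meas: "indicator (- ?I) \<in> borel_measurable ?N"
    using sets_N by (intro borel_measurable_indicator) simp
  have \<nu>: "emeasure \<nu> A = emeasure ?N (- ?I \<inter> A)" if "A \<in> sets borel" for A
  proof -
    have "emeasure \<nu> A = (\<integral>\<^sup>+x. indicator (- ?I) x * indicator A x \<partial>?N)"
      unfolding \<nu>_def using ind_meas that sets_N by (intro emeasure_density) auto
    also have "\<dots> = (\<integral>\<^sup>+x. indicator (- ?I \<inter> A) x \<partial>?N)"
      by (intro nn_integral_cong) (auto simp: indicator_def)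
    also have "\<dots> = emeasure ?N (- ?I \<inter> A)"
      using that sets_N by (intro nn_integral_indicator) auto
    finally show ?thesis .
  qed
  let ?Z = "{- v2 * t, v1 * t}"
  have split: "emeasure ?N A = emeasure (density lborel (\<lambda>x. ennreal (p x))) A + emeasure \<nu> A"
    if A: "A \<in> sets borel" for A
  proof -
    have AI: "A \<inter> ?I \<in> sets borel" using A by simp
    have "emeasure ?N A = emeasure ?N ((A \<inter> ?I) \<union> (- ?I \<inter> A))" by (rule arg_cong[of _ _ "emeasure ?N"]) auto
    also have "\<dots> = emeasure ?N (A \<inter> ?I) + emeasure ?N (- ?I \<inter> A)"
      using A sets_N by (intro plus_emeasure[symmetric]) auto
    also have "emeasure ?N (A \<inter> ?I) = (\<integral>\<^sup>+x. ennreal (p x) * indicator (A \<inter> ?I) x \<partial>lborel)"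
      unfolding p by (rule position_law_interior[OF t AI]) auto
    also have "\<dots> = (\<integral>\<^sup>+x. ennreal (p x) * indicator A x \<partial>lborel)"
      by (intro nn_integral_cong) (auto simp: indicator_def p)
    also have "\<dots> = emeasure (density lborel (\<lambda>x. ennreal (p x))) A"
      using p_meas A by (intro emeasure_density[symmetric]) auto
    finally show ?thesis by (simp add: \<nu>[OF A])
  qed
  have "emeasure \<nu> (- ?Z) = 0"
  proof -
    have "emeasure \<nu> (- ?Z) = emeasure ?N (- ?I \<inter> - ?Z)" by (rule \<nu>) auto
    also have "- ?I \<inter> - ?Z = - {- v2 * t..v1 * t}"
    proof -
      have "0 < v2 * t" "0 < v1 * t" using t positive by simp_all
      thus ?thesis by auto
    qed
    finally show ?thesis using position_law_outside[OF t] by simp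
  qed
  moreover have "sets \<nu> = sets borel" using sets_N by (simp add: \<nu>_def)
  moreover have "?Z \<in> null_sets lborel" by (intro finite_imp_null_set_lborel) simp
  ultimately show ?thesis
    unfolding p_def[symmetric] has_ac_component_def using p_meas p_nonneg split by blast
qed

end

section \<open>The density series\<close>

context ml_telegraph begin

lemma forward_term_eq:
  assumes \<theta>: "0 < \<theta>" "\<theta> < t"
  shows "forward_term t n j \<theta> = real ((n - 1) choose j)
      * pochhammer ((b + c) / c) (j + 1) * pochhammer (r / c) (n - j - 1)
      * inverse (pochhammer ((b + r + c) / c) n)
      * ((\<mu> * (t - \<theta>) powr \<alpha>) powr (r / c + real (n - j - 1)) / (t - \<theta>))
      * (lam * \<theta> powr \<alpha>) powr (b / c + real j + 1)
      * ml3 \<alpha> (\<alpha> * (r / c + real (n - j - 1))) (r / c + real (n - j - 1))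
          (- \<mu> * (t - \<theta>) powr \<alpha>)
      * ml3 \<alpha> (\<alpha> * (b / c + real j + 1) + 1) (b / c + real j + 2)
          (- lam * \<theta> powr \<alpha>)"
proof -
  have j: "b / c + real (Suc j) = b / c + real j + 1" "b / c + real j + 1 + 1 = b / c + real j + 2"
    "n - Suc j = n - j - 1" by simp_all
  have w: "0 < t - \<theta>" using \<theta> by simp
  show ?thesis
    unfolding forward_term_def forward_coeff_def j gml_weighted(1)[OF positive(4) w]
      gml_weighted(3)[OF positive(3) \<theta>(1)]
    by (simp only: mult_ac)
qed

lemma backward_term_eq:
  assumes \<theta>: "0 < \<theta>" "\<theta> < t" and j: "j < n - 1"
  shows "backward_term t n j \<theta> = real ((n - 1) choose j)
      * pochhammer ((b + c) / c) j * pochhammer (r / c) (n - j)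
      * inverse (pochhammer ((b + r + c) / c) n)
      * ((lam * \<theta> powr \<alpha>) powr (b / c + real j + 1) / \<theta>)
      * (\<mu> * (t - \<theta>) powr \<alpha>) powr (r / c + real (n - j - 1))
      * ml3 \<alpha> (\<alpha> * (b / c + real j + 1)) (b / c + real j + 1)
          (- lam * \<theta> powr \<alpha>)
      * ml3 \<alpha> (\<alpha> * (r / c + real (n - j - 1)) + 1) (r / c + real (n - j))
          (- \<mu> * (t - \<theta>) powr \<alpha>)"
proof -
  have "n - Suc j \<noteq> 0" using j by simp
  hence gap: "L.gap (n - Suc j) s = gml_gap \<alpha> \<mu> (r / c + real (n - Suc j)) s" for s
    by (simp only: L.gap_def if_False)
  have eqs: "b / c + real (Suc j) = b / c + real j + 1" "n - Suc j = n - j - 1"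
    "r / c + real (n - j - 1) + 1 = r / c + real (n - j)" using j by auto
  have w: "0 < t - \<theta>" using \<theta> by simp
  show ?thesis
    unfolding backward_term_def backward_coeff_def gap
    unfolding eqs gml_weighted(1)[OF positive(3) \<theta>(1)]
      gml_weighted(3)[OF positive(4) w]
    by (simp only: mult_ac)
qed

lemma backward_term_last:
  assumes \<theta>: "0 < \<theta>" "\<theta> < t" and n: "1 \<le> n"
  shows "backward_term t n (n - 1) \<theta> = pochhammer ((b + c) / c) (n - 1)
      * inverse (pochhammer ((b + r + c) / c) n)
      * (r * (lam * \<theta> powr \<alpha>) powr (b / c + real n) / (c * \<theta>))
      * ml3 \<alpha> (\<alpha> * (b / c + real n)) (b / c + real n) (- lam * \<theta> powr \<alpha>)
      * \<P>(\<omega> in M. L 1 \<omega> > t - \<theta>)"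
proof -
  have eqs: "Suc (n - 1) = n" "n - (n - 1) = Suc 0" "n - n = 0" using n by simp_all
  have gap: "L.gap 0 (t - \<theta>) = \<P>(\<omega> in M. L 1 \<omega> > t - \<theta>)" by (simp add: L.gap_def)
  show ?thesis
    unfolding backward_term_def backward_coeff_def eqs gap gml_weighted(1)[OF positive(3) \<theta>(1)]
    by (simp add: field_simps)
qed

lemma forward_has_sum:
  assumes \<theta>: "0 < \<theta>" "\<theta> < t"
  shows "((\<lambda>n. \<Sum>j = 0..n - 2. forward_term t n j \<theta>) has_sum forward_sum t \<theta>) {2..}"
proof -
  have "((\<lambda>n. forward_row t n \<theta>) has_sum forward_sum t \<theta>) UNIV"
    using row_summable(1)[OF \<theta>] unfolding forward_sum_def
    by (intro norm_summable_imp_has_sum) (auto intro: summable_sums summable_rabs_cancel)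
  also have "?this \<longleftrightarrow> ((\<lambda>n. \<Sum>j = 0..n - 2. forward_term t n j \<theta>) has_sum forward_sum t \<theta>) {2..}"
  proof (rule has_sum_cong_neutral)
    fix n :: nat
    show "forward_row t n \<theta> = 0" if "n \<in> UNIV - {2..}" using that by (simp add: forward_row_def)
    show "forward_row t n \<theta> = (\<Sum>j = 0..n - 2. forward_term t n j \<theta>)" if "n \<in> UNIV \<inter> {2..}"
    proof -
      have "{..<n - 1} = {0..n - 2}" using that by auto
      thus ?thesis by (simp add: forward_row_def)
    qed
  qed simp
  finally show ?thesis .
qed

text \<open>The last term of each row, with the survival function of the first backward waiting time, is
  split off. All terms are nonnegative, so both parts inherit summability from the rows.\<close>

lemma backward_has_sum:
  assumes \<theta>: "0 < \<theta>" "\<theta> < t"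
  obtains B1 B2 where "((\<lambda>n. backward_term t n (n - 1) \<theta>) has_sum B1) {1..}"
    "((\<lambda>n. \<Sum>j = 0..n - 2. backward_term t n j \<theta>) has_sum B2) {2..}"
    "backward_sum t \<theta> = B1 + B2"
proof -
  define f where "f n = (if n = 0 then 0 else backward_term t n (n - 1) \<theta>)" for n
  define g where "g n = (\<Sum>j<n - 1. backward_term t n j \<theta>)" for n
  have row: "backward_row t n \<theta> = f n + g n" for n
  proof (cases n)
    case (Suc m)
    thus ?thesis by (simp add: backward_row_def f_def g_def)
  qed (simp add: backward_row_def f_def g_def)
  have f0: "0 \<le> f n" and g0: "0 \<le> g n" for n
    using term_nonneg(2)[OF \<theta>] by (auto simp: f_def g_def intro!: sum_nonneg)
  have sf: "summable (\<lambda>n. \<bar>f n\<bar>)" and sg: "summable (\<lambda>n. \<bar>g n\<bar>)"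
    using f0 g0 by (auto intro!: summable_comparison_test'[OF row_summable(2)[OF \<theta>]] simp: row)
  have "(f has_sum suminf f) UNIV"
    using sf by (intro norm_summable_imp_has_sum) (auto intro: summable_sums summable_rabs_cancel)
  also have "?this \<longleftrightarrow> ((\<lambda>n. backward_term t n (n - 1) \<theta>) has_sum suminf f) {1..}"
    by (rule has_sum_cong_neutral) (auto simp: f_def)
  finally have F: "((\<lambda>n. backward_term t n (n - 1) \<theta>) has_sum suminf f) {1..}" .
  have "(g has_sum suminf g) UNIV"
    using sg by (intro norm_summable_imp_has_sum) (auto intro: summable_sums summable_rabs_cancel)
  also have "?this \<longleftrightarrow> ((\<lambda>n. \<Sum>j = 0..n - 2. backward_term t n j \<theta>) has_sum suminf g) {2..}"
  proof (rule has_sum_cong_neutral)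
    fix n :: nat
    show "g n = 0" if "n \<in> UNIV - {2..}" using that by (simp add: g_def)
    show "g n = (\<Sum>j = 0..n - 2. backward_term t n j \<theta>)" if "n \<in> UNIV \<inter> {2..}"
    proof -
      have "{..<n - 1} = {0..n - 2}" using that by auto
      thus ?thesis by (simp add: g_def)
    qed
  qed simp
  finally have G: "((\<lambda>n. \<Sum>j = 0..n - 2. backward_term t n j \<theta>) has_sum suminf g) {2..}" .
  have "backward_sum t \<theta> = suminf f + suminf g"
    unfolding backward_sum_def row
    using suminf_add[OF summable_rabs_cancel[OF sf] summable_rabs_cancel[OF sg]] by simp
  from that[OF F G this] show thesis .
qed

end

theorem theorem4p1:
  fixes M :: "'a measure"
    and \<alpha> v1 v2 lam \<mu> b r c t x \<theta> :: real
    and Y :: "nat \<Rightarrow> 'a \<Rightarrow> nat"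
    and R L :: "nat \<Rightarrow> 'a \<Rightarrow> real"
  assumes "ml_telegraph M \<alpha> v1 v2 lam \<mu> b r c Y R L"
    and "0 < t" and "- v2 * t < x" and "x < v1 * t"
    and "\<theta> = (v2 * t + x) / (v1 + v2)"
  shows
    "has_ac_component (position_law M v1 v2 Y R L t)
       (\<lambda>y. if - v2 * t < y \<and> y < v1 * t
             then forward_density M v1 v2 Y R L y t + backward_density M v1 v2 Y R L y t
             else 0)
     \<and>
     joint_cdf M v1 v2 Y R L t v1 differentiable (at x)
     \<and>
     (\<exists>F. ((\<lambda>n. \<Sum>j = 0..n - 2.
              real ((n - 1) choose j)
              * pochhammer ((b + c) / c) (j + 1) * pochhammer (r / c) (n - j - 1)
              * inverse (pochhammer ((b + r + c) / c) n)
              * ((\<mu> * (t - \<theta>) powr \<alpha>) powr (r / c + real (n - j - 1)) / (t - \<theta>))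
              * (lam * \<theta> powr \<alpha>) powr (b / c + real j + 1)
              * ml3 \<alpha> (\<alpha> * (r / c + real (n - j - 1))) (r / c + real (n - j - 1))
                  (- \<mu> * (t - \<theta>) powr \<alpha>)
              * ml3 \<alpha> (\<alpha> * (b / c + real j + 1) + 1) (b / c + real j + 2)
                  (- lam * \<theta> powr \<alpha>))
            has_sum F) {2..}
        \<and> forward_density M v1 v2 Y R L x t = 1 / (v1 + v2) * F)
     \<and>
     joint_cdf M v1 v2 Y R L t (- v2) differentiable (at x)
     \<and>
     (\<exists>B1 B2. ((\<lambda>n. pochhammer ((b + c) / c) (n - 1)
              * inverse (pochhammer ((b + r + c) / c) n)
              * (r * (lam * \<theta> powr \<alpha>) powr (b / c + real n) / (c * \<theta>))
              * ml3 \<alpha> (\<alpha> * (b / c + real n)) (b / c + real n) (- lam * \<theta> powr \<alpha>)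
              * \<P>(\<omega> in M. L 1 \<omega> > t - \<theta>))
            has_sum B1) {1..}
        \<and> ((\<lambda>n. \<Sum>j = 0..n - 2.
              real ((n - 1) choose j)
              * pochhammer ((b + c) / c) j * pochhammer (r / c) (n - j)
              * inverse (pochhammer ((b + r + c) / c) n)
              * ((lam * \<theta> powr \<alpha>) powr (b / c + real j + 1) / \<theta>)
              * (\<mu> * (t - \<theta>) powr \<alpha>) powr (r / c + real (n - j - 1))
              * ml3 \<alpha> (\<alpha> * (b / c + real j + 1)) (b / c + real j + 1)
                  (- lam * \<theta> powr \<alpha>)
              * ml3 \<alpha> (\<alpha> * (r / c + real (n - j - 1)) + 1) (r / c + real (n - j))
                  (- \<mu> * (t - \<theta>) powr \<alpha>))
            has_sum B2) {2..}
        \<and> backward_density M v1 v2 Y R L x t = 1 / (v1 + v2) * (B1 + B2))"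
proof -
  interpret ml_telegraph M \<alpha> v1 v2 lam \<mu> b r c Y R L by fact
  note t = assms(2) and x = assms(3,4)
  have \<theta>: "0 < \<theta>" "\<theta> < t" using forward_share_range[OF x] by (simp_all add: assms(5))
  note dens = density_eqs[OF t x, folded assms(5)]
  have diff: "joint_cdf M v1 v2 Y R L t v1 differentiable (at x)"
    "joint_cdf M v1 v2 Y R L t (- v2) differentiable (at x)"
    using joint_cdf_derivatives[OF t x] by (auto simp: real_differentiable_def)
  have fwd: "forward_density M v1 v2 Y R L x t = 1 / (v1 + v2) * forward_sum t \<theta>"
    using dens(1) by simp
  obtain B1 B2 where B: "((\<lambda>n. backward_term t n (n - 1) \<theta>) has_sum B1) {1..}"
    "((\<lambda>n. \<Sum>j = 0..n - 2. backward_term t n j \<theta>) has_sum B2) {2..}"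
    "backward_sum t \<theta> = B1 + B2"
    by (rule backward_has_sum[OF \<theta>])
  have bwd: "backward_density M v1 v2 Y R L x t = 1 / (v1 + v2) * (B1 + B2)"
    using dens(2) B(3) by simp
  have in_row: "j < n - 1" if "n \<in> {2..}" "j \<in> {0..n - 2}" for n j :: nat
    using that by auto
  show ?thesis
    by (intro conjI exI, rule position_law_ac_component[OF t], rule diff(1),
        rule forward_has_sum[OF \<theta>, unfolded forward_term_eq[OF \<theta>]], rule fwd, rule diff(2),
        rule has_sum_cong[THEN iffD1, OF _ B(1)], simp only: atLeast_iff backward_term_last[OF \<theta>],
        rule has_sum_cong[THEN iffD1, OF _ B(2)],
        intro sum.cong refl backward_term_eq[OF \<theta>] in_row, assumption, assumption, rule bwd)
qed

end
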